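(* Let $l,m,k_1,k_2$ be integers with $|l|>m>0$, $k_1>0$, $k_2>0$. The groups $G_1=G(l,m;k_1)$ and $G_2=G(l,m;k_2)$ are isomorphic if and only if one of the following holds: (2.1) $k_1=k_2$; (2.2) $m>1$, both $k_1$ and $k_2$ are divisible by $\gcd(l,m)$, and $k_1/k_2=\pm (l/m)^p$ for some integer $p\neq 0$; (2.3) $m=1$ and the rational number $k_1/k_2$ is an $l$-number.
   Context: For nonzero integers $l,m,k$, $G(l,m;k)$ denotes the one-relator group $\langle a,t \mid t^{-1}a^{-k}ta^{l}t^{-1}a^{k}t=a^{m}\rangle$. For a nonzero integer $n$, a nonzero integer $q$ is called an $n$-number if every prime divisor of $q$ divides $n$; a nonzero rational number is called an $n$-number if the numerator and the denominator of its irreducible fraction representation are both $n$-numbers. *)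

theory Defs
  imports Complex_Main "HOL-Algebra.Group" "HOL-Computational_Algebra.Primes"
begin

datatype gen = GA | GT

text \<open>A letter is a generator together with an exponent sign flag (True = inverse).
  Words are lists of letters.\<close>
type_synonym word = "(gen \<times> bool) list"

inductive_set pres_rel :: "word set \<Rightarrow> (word \<times> word) set" for R :: "word set" where
  pr_refl:   "(u, u) \<in> pres_rel R"
| pr_sym:    "(u, v) \<in> pres_rel R \<Longrightarrow> (v, u) \<in> pres_rel R"
| pr_trans:  "(u, v) \<in> pres_rel R \<Longrightarrow> (v, w) \<in> pres_rel R \<Longrightarrow> (u, w) \<in> pres_rel R"
| pr_cancel: "(u @ [(x, b), (x, \<not> b)] @ v, u @ v) \<in> pres_rel R"
| pr_rel:    "r \<in> R \<Longrightarrow> (u @ r @ v, u @ v) \<in> pres_rel R"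

definition pres_group :: "word set \<Rightarrow> word set monoid" where
  "pres_group R = \<lparr> carrier = UNIV // pres_rel R,
      monoid.mult = (\<lambda>X Y. pres_rel R `` {(SOME u. u \<in> X) @ (SOME v. v \<in> Y)}),
      one = pres_rel R `` {[]} \<rparr>"

definition gpow :: "gen \<Rightarrow> int \<Rightarrow> word" where
  "gpow g n = (if n \<ge> 0 then replicate (nat n) (g, False) else replicate (nat (- n)) (g, True))"

text \<open>G(l,m;k) = < a, t | t^-1 a^-k t a^l t^-1 a^k t = a^m >, relator
  t^-1 a^-k t a^l t^-1 a^k t a^-m.\<close>
definition G :: "int \<Rightarrow> int \<Rightarrow> int \<Rightarrow> word set monoid" where
  "G l m k = pres_group {gpow GT (-1) @ gpow GA (- k) @ gpow GT 1 @ gpow GA l @ gpow GT (-1)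
                         @ gpow GA k @ gpow GT 1 @ gpow GA (- m)}"

definition n_number_int :: "int \<Rightarrow> int \<Rightarrow> bool" where
  "n_number_int n q \<longleftrightarrow> q \<noteq> 0 \<and> (\<forall>p::int. prime p \<longrightarrow> p dvd q \<longrightarrow> p dvd n)"

definition n_number_rat :: "int \<Rightarrow> rat \<Rightarrow> bool" where
  "n_number_rat n r \<longleftrightarrow> r \<noteq> 0 \<and>
     (case quotient_of r of (a, b) \<Rightarrow> n_number_int n a \<and> n_number_int n b)"

end

theory Submission
  imports Defs "HOL-Algebra.Elementary_Groups" "HOL-Algebra.Bij"
begin

text \<open>
  With \<open>b = t\<inverse> a\<^sup>k t\<close> the group \<open>G(l,m;k)\<close> is an HNN extension, with stable letter \<open>t\<close> conjugating
  \<open>a\<^sup>k\<close> to \<open>b\<close>, of the Baumslag-Solitar group \<open>\<langle>a, b | b\<inverse> a\<^sup>l b = a\<^sup>m\<rangle>\<close>, which is itself an HNN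
  extension of \<open>\<langle>a\<rangle>\<close>. Since \<open>\<bar>l\<bar> \<noteq> m\<close>, an element whose \<open>l\<close>-th and \<open>m\<close>-th powers are conjugate has
  translation length 0, and by Britton's lemma it is conjugate to a power of \<open>a\<close>. Hence an isomorphism
  sends \<open>a\<close> to a conjugate of some \<open>a\<^sup>r\<close>. The image \<open>\<beta>\<close> of \<open>b\<close> then conjugates \<open>a\<^sup>r\<^sup>l\<close> to \<open>a\<^sup>r\<^sup>m\<close>,
  up to conjugacy, so it lies in the Baumslag-Solitar subgroup and has \<open>b\<close>-exponent 1. It is also
  conjugate to a power of \<open>a\<close>, which forces \<open>\<beta>\<close> to be conjugate to \<open>b\<close>. Consequently
  \<open>a^(r k\<^sub>1)\<close> is conjugate to \<open>a^k\<^sub>2\<close>, and powers of \<open>a\<close> are conjugate only inside the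
  Baumslag-Solitar group, where the exponents differ by a power of \<open>l / m\<close>.
\<close>

section \<open>Group computations\<close>

text \<open>Britton's lemma has to be established for bare presentations. Each extension is
  therefore made to act on its own normal forms, the base group by left multiplication and the
  stable letter by an explicit permutation, and the relators are checked on these permutations. One
  abstract HNN development serves twice, over the integers and over the Baumslag-Solitar group. The
  exponent \<open>r\<close> is controlled by running the argument for the inverse isomorphism as
  well, which makes \<open>a\<close> conjugate to some \<open>a^(r s)\<close>. If
  \<open>m > 1\<close>, only \<open>r = 1\<close> and \<open>r = -1\<close> remain; if
  \<open>m = 1\<close>, then \<open>r\<close> only has to divide a power of \<open>l\<close>. Here
  (2.2) and (2.3) part. The condition on \<open>gcd(l,m)\<close> arises because distinct conjugate
  powers of \<open>a\<close> have exponents divisible by \<open>l\<close> or \<open>m\<close>. For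
  the converse, put \<open>b = t^-1 a^k t\<close>. Replacing \<open>t\<close> by
  \<open>b^-1 t\<close> trades \<open>k = l s\<close> for \<open>m s\<close>, inverting
  \<open>a\<close> changes the sign of \<open>k\<close>, and for \<open>m = 1\<close> the equation
  \<open>a = (b^-1 a^(l/p) b)^p\<close> provides a \<open>p\<close>-th root of \<open>a\<close> for
  each divisor \<open>p\<close> of \<open>l\<close>, which trades \<open>p k\<close> for
  \<open>k\<close>.\<close>

context group
begin

lemma mult_inv_mult [simp]:
  "x \<in> carrier G \<Longrightarrow> y \<in> carrier G \<Longrightarrow> x \<otimes> (inv x \<otimes> y) = y"
  "x \<in> carrier G \<Longrightarrow> y \<in> carrier G \<Longrightarrow> inv x \<otimes> (x \<otimes> y) = y"
  by (simp_all add: m_assoc [symmetric])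

text \<open>Conjugacy is mostly carried as \<open>x \<otimes> g = g \<otimes> y\<close>: this form
  passes through homomorphisms and chains by associativity alone, with no inverse to cancel.\<close>

lemma conj_eq_iff:
  assumes "x \<in> carrier G" "g \<in> carrier G" "y \<in> carrier G"
  shows "inv g \<otimes> x \<otimes> g = y \<longleftrightarrow> x \<otimes> g = g \<otimes> y"
proof
  assume "inv g \<otimes> x \<otimes> g = y"
  then have "g \<otimes> (inv g \<otimes> x \<otimes> g) = g \<otimes> y" by simp
  then show "x \<otimes> g = g \<otimes> y" using assms by (simp add: m_assoc)
qed (use assms in \<open>simp add: m_assoc\<close>)

lemma conj_int_pow:
  fixes n :: int
  assumes "x \<in> carrier G" "g \<in> carrier G" "y \<in> carrier G" "x \<otimes> g = g \<otimes> y"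
  shows "x [^] n \<otimes> g = g \<otimes> y [^] n"
proof -
  have nat: "x [^] k \<otimes> g = g \<otimes> y [^] k" for k :: nat
  proof (induction k)
    case (Suc k)
    have "x [^] Suc k \<otimes> g = x [^] k \<otimes> (x \<otimes> g)"
      using assms by (simp add: m_assoc)
    also have "\<dots> = (x [^] k \<otimes> g) \<otimes> y"
      using assms by (simp add: m_assoc)
    finally show ?case
      using assms Suc by (simp add: m_assoc)
  qed (use assms in auto)
  show ?thesis
  proof (cases n rule: int_cases2)
    case (nonneg k)
    then show ?thesis using nat by (simp add: int_pow_int)
  next
    case (nonpos k)
    have "inv (x [^] k) \<otimes> g = inv (x [^] k) \<otimes> ((g \<otimes> y [^] k) \<otimes> inv (y [^] k))"
      using assms by (simp add: m_assoc)
    also have "\<dots> = g \<otimes> inv (y [^] k)"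
      unfolding nat [symmetric] using assms by (simp add: m_assoc)
    finally show ?thesis
      using assms nonpos by (simp add: int_pow_neg_int)
  qed
qed

lemma conj_int_pow':
  fixes n :: int
  assumes "x \<in> carrier G" "g \<in> carrier G"
  shows "(inv g \<otimes> x \<otimes> g) [^] n = inv g \<otimes> x [^] n \<otimes> g"
proof -
  have "x \<otimes> g = g \<otimes> (inv g \<otimes> x \<otimes> g)"
    using assms by (simp add: m_assoc)
  from conj_int_pow [OF _ _ _ this, of n] assms show ?thesis
    by (metis conj_eq_iff inv_closed m_closed int_pow_closed)
qed

end

section \<open>Groups given by generators and relators\<close>

definition cls :: "word set \<Rightarrow> word \<Rightarrow> word set" where
  "cls R u = pres_rel R `` {u}"

fun eval_word :: "('g, 'm) monoid_scheme \<Rightarrow> (gen \<Rightarrow> 'g) \<Rightarrow> word \<Rightarrow> 'g" where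
  "eval_word K f [] = \<one>\<^bsub>K\<^esub>"
| "eval_word K f ((x, b) # w) = (if b then inv\<^bsub>K\<^esub> f x else f x) \<otimes>\<^bsub>K\<^esub> eval_word K f w"

lemma equiv_pres_rel: "equiv UNIV (pres_rel R)"
  by (auto simp: equiv_def refl_on_def sym_def trans_def intro: pres_rel.intros)

lemma pres_rel_context: "(u, v) \<in> pres_rel R \<Longrightarrow> (p @ u @ q, p @ v @ q) \<in> pres_rel R"
proof (induction rule: pres_rel.induct)
  case (pr_cancel u x b v)
  show ?case using pres_rel.pr_cancel [of "p @ u" x b "v @ q" R] by simp
next
  case (pr_rel r u v)
  then show ?case using pres_rel.pr_rel [of r R "p @ u" "v @ q"] by simp
qed (auto intro: pres_rel.intros)

lemma pres_rel_append:
  assumes "(u, u') \<in> pres_rel R" "(v, v') \<in> pres_rel R"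
  shows "(u @ v, u' @ v') \<in> pres_rel R"
  using pres_rel_context [OF assms(1), of "[]" v] pres_rel_context [OF assms(2), of u' "[]"]
  by (auto intro: pres_rel.intros)

lemma cls_eq_iff: "cls R u = cls R v \<longleftrightarrow> (u, v) \<in> pres_rel R"
  unfolding cls_def using eq_equiv_class_iff [OF equiv_pres_rel] by blast

text \<open>Multiplication in \<open>pres_group\<close> picks representatives with
  \<open>SOME\<close>; this makes the choice immaterial up to \<open>pres_rel\<close>.\<close>

lemma some_in_cls: "(u, SOME v. v \<in> cls R u) \<in> pres_rel R"
proof -
  have "u \<in> cls R u" by (simp add: cls_def pres_rel.pr_refl)
  then have "(SOME v. v \<in> cls R u) \<in> cls R u" by (rule someI)
  then show ?thesis by (simp add: cls_def)
qed

lemma carrier_pres: "carrier (pres_group R) = range (cls R)"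
  by (auto simp: pres_group_def quotient_def cls_def)

lemma cls_in_carrier [simp]: "cls R u \<in> carrier (pres_group R)"
  by (simp add: carrier_pres)

lemma mult_cls [simp]: "cls R u \<otimes>\<^bsub>pres_group R\<^esub> cls R v = cls R (u @ v)"
proof -
  have "cls R u \<otimes>\<^bsub>pres_group R\<^esub> cls R v
      = cls R ((SOME w. w \<in> cls R u) @ (SOME w. w \<in> cls R v))"
    by (simp add: pres_group_def cls_def)
  also have "\<dots> = cls R (u @ v)"
    unfolding cls_eq_iff by (intro pres_rel.pr_sym [OF pres_rel_append] some_in_cls)
  finally show ?thesis .
qed

lemma one_pres: "\<one>\<^bsub>pres_group R\<^esub> = cls R []"
  by (simp add: pres_group_def cls_def)

definition inv_word :: "word \<Rightarrow> word" where
  "inv_word u = rev (map (\<lambda>(x, b). (x, \<not> b)) u)"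

lemma inv_word_append: "(inv_word u @ u, []) \<in> pres_rel R"
proof (induction u)
  case (Cons s u)
  obtain x b where s: "s = (x, b)" by force
  have "(inv_word u @ [(x, \<not> b), (x, b)] @ u, inv_word u @ u) \<in> pres_rel R"
    using pres_rel.pr_cancel [of "inv_word u" x "\<not> b" u R] by simp
  then show ?case
    using Cons by (auto simp: s inv_word_def intro: pres_rel.pr_trans)
qed (auto simp: inv_word_def intro: pres_rel.intros)

lemma group_pres: "group (pres_group R)"
proof (rule groupI)
  fix X Y Z assume "X \<in> carrier (pres_group R)" "Y \<in> carrier (pres_group R)"
    "Z \<in> carrier (pres_group R)"
  then show "X \<otimes>\<^bsub>pres_group R\<^esub> Y \<otimes>\<^bsub>pres_group R\<^esub> Z
    = X \<otimes>\<^bsub>pres_group R\<^esub> (Y \<otimes>\<^bsub>pres_group R\<^esub> Z)"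
    by (auto simp: carrier_pres)
next
  fix X assume "X \<in> carrier (pres_group R)"
  then obtain u where "X = cls R u" by (auto simp: carrier_pres)
  then have "cls R (inv_word u) \<otimes>\<^bsub>pres_group R\<^esub> X = \<one>\<^bsub>pres_group R\<^esub>"
    by (simp add: one_pres cls_eq_iff inv_word_append)
  then show "\<exists>Y\<in>carrier (pres_group R). Y \<otimes>\<^bsub>pres_group R\<^esub> X = \<one>\<^bsub>pres_group R\<^esub>"
    by (intro bexI [of _ "cls R (inv_word u)"]) auto
qed (auto simp: carrier_pres one_pres)

definition gen_cls :: "word set \<Rightarrow> gen \<Rightarrow> word set" where
  "gen_cls R x = cls R [(x, False)]"

lemma gen_cls_closed [simp]: "gen_cls R x \<in> carrier (pres_group R)"
  by (simp add: gen_cls_def)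

lemma inv_gen_cls: "inv\<^bsub>pres_group R\<^esub> gen_cls R x = cls R [(x, True)]"
proof (rule group.inv_equality [OF group_pres])
  show "cls R [(x, True)] \<otimes>\<^bsub>pres_group R\<^esub> gen_cls R x = \<one>\<^bsub>pres_group R\<^esub>"
    using pres_rel.pr_cancel [of "[]" x True "[]" R]
    by (simp add: gen_cls_def one_pres cls_eq_iff)
qed simp_all

lemma eval_gen_cls: "eval_word (pres_group R) (gen_cls R) u = cls R u"
proof (induction u)
  case (Cons s u)
  then show ?case by (cases s) (simp add: inv_gen_cls, simp add: gen_cls_def)
qed (simp add: one_pres)

lemma eval_relator: "r \<in> R \<Longrightarrow> eval_word (pres_group R) (gen_cls R) r = \<one>\<^bsub>pres_group R\<^esub>"
  using pres_rel.pr_rel [of r R "[]" "[]"] by (simp add: eval_gen_cls one_pres cls_eq_iff)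

context group
begin

lemma eval_closed [simp]: "(\<And>x. f x \<in> carrier G) \<Longrightarrow> eval_word G f u \<in> carrier G"
  by (induction u) auto

lemma eval_append:
  "(\<And>x. f x \<in> carrier G) \<Longrightarrow> eval_word G f (u @ v) = eval_word G f u \<otimes> eval_word G f v"
  by (induction u) (auto simp: m_assoc)

lemma eval_gpow:
  assumes f: "\<And>x. f x \<in> carrier G"
  shows "eval_word G f (gpow x n) = f x [^] n"
proof -
  have Suc2: "f x \<otimes> f x [^] k = f x [^] Suc k" "inv f x \<otimes> inv f x [^] k = inv f x [^] Suc k" for k :: nat
    using f by (simp_all only: nat_pow_Suc2 inv_closed)
  have 1: "eval_word G f (replicate k (x, False)) = f x [^] k" for k
    using f by (induction k) (simp_all add: Suc2 del: nat_pow_Suc Group.nat_pow_Suc)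
  have 2: "eval_word G f (replicate k (x, True)) = inv (f x) [^] k" for k
    using f by (induction k) (simp_all add: Suc2 del: nat_pow_Suc Group.nat_pow_Suc)
  show ?thesis
    using f by (cases n rule: int_cases2)
      (auto simp: gpow_def 1 2 int_pow_int int_pow_neg_int nat_pow_inv)
qed

lemma eval_pres_rel:
  assumes "(u, v) \<in> pres_rel R" "\<And>x. f x \<in> carrier G" "\<And>r. r \<in> R \<Longrightarrow> eval_word G f r = \<one>"
  shows "eval_word G f u = eval_word G f v"
  using assms by (induction rule: pres_rel.induct) (auto simp: eval_append)

text \<open>Von Dyck's theorem. It is the source of the exponent sum, of the actions on normal forms
  and of the explicit isomorphisms.\<close>

lemma pres_lift:
  assumes f: "\<And>x. f x \<in> carrier G" "\<And>r. r \<in> R \<Longrightarrow> eval_word G f r = \<one>"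
  obtains h where "h \<in> hom (pres_group R) G" "\<And>x. h (gen_cls R x) = f x"
proof -
  define h where "h X = eval_word G f (SOME u. u \<in> X)" for X
  have h: "h (cls R u) = eval_word G f u" for u
    unfolding h_def by (rule eval_pres_rel [OF some_in_cls f, symmetric])
  show ?thesis
  proof
    show "h \<in> hom (pres_group R) G"
      using f by (auto simp: hom_def carrier_pres h eval_append)
    show "h (gen_cls R x) = f x" for x
      using f by (simp add: gen_cls_def h)
  qed
qed

end

lemma hom_eval:
  assumes "group K" "group L" "h \<in> hom K L" "\<And>x. f x \<in> carrier K"
  shows "h (eval_word K f u) = eval_word L (\<lambda>x. h (f x)) u"
proof -
  interpret group_hom K L h
    using assms by (simp add: group_hom_def group_hom_axioms_def)
  interpret K: group K by fact
  show ?thesis using assms(4) by (induction u) auto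
qed

lemma pres_hom_unique:
  assumes "group L" "h \<in> hom (pres_group R) L" "h' \<in> hom (pres_group R) L"
    "\<And>x. h (gen_cls R x) = h' (gen_cls R x)" "X \<in> carrier (pres_group R)"
  shows "h X = h' X"
proof -
  obtain u where "X = cls R u" using assms(5) by (auto simp: carrier_pres)
  then show ?thesis
    using hom_eval [OF group_pres assms(1,2), of "gen_cls R" u]
      hom_eval [OF group_pres assms(1,3), of "gen_cls R" u] assms(4)
    by (simp add: eval_gen_cls)
qed

lemma pres_generate: "X \<in> carrier (pres_group R) \<Longrightarrow> X \<in> generate (pres_group R) (range (gen_cls R))"
proof -
  assume "X \<in> carrier (pres_group R)"
  then obtain u where "X = eval_word (pres_group R) (gen_cls R) u"
    by (auto simp: carrier_pres eval_gen_cls)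
  moreover have "eval_word (pres_group R) (gen_cls R) u \<in> generate (pres_group R) (range (gen_cls R))"
  proof (induction u)
    case (Cons s u)
    have "(if snd s then inv\<^bsub>pres_group R\<^esub> gen_cls R (fst s) else gen_cls R (fst s))
        \<in> generate (pres_group R) (range (gen_cls R))"
      by (auto intro: generate.incl generate.inv)
    then show ?case
      using generate.eng [OF _ Cons] by (cases s) auto
  qed (simp add: generate.one)
  ultimately show ?thesis by simp
qed

lemma pres_iso:
  assumes f: "f \<in> hom (pres_group R) (pres_group S)"
    and g: "g \<in> hom (pres_group S) (pres_group R)"
    and gf: "\<And>x. g (f (gen_cls R x)) = gen_cls R x"
    and fg: "\<And>x. f (g (gen_cls S x)) = gen_cls S x"
  shows "pres_group R \<cong> pres_group S"
proof -
  have "(g \<circ> f) X = (\<lambda>Y. Y) X" if "X \<in> carrier (pres_group R)" for X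
    by (rule pres_hom_unique [OF group_pres hom_compose [OF f g] _ _ that])
      (auto simp: gf hom_def)
  moreover have "(f \<circ> g) X = (\<lambda>Y. Y) X" if "X \<in> carrier (pres_group S)" for X
    by (rule pres_hom_unique [OF group_pres hom_compose [OF g f] _ _ that])
      (auto simp: fg hom_def)
  ultimately have "group_isomorphisms (pres_group R) (pres_group S) f g"
    using f g by (auto simp: group_isomorphisms_def)
  then show ?thesis
    using group_isomorphisms_imp_iso is_isoI by blast
qed

section \<open>HNN extensions: normal forms\<close>

lemma BijGroup_mult_apply:
  assumes "f \<in> carrier (BijGroup S)" "g \<in> carrier (BijGroup S)" "x \<in> S"
  shows "(f \<otimes>\<^bsub>BijGroup S\<^esub> g) x = f (g x)"
  using assms by (simp add: BijGroup_def compose_def)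

lemma BijGroup_apply_closed: "f \<in> carrier (BijGroup S) \<Longrightarrow> x \<in> S \<Longrightarrow> f x \<in> S"
  using Bij_imp_funcset by (force simp: BijGroup_def)

lemma BijGroup_eqI:
  assumes "f \<in> carrier (BijGroup S)" "g \<in> carrier (BijGroup S)" "\<And>x. x \<in> S \<Longrightarrow> f x = g x"
  shows "f = g"
  using assms by (auto simp: BijGroup_def Bij_def intro: extensionalityI)

lemma restrict_in_BijGroup:
  assumes "\<And>x. x \<in> S \<Longrightarrow> f x \<in> S" "\<And>x. x \<in> S \<Longrightarrow> g x \<in> S"
    "\<And>x. x \<in> S \<Longrightarrow> g (f x) = x" "\<And>x. x \<in> S \<Longrightarrow> f (g x) = x"
  shows "restrict f S \<in> carrier (BijGroup S)"
proof -
  have "bij_betw f S S"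
    by (rule bij_betw_byWitness [where f' = g]) (use assms in auto)
  then show ?thesis by (simp add: BijGroup_def Bij_def)
qed

text \<open>The stable letter \<open>t\<close> satisfies \<open>t d = \<theta> True d t\<close> for \<open>d \<in> D True\<close>. In general
  the flag \<open>e\<close> stands for the exponent \<open>1\<close> (True) or \<open>-1\<close> (False) of \<open>t\<close>, and
  \<open>t\<^sup>e d = \<theta> e d t\<^sup>e\<close> for \<open>d \<in> D e\<close>.\<close>
locale hnn_data = H: group H
  for H :: "('h, 'm) monoid_scheme" +
  fixes D :: "bool \<Rightarrow> 'h set" and \<theta> :: "bool \<Rightarrow> 'h \<Rightarrow> 'h"
  assumes subgroup_D: "subgroup (D e) H"
    and \<theta>_in: "x \<in> D e \<Longrightarrow> \<theta> e x \<in> D (\<not> e)"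
    and \<theta>_inverse: "x \<in> D e \<Longrightarrow> \<theta> (\<not> e) (\<theta> e x) = x"
    and \<theta>_mult: "x \<in> D e \<Longrightarrow> y \<in> D e \<Longrightarrow> \<theta> e (x \<otimes>\<^bsub>H\<^esub> y) = \<theta> e x \<otimes>\<^bsub>H\<^esub> \<theta> e y"
begin

lemma D_carrier [simp]: "x \<in> D e \<Longrightarrow> x \<in> carrier H"
  using subgroup.mem_carrier [OF subgroup_D] .

lemma D_one [simp]: "\<one>\<^bsub>H\<^esub> \<in> D e"
  using subgroup.one_closed [OF subgroup_D] .

lemma D_mult [simp]: "x \<in> D e \<Longrightarrow> y \<in> D e \<Longrightarrow> x \<otimes>\<^bsub>H\<^esub> y \<in> D e"
  using subgroup.m_closed [OF subgroup_D] .

lemma D_inv [simp]: "x \<in> D e \<Longrightarrow> inv\<^bsub>H\<^esub> x \<in> D e"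
  using subgroup.m_inv_closed [OF subgroup_D] .

lemma \<theta>_carrier [simp]: "x \<in> D e \<Longrightarrow> \<theta> e x \<in> carrier H"
  using \<theta>_in D_carrier by blast

lemma D_mult_left_iff: "x \<in> D e \<Longrightarrow> y \<in> carrier H \<Longrightarrow> x \<otimes>\<^bsub>H\<^esub> y \<in> D e \<longleftrightarrow> y \<in> D e"
  by (metis D_inv D_mult D_carrier H.mult_inv_mult(2))

lemma D_mult_right_iff: "x \<in> D e \<Longrightarrow> y \<in> carrier H \<Longrightarrow> y \<otimes>\<^bsub>H\<^esub> x \<in> D e \<longleftrightarrow> y \<in> D e"
  by (metis D_inv D_mult D_carrier H.inv_solve_right)

text \<open>The coset \<open>D e\<close> itself is represented by \<open>\<one>\<close>, so that
  \<open>rep e h = \<one>\<close> is a test for \<open>h \<in> D e\<close>. Elsewhere the choice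
  depends only on the right coset, whence \<open>rep_mult\<close>.\<close>

definition rep :: "bool \<Rightarrow> 'h \<Rightarrow> 'h" where
  "rep e h = (if h \<in> D e then \<one>\<^bsub>H\<^esub> else SOME c. c \<in> D e #>\<^bsub>H\<^esub> h)"

lemma rep_in_coset: "h \<in> carrier H \<Longrightarrow> rep e h \<in> D e #>\<^bsub>H\<^esub> h"
proof (cases "h \<in> D e")
  case True
  have "\<one>\<^bsub>H\<^esub> = inv\<^bsub>H\<^esub> h \<otimes>\<^bsub>H\<^esub> h" using True by simp
  then show ?thesis using True by (auto simp: rep_def r_coset_def intro!: bexI [of _ "inv\<^bsub>H\<^esub> h"])
next
  case False
  assume "h \<in> carrier H"
  then have "h \<in> D e #>\<^bsub>H\<^esub> h" using H.rcos_self subgroup_D by blast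
  then show ?thesis using False by (auto simp: rep_def intro: someI)
qed

lemma rep_decomp:
  assumes "h \<in> carrier H"
  obtains d where "d \<in> D e" "h = d \<otimes>\<^bsub>H\<^esub> rep e h" "rep e h \<in> carrier H"
proof -
  obtain d where d: "d \<in> D e" "rep e h = d \<otimes>\<^bsub>H\<^esub> h"
    using rep_in_coset [OF assms, of e] by (auto simp: r_coset_def)
  show ?thesis
    by (rule that [of "inv\<^bsub>H\<^esub> d"]) (use d assms in auto)
qed

lemma rep_closed [simp]: "h \<in> carrier H \<Longrightarrow> rep e h \<in> carrier H"
  using rep_decomp by blast

lemma rep_mult [simp]:
  assumes "d \<in> D e" "h \<in> carrier H"
  shows "rep e (d \<otimes>\<^bsub>H\<^esub> h) = rep e h"
proof -
  have "D e #>\<^bsub>H\<^esub> (d \<otimes>\<^bsub>H\<^esub> h) = D e #>\<^bsub>H\<^esub> h"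
    using assms H.repr_independence [of "d \<otimes>\<^bsub>H\<^esub> h" "D e" h] subgroup_D
    by (auto simp: r_coset_def)
  then show ?thesis using assms by (simp add: rep_def D_mult_left_iff)
qed

lemma rep_rep [simp]: "h \<in> carrier H \<Longrightarrow> rep e (rep e h) = rep e h"
  by (metis rep_decomp rep_mult)

lemma rep_D [simp]: "h \<in> D e \<Longrightarrow> rep e h = \<one>\<^bsub>H\<^esub>"
  by (simp add: rep_def)

text \<open>A list \<open>[(e\<^sub>1, c\<^sub>1), \<dots>, (e\<^sub>n, c\<^sub>n)]\<close> stands for the product \<open>t\<^sup>e\<^sup>1 c\<^sub>1 \<cdots> t\<^sup>e\<^sup>n c\<^sub>n\<close>.\<close>

definition red :: "bool \<times> 'h \<Rightarrow> bool \<times> 'h \<Rightarrow> bool" where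
  "red p q \<longleftrightarrow> (fst q \<noteq> fst p \<longrightarrow> snd p \<notin> D (fst p))"

text \<open>As every \<open>c\<close> is its own representative, \<open>successively red\<close>
  amounts to \<open>c\<close> being nontrivial wherever the sign of \<open>t\<close>
  changes.\<close>

definition NF :: "('h \<times> (bool \<times> 'h) list) set" where
  "NF = {(h, w). h \<in> carrier H \<and> (\<forall>(e, c)\<in>set w. c \<in> carrier H \<and> rep e c = c) \<and> successively red w}"

text \<open>Left multiplication by \<open>t^e\<close>: split \<open>h\<close> as
  \<open>(h c^-1) c\<close>, move the first factor across \<open>t^e\<close> by
  \<open>\<theta> e\<close>, then prefix \<open>t^e c\<close>, or cancel if \<open>c\<close> is
  trivial and the word begins with the opposite letter.\<close>

definition T :: "bool \<Rightarrow> 'h \<times> (bool \<times> 'h) list \<Rightarrow> 'h \<times> (bool \<times> 'h) list" where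
  "T e x = (let h = fst x; w = snd x; c = rep e h; d = \<theta> e (h \<otimes>\<^bsub>H\<^esub> inv\<^bsub>H\<^esub> c) in
     if c = \<one>\<^bsub>H\<^esub> \<and> w \<noteq> [] \<and> fst (hd w) \<noteq> e then (d \<otimes>\<^bsub>H\<^esub> snd (hd w), tl w)
     else (d, (e, c) # w))"

lemma NF_Nil [simp]: "(h, []) \<in> NF \<longleftrightarrow> h \<in> carrier H"
  by (simp add: NF_def)

lemma NF_Cons:
  "(h, (e, c) # w) \<in> NF \<longleftrightarrow> h \<in> carrier H \<and> c \<in> carrier H \<and> rep e c = c
     \<and> (w \<noteq> [] \<longrightarrow> red (e, c) (hd w)) \<and> (c, w) \<in> NF"
  by (auto simp: NF_def successively_Cons)

lemma NF_head: "(h, w) \<in> NF \<Longrightarrow> h \<in> carrier H"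
  by (simp add: NF_def)

lemma NF_change_head: "(h, w) \<in> NF \<Longrightarrow> h' \<in> carrier H \<Longrightarrow> (h', w) \<in> NF"
  by (simp add: NF_def)

lemma NF_left_mult [simp]: "h \<in> carrier H \<Longrightarrow> (x, w) \<in> NF \<Longrightarrow> (h \<otimes>\<^bsub>H\<^esub> x, w) \<in> NF"
  using NF_head NF_change_head by blast

lemma T_cancel:
  "d \<in> D e \<Longrightarrow> c \<in> carrier H \<Longrightarrow> T e (d, (\<not> e, c) # w) = (\<theta> e d \<otimes>\<^bsub>H\<^esub> c, w)"
  by (simp add: T_def)

lemma T_extend:
  assumes "d \<in> D e" "c \<in> carrier H" "rep e c = c" "w \<noteq> [] \<Longrightarrow> red (e, c) (hd w)"
  shows "T e (d \<otimes>\<^bsub>H\<^esub> c, w) = (\<theta> e d, (e, c) # w)"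
proof -
  have "c = \<one>\<^bsub>H\<^esub> \<Longrightarrow> w \<noteq> [] \<Longrightarrow> fst (hd w) = e"
    using assms(4) by (auto simp: red_def)
  then show ?thesis
    using assms by (auto simp: T_def Let_def H.m_assoc)
qed

lemma NF_T_cases:
  assumes "(h, w) \<in> NF"
  obtains (cancel) c w' where "w = (\<not> e, c) # w'" "h \<in> D e"
  | (extend) d c where "h = d \<otimes>\<^bsub>H\<^esub> c" "d \<in> D e" "c \<in> carrier H" "rep e c = c"
      "w \<noteq> [] \<Longrightarrow> red (e, c) (hd w)"
proof (cases "h \<in> D e \<and> w \<noteq> [] \<and> fst (hd w) \<noteq> e")
  case True
  then show ?thesis
    by (cases w) (auto intro!: cancel)
next
  case False
  obtain d where d: "d \<in> D e" "h = d \<otimes>\<^bsub>H\<^esub> rep e h" "rep e h \<in> carrier H"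
    using rep_decomp [OF NF_head [OF assms]] .
  show ?thesis
  proof (rule extend [OF d(2,1,3)])
    show "red (e, rep e h) (hd w)" if "w \<noteq> []"
    proof -
      have "rep e h \<in> D e \<Longrightarrow> h \<in> D e"
        using D_mult [OF d(1), of "rep e h"] by (simp flip: d(2))
      then show ?thesis using False that by (auto simp: red_def)
    qed
    show "rep e (rep e h) = rep e h" using NF_head [OF assms] by simp
  qed
qed

lemma T_closed:
  assumes "x \<in> NF"
  shows "T e x \<in> NF"
proof -
  obtain h w where x: "x = (h, w)" by force
  have hw: "(h, w) \<in> NF" using assms x by simp
  from hw show ?thesis
  proof (cases rule: NF_T_cases [where e = e])
    case (cancel c w')
    then show ?thesis using hw
      by (auto simp: x T_cancel NF_Cons intro: NF_change_head)
  next
    case (extend d c)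
    then show ?thesis using hw
      by (auto simp: x T_extend NF_Cons intro: NF_change_head)
  qed
qed

text \<open>After a cancellation the opposite letter extends, and after an extension it cancels.
  Hence \<open>T e\<close> permutes \<open>NF\<close>, with inverse
  \<open>T (\<not> e)\<close>.\<close>

lemma T_T:
  assumes "x \<in> NF"
  shows "T (\<not> e) (T e x) = x"
proof -
  obtain h w where x: "x = (h, w)" by force
  have hw: "(h, w) \<in> NF" using assms x by simp
  from hw show ?thesis
  proof (cases rule: NF_T_cases [where e = e])
    case (cancel c w')
    have "T (\<not> e) (\<theta> e h \<otimes>\<^bsub>H\<^esub> c, w') = (\<theta> (\<not> e) (\<theta> e h), (\<not> e, c) # w')"
      using hw cancel by (intro T_extend) (auto simp: NF_Cons \<theta>_in)
    then show ?thesis using hw cancel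
      by (simp add: x T_cancel NF_Cons \<theta>_inverse)
  next
    case (extend d c)
    then show ?thesis using T_cancel [of "\<theta> e d" "\<not> e" c w]
      by (simp add: x T_extend \<theta>_in \<theta>_inverse)
  qed
qed

lemma T_left_mult:
  assumes "d \<in> D e" "(h, w) \<in> NF"
  shows "T e (d \<otimes>\<^bsub>H\<^esub> h, w) = (\<theta> e d \<otimes>\<^bsub>H\<^esub> fst (T e (h, w)), snd (T e (h, w)))"
  using assms(2)
proof (cases rule: NF_T_cases [where e = e])
  case (cancel c w')
  then show ?thesis
    using assms by (simp add: T_cancel NF_Cons \<theta>_mult H.m_assoc)
next
  case (extend d' c)
  have "d \<otimes>\<^bsub>H\<^esub> h = (d \<otimes>\<^bsub>H\<^esub> d') \<otimes>\<^bsub>H\<^esub> c"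
    using assms extend by (simp add: H.m_assoc)
  moreover have "T e ((d \<otimes>\<^bsub>H\<^esub> d') \<otimes>\<^bsub>H\<^esub> c, w) = (\<theta> e (d \<otimes>\<^bsub>H\<^esub> d'), (e, c) # w)"
    using assms extend by (intro T_extend) auto
  ultimately show ?thesis
    using assms extend by (simp add: T_extend \<theta>_mult)
qed

definition left_perm :: "'h \<Rightarrow> 'h \<times> (bool \<times> 'h) list \<Rightarrow> 'h \<times> (bool \<times> 'h) list" where
  "left_perm h = (\<lambda>x\<in>NF. (h \<otimes>\<^bsub>H\<^esub> fst x, snd x))"

definition letter_perm :: "bool \<Rightarrow> 'h \<times> (bool \<times> 'h) list \<Rightarrow> 'h \<times> (bool \<times> 'h) list" where
  "letter_perm e = restrict (T e) NF"

lemma left_perm_apply [simp]: "(x, w) \<in> NF \<Longrightarrow> left_perm h (x, w) = (h \<otimes>\<^bsub>H\<^esub> x, w)"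
  by (simp add: left_perm_def)

lemma letter_perm_apply [simp]: "x \<in> NF \<Longrightarrow> letter_perm e x = T e x"
  by (simp add: letter_perm_def)

lemma left_perm_closed [simp]: "h \<in> carrier H \<Longrightarrow> left_perm h \<in> carrier (BijGroup NF)"
  unfolding left_perm_def
  by (rule restrict_in_BijGroup [where g = "\<lambda>x. (inv\<^bsub>H\<^esub> h \<otimes>\<^bsub>H\<^esub> fst x, snd x)"])
    (auto simp: NF_head intro: NF_change_head)

lemma letter_perm_closed [simp]: "letter_perm e \<in> carrier (BijGroup NF)"
  unfolding letter_perm_def
  by (rule restrict_in_BijGroup [where g = "T (\<not> e)"])
    (use T_T [of _ e] T_T [of _ "\<not> e"] in \<open>auto simp: T_closed\<close>)

lemma left_perm_hom: "left_perm \<in> hom H (BijGroup NF)"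
proof (rule homI)
  fix x y assume "x \<in> carrier H" "y \<in> carrier H"
  then show "left_perm (x \<otimes>\<^bsub>H\<^esub> y) = left_perm x \<otimes>\<^bsub>BijGroup NF\<^esub> left_perm y"
    by (intro BijGroup_eqI [where S = NF])
      (auto simp: BijGroup_mult_apply NF_head H.m_assoc monoid.m_closed group.is_monoid group_BijGroup)
qed simp

lemma inv_letter_perm: "inv\<^bsub>BijGroup NF\<^esub> letter_perm e = letter_perm (\<not> e)"
proof (rule group.inv_equality [OF group_BijGroup])
  show "letter_perm (\<not> e) \<otimes>\<^bsub>BijGroup NF\<^esub> letter_perm e = \<one>\<^bsub>BijGroup NF\<^esub>"
    by (rule BijGroup_eqI [where S = NF])
      (auto simp: BijGroup_mult_apply T_closed T_T monoid.m_closed group.is_monoid group_BijGroup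
        monoid.one_closed, simp add: BijGroup_def)
qed simp_all

text \<open>The permutations satisfy the defining relation of the HNN extension; this is what allows
  von Dyck's theorem to turn them into an action of the presented group.\<close>

lemma letter_perm_left_perm:
  assumes "d \<in> D e"
  shows "letter_perm e \<otimes>\<^bsub>BijGroup NF\<^esub> left_perm d
    = left_perm (\<theta> e d) \<otimes>\<^bsub>BijGroup NF\<^esub> letter_perm e"
proof (rule BijGroup_eqI [where S = NF])
  fix x assume x: "x \<in> NF"
  obtain h w where hw: "x = (h, w)" by force
  have "T e x \<in> NF" "(d \<otimes>\<^bsub>H\<^esub> h, w) \<in> NF"
    using x assms by (auto simp: T_closed hw NF_head intro: NF_change_head)
  then show "(letter_perm e \<otimes>\<^bsub>BijGroup NF\<^esub> left_perm d) x
      = (left_perm (\<theta> e d) \<otimes>\<^bsub>BijGroup NF\<^esub> letter_perm e) x"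
    using x assms T_left_mult [OF assms, of h w]
    by (cases "T e x") (simp add: BijGroup_mult_apply hw)
qed (use assms in \<open>auto intro!: monoid.m_closed group.is_monoid group_BijGroup\<close>)

end

section \<open>HNN extensions: Britton's lemma\<close>

text \<open>No universal property of \<open>G\<close> is assumed. The action \<open>\<rho>\<close> on the set of normal forms is what
  makes \<open>\<iota>\<close> injective and excludes further relations.\<close>
locale hnn = hnn_data H D \<theta> + G: group G
  for H :: "('h, 'm) monoid_scheme" and D \<theta> and G :: "('g, 'n) monoid_scheme" +
  fixes \<iota> :: "'h \<Rightarrow> 'g" and t :: 'g
    and \<rho> :: "'g \<Rightarrow> 'h \<times> (bool \<times> 'h) list \<Rightarrow> 'h \<times> (bool \<times> 'h) list"
  assumes \<iota>_hom: "\<iota> \<in> hom H G"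
    and t_closed [simp]: "t \<in> carrier G"
    and t_commute: "d \<in> D True \<Longrightarrow> t \<otimes>\<^bsub>G\<^esub> \<iota> d = \<iota> (\<theta> True d) \<otimes>\<^bsub>G\<^esub> t"
    and \<rho>_hom: "\<rho> \<in> hom G (BijGroup NF)"
    and \<rho>_\<iota>: "h \<in> carrier H \<Longrightarrow> \<rho> (\<iota> h) = left_perm h"
    and \<rho>_t: "\<rho> t = letter_perm True"
    and generated: "g \<in> carrier G \<Longrightarrow> g \<in> generate G (insert t (\<iota> ` carrier H))"

sublocale hnn \<subseteq> \<iota>: group_hom H G \<iota>
  by unfold_locales (rule \<iota>_hom)

sublocale hnn \<subseteq> \<rho>: group_hom G "BijGroup NF" \<rho>
  using group_BijGroup \<rho>_hom
  by (auto simp: group_hom_def group_hom_axioms_def)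

context hnn
begin

definition st :: "bool \<Rightarrow> 'g" where
  "st e = (if e then t else inv\<^bsub>G\<^esub> t)"

lemma st_closed [simp]: "st e \<in> carrier G"
  by (simp add: st_def)

lemma inv_st: "inv\<^bsub>G\<^esub> st e = st (\<not> e)"
  by (simp add: st_def)

lemma st_not [simp]:
  "x \<in> carrier G \<Longrightarrow> st e \<otimes>\<^bsub>G\<^esub> (st (\<not> e) \<otimes>\<^bsub>G\<^esub> x) = x"
  "x \<in> carrier G \<Longrightarrow> st (\<not> e) \<otimes>\<^bsub>G\<^esub> (st e \<otimes>\<^bsub>G\<^esub> x) = x"
  "st e \<otimes>\<^bsub>G\<^esub> st (\<not> e) = \<one>\<^bsub>G\<^esub>"
  "st (\<not> e) \<otimes>\<^bsub>G\<^esub> st e = \<one>\<^bsub>G\<^esub>"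
  by (auto simp flip: inv_st)

lemma st_commute:
  assumes "d \<in> D e"
  shows "st e \<otimes>\<^bsub>G\<^esub> \<iota> d = \<iota> (\<theta> e d) \<otimes>\<^bsub>G\<^esub> st e"
proof (cases e)
  case False
  then have d: "d = \<theta> True (\<theta> False d)" "\<theta> False d \<in> D True"
    using assms \<theta>_inverse [of d e] \<theta>_in [of d e] by auto
  have "inv\<^bsub>G\<^esub> t \<otimes>\<^bsub>G\<^esub> \<iota> d = inv\<^bsub>G\<^esub> t \<otimes>\<^bsub>G\<^esub> (\<iota> d \<otimes>\<^bsub>G\<^esub> t) \<otimes>\<^bsub>G\<^esub> inv\<^bsub>G\<^esub> t"
    using assms by (simp add: G.m_assoc)
  also have "\<iota> d \<otimes>\<^bsub>G\<^esub> t = t \<otimes>\<^bsub>G\<^esub> \<iota> (\<theta> False d)"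
    using t_commute [OF d(2)] d(1) by simp
  finally show ?thesis
    using False d(2) by (simp add: st_def G.m_assoc)
qed (use assms in \<open>simp add: st_def t_commute\<close>)

lemma \<rho>_mult: "g \<in> carrier G \<Longrightarrow> g' \<in> carrier G \<Longrightarrow> x \<in> NF \<Longrightarrow> \<rho> (g \<otimes>\<^bsub>G\<^esub> g') x = \<rho> g (\<rho> g' x)"
  using BijGroup_mult_apply [OF \<rho>.hom_closed \<rho>.hom_closed] by simp

lemma \<rho>_closed [simp]: "g \<in> carrier G \<Longrightarrow> x \<in> NF \<Longrightarrow> \<rho> g x \<in> NF"
  by (rule BijGroup_apply_closed [OF \<rho>.hom_closed])

lemma \<rho>_one [simp]: "x \<in> NF \<Longrightarrow> \<rho> \<one>\<^bsub>G\<^esub> x = x"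
  by (simp add: \<rho>.hom_one BijGroup_def)

lemma \<rho>_st [simp]: "\<rho> (st e) = letter_perm e"
  by (simp add: st_def \<rho>_t inv_letter_perm)

declare \<rho>_\<iota> [simp] \<rho>.hom_mult [simp del] \<rho>.hom_one [simp del]

primrec evl :: "(bool \<times> 'h) list \<Rightarrow> 'g" where
  "evl [] = \<one>\<^bsub>G\<^esub>"
| "evl (p # w) = st (fst p) \<otimes>\<^bsub>G\<^esub> (\<iota> (snd p) \<otimes>\<^bsub>G\<^esub> evl w)"

definition ev :: "'h \<times> (bool \<times> 'h) list \<Rightarrow> 'g" where
  "ev x = \<iota> (fst x) \<otimes>\<^bsub>G\<^esub> evl (snd x)"

definition base_word :: "(bool \<times> 'h) list \<Rightarrow> bool" where
  "base_word w \<longleftrightarrow> (\<forall>p\<in>set w. snd p \<in> carrier H)"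

lemma base_word_simps [simp]:
  "base_word []" "base_word (p # w) \<longleftrightarrow> snd p \<in> carrier H \<and> base_word w" "base_word (v @ w) \<longleftrightarrow> base_word v \<and> base_word w"
  by (auto simp: base_word_def)

lemma evl_closed [simp]: "base_word w \<Longrightarrow> evl w \<in> carrier G"
  by (induction w) auto

lemma evl_append: "base_word v \<Longrightarrow> base_word w \<Longrightarrow> evl (v @ w) = evl v \<otimes>\<^bsub>G\<^esub> evl w"
  by (induction v) (auto simp: G.m_assoc)

lemma NF_base_word: "(h, w) \<in> NF \<Longrightarrow> base_word w"
  by (auto simp: NF_def base_word_def)

lemma NF_red: "(h, w) \<in> NF \<Longrightarrow> successively red w"
  by (simp add: NF_def)

lemma ev_closed [simp]: "x \<in> NF \<Longrightarrow> ev x \<in> carrier G"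
  by (cases x) (auto simp: ev_def NF_head NF_base_word)

lemma ev_T:
  assumes "x \<in> NF"
  shows "ev (T e x) = st e \<otimes>\<^bsub>G\<^esub> ev x"
proof -
  obtain h w where x: "x = (h, w)" by force
  have hw: "(h, w) \<in> NF" using assms x by simp
  note base_word = NF_base_word [OF hw]
  from hw show ?thesis
  proof (cases rule: NF_T_cases [where e = e])
    case (cancel c w')
    have "st e \<otimes>\<^bsub>G\<^esub> ev x = (st e \<otimes>\<^bsub>G\<^esub> \<iota> h) \<otimes>\<^bsub>G\<^esub> (st (\<not> e) \<otimes>\<^bsub>G\<^esub> (\<iota> c \<otimes>\<^bsub>G\<^esub> evl w'))"
      using cancel base_word by (simp add: x ev_def G.m_assoc)
    also have "\<dots> = \<iota> (\<theta> e h) \<otimes>\<^bsub>G\<^esub> (\<iota> c \<otimes>\<^bsub>G\<^esub> evl w')"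
      using cancel base_word by (simp add: st_commute G.m_assoc)
    finally show ?thesis
      using cancel base_word by (simp add: x T_cancel ev_def G.m_assoc)
  next
    case (extend d c)
    have "st e \<otimes>\<^bsub>G\<^esub> ev x = (st e \<otimes>\<^bsub>G\<^esub> \<iota> d) \<otimes>\<^bsub>G\<^esub> (\<iota> c \<otimes>\<^bsub>G\<^esub> evl w)"
      using extend base_word by (simp add: x ev_def G.m_assoc)
    also have "\<dots> = \<iota> (\<theta> e d) \<otimes>\<^bsub>G\<^esub> (st e \<otimes>\<^bsub>G\<^esub> (\<iota> c \<otimes>\<^bsub>G\<^esub> evl w))"
      using extend base_word by (simp add: st_commute G.m_assoc)
    finally show ?thesis
      using extend base_word by (simp add: x T_extend ev_def)
  qed
qed

lemma ev_left_mult: "h \<in> carrier H \<Longrightarrow> (x, w) \<in> NF \<Longrightarrow> ev (h \<otimes>\<^bsub>H\<^esub> x, w) = \<iota> h \<otimes>\<^bsub>G\<^esub> ev (x, w)"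
  by (simp add: ev_def NF_head NF_base_word G.m_assoc)

text \<open>Evaluation intertwines the action with left multiplication. At the base point this says
  that the normal form of \<open>g\<close> evaluates to \<open>g\<close>, so every element has a
  reduced expression.\<close>

lemma ev_\<rho>:
  assumes "g \<in> carrier G" "x \<in> NF"
  shows "ev (\<rho> g x) = g \<otimes>\<^bsub>G\<^esub> ev x"
proof -
  have "g \<in> generate G (insert t (\<iota> ` carrier H))"
    by (rule generated [OF assms(1)])
  then have "g \<in> carrier G \<and> (\<forall>x\<in>NF. ev (\<rho> g x) = g \<otimes>\<^bsub>G\<^esub> ev x)"
  proof induction
    case (incl g)
    then show ?case
      using ev_T [of _ True] by (auto simp: \<rho>_t st_def ev_left_mult)
  next
    case (inv g)
    then consider "g = t" | h where "h \<in> carrier H" "g = \<iota> h" by auto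
    then show ?case
    proof cases
      case 1
      then show ?thesis
        using ev_T [of _ False] \<rho>_st [of False] by (auto simp: st_def simp del: \<rho>_st)
    next
      case 2
      then show ?thesis
        by (auto simp: ev_left_mult simp flip: \<iota>.hom_inv)
    qed
  next
    case (eng g g')
    then show ?case by (auto simp: \<rho>_mult G.m_assoc)
  qed auto
  then show ?thesis using assms by blast
qed

section \<open>Normal forms of group elements and their length\<close>

definition nf :: "'g \<Rightarrow> 'h \<times> (bool \<times> 'h) list" where
  "nf g = \<rho> g (\<one>\<^bsub>H\<^esub>, [])"

text \<open>The number of stable letters, that is, the distance in the Bass-Serre tree from the base
  vertex to its translate by \<open>g\<close>.\<close>

definition len :: "'g \<Rightarrow> nat" where
  "len g = length (snd (nf g))"

lemma nf_closed [simp]: "g \<in> carrier G \<Longrightarrow> nf g \<in> NF"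
  by (simp add: nf_def)

lemma ev_nf: "g \<in> carrier G \<Longrightarrow> ev (nf g) = g"
  by (simp add: nf_def ev_\<rho>) (simp add: ev_def)

lemma nf_\<iota>: "h \<in> carrier H \<Longrightarrow> nf (\<iota> h) = (h, [])"
  by (simp add: nf_def)

lemma \<iota>_eq_iff [simp]: "h \<in> carrier H \<Longrightarrow> h' \<in> carrier H \<Longrightarrow> \<iota> h = \<iota> h' \<longleftrightarrow> h = h'"
  using nf_\<iota> by (metis fst_conv)

lemma obtain_reduced:
  assumes "g \<in> carrier G"
  obtains h ws where "h \<in> carrier H" "base_word ws" "successively red ws" "g = \<iota> h \<otimes>\<^bsub>G\<^esub> evl ws"
    "len g = length ws"
proof -
  obtain h ws where hw: "nf g = (h, ws)" by force
  have NF: "(h, ws) \<in> NF" using nf_closed [OF assms] hw by simp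
  show ?thesis
    by (rule that [OF NF_head [OF NF] NF_base_word [OF NF] NF_red [OF NF]])
      (use ev_nf [OF assms] in \<open>simp_all add: hw len_def ev_def\<close>)
qed

lemma length_T_le: "length (snd (T e x)) \<le> Suc (length (snd x))"
  by (auto simp: T_def Let_def)

lemma length_\<rho>_evl_le:
  assumes "base_word ws" "x \<in> NF"
  shows "length (snd (\<rho> (evl ws) x)) \<le> length ws + length (snd x)"
  using assms
proof (induction ws)
  case (Cons p ws)
  have NF: "\<rho> (evl ws) x \<in> NF" using Cons by simp
  obtain h w where hw: "\<rho> (evl ws) x = (h, w)" by force
  have "\<rho> (evl (p # ws)) x = T (fst p) (snd p \<otimes>\<^bsub>H\<^esub> h, w)"
    using Cons.prems NF by (simp add: \<rho>_mult hw)
  moreover have "length w \<le> length ws + length (snd x)"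
    using Cons by (simp add: hw)
  ultimately show ?case
    using length_T_le [of "fst p" "(snd p \<otimes>\<^bsub>H\<^esub> h, w)"] by simp
qed simp

lemma length_\<rho>_\<iota>: "h \<in> carrier H \<Longrightarrow> x \<in> NF \<Longrightarrow> length (snd (\<rho> (\<iota> h) x)) = length (snd x)"
  by (cases x) simp

lemma length_\<rho>_le:
  assumes "g \<in> carrier G" "x \<in> NF"
  shows "length (snd (\<rho> g x)) \<le> len g + length (snd x)"
proof -
  obtain h ws where "h \<in> carrier H" "base_word ws" "g = \<iota> h \<otimes>\<^bsub>G\<^esub> evl ws" "len g = length ws"
    using obtain_reduced [OF assms(1)] by metis
  then show ?thesis
    using length_\<rho>_evl_le [of ws x] assms by (simp add: \<rho>_mult length_\<rho>_\<iota> del: \<rho>_\<iota>)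
qed

lemma len_mult_le: "g \<in> carrier G \<Longrightarrow> g' \<in> carrier G \<Longrightarrow> len (g \<otimes>\<^bsub>G\<^esub> g') \<le> len g + len g'"
  using length_\<rho>_le [of g "nf g'"] by (simp add: len_def nf_def \<rho>_mult)

lemma len_\<iota> [simp]: "h \<in> carrier H \<Longrightarrow> len (\<iota> h) = 0"
  by (simp add: len_def nf_\<iota>)

lemma len_st_le: "len (st e) \<le> 1"
  using length_T_le [of e "(\<one>\<^bsub>H\<^esub>, [])"] by (simp add: len_def nf_def)

lemma len_evl_le: "base_word ws \<Longrightarrow> len (evl ws) \<le> length ws"
  using length_\<rho>_evl_le [of ws "(\<one>\<^bsub>H\<^esub>, [])"] by (simp add: len_def nf_def)

lemma len_inv_evl_le: "base_word ws \<Longrightarrow> len (inv\<^bsub>G\<^esub> evl ws) \<le> length ws"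
proof (induction ws)
  case (Cons p ws)
  have "len (inv\<^bsub>G\<^esub> evl (p # ws))
      = len (inv\<^bsub>G\<^esub> evl ws \<otimes>\<^bsub>G\<^esub> (\<iota> (inv\<^bsub>H\<^esub> snd p) \<otimes>\<^bsub>G\<^esub> st (\<not> fst p)))"
    using Cons.prems by (simp add: G.inv_mult_group inv_st G.m_assoc)
  also have "\<dots> \<le> len (inv\<^bsub>G\<^esub> evl ws) + (len (\<iota> (inv\<^bsub>H\<^esub> snd p)) + len (st (\<not> fst p)))"
    using Cons.prems
    by (intro order_trans [OF len_mult_le] add_left_mono len_mult_le) auto
  also have "\<dots> \<le> length ws + (0 + 1)"
    using Cons len_st_le by (intro add_mono) (auto simp del: \<iota>.hom_inv)
  finally show ?case by simp
qed (use len_\<iota> [of "\<one>\<^bsub>H\<^esub>"] in \<open>simp del: len_\<iota>\<close>)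

lemma len_inv:
  assumes "g \<in> carrier G"
  shows "len (inv\<^bsub>G\<^esub> g) = len g"
proof -
  have le: "len (inv\<^bsub>G\<^esub> g) \<le> len g" if g: "g \<in> carrier G" for g
  proof -
    obtain h ws where *: "h \<in> carrier H" "base_word ws" "g = \<iota> h \<otimes>\<^bsub>G\<^esub> evl ws" "len g = length ws"
      using obtain_reduced [OF g] by metis
    then have "len (inv\<^bsub>G\<^esub> g) = len (inv\<^bsub>G\<^esub> evl ws \<otimes>\<^bsub>G\<^esub> \<iota> (inv\<^bsub>H\<^esub> h))"
      by (simp add: G.inv_mult_group)
    also have "\<dots> \<le> len (inv\<^bsub>G\<^esub> evl ws) + len (\<iota> (inv\<^bsub>H\<^esub> h))"
      using * by (intro len_mult_le) auto
    also have "\<dots> \<le> len g"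
      using * len_inv_evl_le by (simp del: \<iota>.hom_inv)
    finally show ?thesis .
  qed
  show ?thesis using le [OF assms] le [of "inv\<^bsub>G\<^esub> g"] assms by simp
qed

text \<open>Britton's lemma, with the additional information that the coset of the head of the normal
  form and its first sign can be read off the reduced word.\<close>
lemma britton:
  assumes "base_word ws" "successively red ws" "ws \<noteq> []" "y \<in> carrier H"
  obtains z c w where "\<rho> (evl ws) (y, []) = (z, (fst (hd ws), c) # w)"
    "z \<in> D (\<not> fst (hd ws))" "length ws = Suc (length w)"
  using assms
proof (induction ws arbitrary: thesis)
  case (Cons p ws)
  obtain e h where p: "p = (e, h)" by force
  have h: "h \<in> carrier H" using Cons.prems by (simp add: p)
  show ?case
  proof (cases "ws = []")
    case True
    obtain d where d: "d \<in> D e" "h \<otimes>\<^bsub>H\<^esub> y = d \<otimes>\<^bsub>H\<^esub> rep e (h \<otimes>\<^bsub>H\<^esub> y)"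
      using rep_decomp [of "h \<otimes>\<^bsub>H\<^esub> y" e] h Cons.prems by auto
    have "\<rho> (evl (p # ws)) (y, []) = T e (d \<otimes>\<^bsub>H\<^esub> rep e (h \<otimes>\<^bsub>H\<^esub> y), [])"
      using True h Cons.prems by (simp add: p \<rho>_mult flip: d(2))
    also have "\<dots> = (\<theta> e d, [(e, rep e (h \<otimes>\<^bsub>H\<^esub> y))])"
      using d(1) h Cons.prems by (intro T_extend) auto
    finally show ?thesis
      using True d(1) by (intro Cons.prems(1)) (auto simp: p \<theta>_in)
  next
    case False
    obtain z c w where zcw: "\<rho> (evl ws) (y, []) = (z, (fst (hd ws), c) # w)"
      "z \<in> D (\<not> fst (hd ws))" "length ws = Suc (length w)"
      by (rule Cons.IH) (use Cons.prems False in \<open>auto simp: successively_Cons\<close>)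
    have zNF: "(z, (fst (hd ws), c) # w) \<in> NF"
      using \<rho>_closed [of "evl ws" "(y, [])"] Cons.prems by (simp add: zcw)
    have hzNF: "(h \<otimes>\<^bsub>H\<^esub> z, (fst (hd ws), c) # w) \<in> NF"
      using zNF h by simp
    have red: "red (e, h) (hd ws)"
      using Cons.prems(3) False by (simp add: p successively_Cons)
    have act: "\<rho> (evl (p # ws)) (y, []) = T e (h \<otimes>\<^bsub>H\<^esub> z, (fst (hd ws), c) # w)"
      using h Cons.prems zcw zNF by (simp add: p \<rho>_mult)
    from hzNF show ?thesis
    proof (cases rule: NF_T_cases [where e = e])
      \<comment> \<open>Cancellation needs \<open>h z \<in> D e\<close> and a first letter of
        opposite sign. Then \<open>z \<in> D e\<close> by the induction hypothesis, so
        \<open>h \<in> D e\<close>, a pinch in the reduced word.\<close>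
      case (cancel c' w')
      then have "h \<in> D e"
        using zcw(2) h D_mult_right_iff [of z e h] by auto
      then show ?thesis using red cancel by (auto simp: red_def)
    next
      case (extend d c')
      then show ?thesis
        using act T_extend [OF extend(2-5)] zcw(3)
        by (intro Cons.prems(1)) (auto simp: p \<theta>_in)
    qed
  qed
qed simp

lemma len_reduced:
  assumes "h \<in> carrier H" "base_word ws" "successively red ws"
  shows "len (\<iota> h \<otimes>\<^bsub>G\<^esub> evl ws) = length ws"
proof (cases "ws = []")
  case False
  obtain z c w where "\<rho> (evl ws) (\<one>\<^bsub>H\<^esub>, []) = (z, (fst (hd ws), c) # w)" "length ws = Suc (length w)"
    by (rule britton [OF assms(2,3) False H.one_closed])
  moreover have "len (\<iota> h \<otimes>\<^bsub>G\<^esub> evl ws) = length (snd (\<rho> (evl ws) (\<one>\<^bsub>H\<^esub>, [])))"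
    using assms by (simp add: len_def nf_def \<rho>_mult length_\<rho>_\<iota> del: \<rho>_\<iota>)
  ultimately show ?thesis by simp
qed (use assms in simp)

subsection \<open>Conjugacy\<close>

text \<open>Let both sides of the equation act on the base point. Starting \<open>britton\<close>
  from \<open>(y, [])\<close> absorbs the factor \<open>\<iota> y\<close> on the right, so the heads
  \<open>x h z\<close> and \<open>h z'\<close> agree with
  \<open>z, z' \<in> D (\<not> fst p)\<close>, and the conjugate of \<open>x\<close> equals
  \<open>z' z^-1\<close>.\<close>

lemma conj_base:
  assumes "x \<in> carrier H" "y \<in> carrier H" "h \<in> carrier H" "base_word (p # ws)" "successively red (p # ws)"
    and eq: "\<iota> x \<otimes>\<^bsub>G\<^esub> (\<iota> h \<otimes>\<^bsub>G\<^esub> evl (p # ws)) = (\<iota> h \<otimes>\<^bsub>G\<^esub> evl (p # ws)) \<otimes>\<^bsub>G\<^esub> \<iota> y"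
  shows "inv\<^bsub>H\<^esub> h \<otimes>\<^bsub>H\<^esub> x \<otimes>\<^bsub>H\<^esub> h \<in> D (\<not> fst p)"
proof -
  let ?g = "evl (p # ws)"
  have g: "?g \<in> carrier G" using assms(4) evl_closed by blast
  obtain z c w where z: "\<rho> ?g (\<one>\<^bsub>H\<^esub>, []) = (z, (fst p, c) # w)" "z \<in> D (\<not> fst p)"
    by (rule britton [OF assms(4,5), of "\<one>\<^bsub>H\<^esub>"]) (auto simp del: evl.simps)
  obtain z' c' w' where z': "\<rho> ?g (y, []) = (z', (fst p, c') # w')" "z' \<in> D (\<not> fst p)"
    by (rule britton [OF assms(4,5), of y]) (use assms(2) in \<open>auto simp del: evl.simps\<close>)
  have NF: "(z, (fst p, c) # w) \<in> NF" "(z', (fst p, c') # w') \<in> NF"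
    using \<rho>_closed [OF g, of "(\<one>\<^bsub>H\<^esub>, [])"] \<rho>_closed [OF g, of "(y, [])"] assms(2)
    by (simp_all add: z z' del: evl.simps)
  have "\<rho> (\<iota> x \<otimes>\<^bsub>G\<^esub> (\<iota> h \<otimes>\<^bsub>G\<^esub> ?g)) (\<one>\<^bsub>H\<^esub>, []) = (x \<otimes>\<^bsub>H\<^esub> (h \<otimes>\<^bsub>H\<^esub> z), (fst p, c) # w)"
    using assms(1-4) g z NF by (simp add: \<rho>_mult del: evl.simps)
  moreover have "\<rho> ((\<iota> h \<otimes>\<^bsub>G\<^esub> ?g) \<otimes>\<^bsub>G\<^esub> \<iota> y) (\<one>\<^bsub>H\<^esub>, []) = (h \<otimes>\<^bsub>H\<^esub> z', (fst p, c') # w')"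
    using assms(1-4) g z' NF by (simp add: \<rho>_mult del: evl.simps)
  ultimately have "x \<otimes>\<^bsub>H\<^esub> (h \<otimes>\<^bsub>H\<^esub> z) = h \<otimes>\<^bsub>H\<^esub> z'"
    using eq by simp
  then have "inv\<^bsub>H\<^esub> h \<otimes>\<^bsub>H\<^esub> (x \<otimes>\<^bsub>H\<^esub> (h \<otimes>\<^bsub>H\<^esub> z)) \<otimes>\<^bsub>H\<^esub> inv\<^bsub>H\<^esub> z = z' \<otimes>\<^bsub>H\<^esub> inv\<^bsub>H\<^esub> z"
    using assms z z' by simp
  then have "inv\<^bsub>H\<^esub> h \<otimes>\<^bsub>H\<^esub> x \<otimes>\<^bsub>H\<^esub> h = z' \<otimes>\<^bsub>H\<^esub> inv\<^bsub>H\<^esub> z"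
    using assms z by (simp add: H.m_assoc)
  then show ?thesis using z z' by simp
qed

text \<open>Strips the first stable letter from the conjugator. Alternating with
  \<open>conj_base\<close> it follows a conjugation along a reduced word, one edge group at a
  time.\<close>

lemma conj_step:
  assumes "x \<in> carrier H" "y \<in> carrier H" "h \<in> carrier H" "base_word (p # ws)"
    and eq: "\<iota> x \<otimes>\<^bsub>G\<^esub> (\<iota> h \<otimes>\<^bsub>G\<^esub> evl (p # ws)) = (\<iota> h \<otimes>\<^bsub>G\<^esub> evl (p # ws)) \<otimes>\<^bsub>G\<^esub> \<iota> y"
    and z: "z = inv\<^bsub>H\<^esub> h \<otimes>\<^bsub>H\<^esub> x \<otimes>\<^bsub>H\<^esub> h" "z \<in> D (\<not> fst p)"
  shows "\<iota> (\<theta> (\<not> fst p) z) \<otimes>\<^bsub>G\<^esub> (\<iota> (snd p) \<otimes>\<^bsub>G\<^esub> evl ws) = (\<iota> (snd p) \<otimes>\<^bsub>G\<^esub> evl ws) \<otimes>\<^bsub>G\<^esub> \<iota> y"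
proof -
  let ?g = "\<iota> (snd p) \<otimes>\<^bsub>G\<^esub> evl ws" and ?s = "st (fst p)"
  have g: "?g \<in> carrier G" using assms(4) by simp
  have comm: "?s \<otimes>\<^bsub>G\<^esub> \<iota> (\<theta> (\<not> fst p) z) = \<iota> z \<otimes>\<^bsub>G\<^esub> ?s"
    using st_commute [of "\<theta> (\<not> fst p) z" "fst p"] \<theta>_in [OF z(2)] \<theta>_inverse [OF z(2)] by simp
  have zc: "z \<in> carrier H" "\<theta> (\<not> fst p) z \<in> carrier H" using z(2) by auto
  have hz: "x \<otimes>\<^bsub>H\<^esub> h = h \<otimes>\<^bsub>H\<^esub> z" using assms by (simp add: z(1) H.m_assoc)
  have "\<iota> h \<otimes>\<^bsub>G\<^esub> (?s \<otimes>\<^bsub>G\<^esub> (\<iota> (\<theta> (\<not> fst p) z) \<otimes>\<^bsub>G\<^esub> ?g))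
      = \<iota> h \<otimes>\<^bsub>G\<^esub> ((\<iota> z \<otimes>\<^bsub>G\<^esub> ?s) \<otimes>\<^bsub>G\<^esub> ?g)"
    unfolding comm [symmetric] using assms(1-4) g zc by (simp add: G.m_assoc)
  also have "\<dots> = \<iota> (h \<otimes>\<^bsub>H\<^esub> z) \<otimes>\<^bsub>G\<^esub> (?s \<otimes>\<^bsub>G\<^esub> ?g)"
    using assms(1-4) g zc by (simp add: G.m_assoc)
  also have "\<dots> = \<iota> x \<otimes>\<^bsub>G\<^esub> (\<iota> h \<otimes>\<^bsub>G\<^esub> evl (p # ws))"
    unfolding hz [symmetric] using assms(1-4) by (simp add: G.m_assoc)
  also have "\<dots> = \<iota> h \<otimes>\<^bsub>G\<^esub> (?s \<otimes>\<^bsub>G\<^esub> (?g \<otimes>\<^bsub>G\<^esub> \<iota> y))"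
    unfolding eq using assms(1-4) by (simp add: G.m_assoc)
  finally show ?thesis
    using assms(1-4) g zc by (simp del: \<iota>.hom_mult)
qed

lemma conj_trans:
  assumes "g \<in> carrier G" "c \<in> carrier G" "g' \<in> carrier G" "c' \<in> carrier G" "y \<in> carrier G"
    "g \<otimes>\<^bsub>G\<^esub> c = c \<otimes>\<^bsub>G\<^esub> g'" "g' \<otimes>\<^bsub>G\<^esub> c' = c' \<otimes>\<^bsub>G\<^esub> y"
  shows "g \<otimes>\<^bsub>G\<^esub> (c \<otimes>\<^bsub>G\<^esub> c') = (c \<otimes>\<^bsub>G\<^esub> c') \<otimes>\<^bsub>G\<^esub> y"
proof -
  have "g \<otimes>\<^bsub>G\<^esub> (c \<otimes>\<^bsub>G\<^esub> c') = c \<otimes>\<^bsub>G\<^esub> (g' \<otimes>\<^bsub>G\<^esub> c')"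
    using assms by (metis G.m_assoc)
  then show ?thesis using assms by (simp add: G.m_assoc)
qed

section \<open>Cyclic reduction and translation length\<close>

lemma cyclic_reduction:
  assumes "g \<in> carrier G"
  obtains c h where "c \<in> carrier G" "h \<in> carrier H" "g \<otimes>\<^bsub>G\<^esub> c = c \<otimes>\<^bsub>G\<^esub> \<iota> h"
  | c ws where "c \<in> carrier G" "ws \<noteq> []" "base_word ws" "successively red ws" "red (last ws) (hd ws)"
      "g \<otimes>\<^bsub>G\<^esub> c = c \<otimes>\<^bsub>G\<^esub> evl ws"
proof -
  have "(\<exists>c h. c \<in> carrier G \<and> h \<in> carrier H \<and> g \<otimes>\<^bsub>G\<^esub> c = c \<otimes>\<^bsub>G\<^esub> \<iota> h) \<or>
      (\<exists>c ws. c \<in> carrier G \<and> ws \<noteq> [] \<and> base_word ws \<and> successively red ws \<and> red (last ws) (hd ws)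
        \<and> g \<otimes>\<^bsub>G\<^esub> c = c \<otimes>\<^bsub>G\<^esub> evl ws)" (is "?P g")
    using assms
  proof (induction "len g" arbitrary: g rule: less_induct)
    case less
    obtain h ws where ws: "h \<in> carrier H" "base_word ws" "successively red ws"
      "g = \<iota> h \<otimes>\<^bsub>G\<^esub> evl ws" "len g = length ws"
      using obtain_reduced [OF less.prems] by metis
    show ?case
    proof (cases ws rule: rev_cases)
      case Nil
      then have "g \<otimes>\<^bsub>G\<^esub> \<one>\<^bsub>G\<^esub> = \<one>\<^bsub>G\<^esub> \<otimes>\<^bsub>G\<^esub> \<iota> h" using ws by simp
      then show ?thesis using ws(1) by blast
    next
      case (snoc us p)
      \<comment> \<open>The word of \<open>h^-1 g h\<close>: the head is moved to the end, so that
        only the junction between last and first letter can still contain a pinch.\<close>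
      define vs where "vs = us @ [(fst p, snd p \<otimes>\<^bsub>H\<^esub> h)]"
      have base_word: "base_word us" "snd p \<in> carrier H" using ws(2) snoc by auto
      have vs: "base_word vs" "vs \<noteq> []" using base_word ws(1) by (auto simp: vs_def)
      have red: "successively red vs"
        using ws(3) by (auto simp: vs_def snoc successively_append_iff red_def)
      have conj0: "g \<otimes>\<^bsub>G\<^esub> \<iota> h = \<iota> h \<otimes>\<^bsub>G\<^esub> evl vs"
        using base_word ws(1) by (simp add: ws(4) snoc vs_def evl_append G.m_assoc)
      show ?thesis
      proof (cases "red (last vs) (hd vs)")
        case True
        then show ?thesis
          using conj0 ws(1) vs red by (intro disjI2 exI [of _ "\<iota> h"] exI [of _ vs]) simp
      next
        case False
        then have pinch: "fst (hd vs) = (\<not> fst p)" "snd p \<otimes>\<^bsub>H\<^esub> h \<in> D (fst p)"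
          by (auto simp: red_def vs_def)
        then obtain q us' where us: "us = q # us'"
          by (cases us) (auto simp: vs_def)
        have q: "fst q = (\<not> fst p)" using pinch us by (simp add: vs_def)
        \<comment> \<open>Conjugating by the first letter \<open>st (\<not> fst p)\<close> closes
          the pinch: both the first and the last stable letter disappear, and the length
          drops.\<close>
        define g' where "g' = \<iota> (snd q) \<otimes>\<^bsub>G\<^esub> (evl us' \<otimes>\<^bsub>G\<^esub> \<iota> (\<theta> (fst p) (snd p \<otimes>\<^bsub>H\<^esub> h)))"
        have g': "g' \<in> carrier G" using base_word us pinch by (simp add: g'_def)
        have "st (fst p) \<otimes>\<^bsub>G\<^esub> (\<iota> (snd p \<otimes>\<^bsub>H\<^esub> h) \<otimes>\<^bsub>G\<^esub> st (\<not> fst p))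
            = \<iota> (\<theta> (fst p) (snd p \<otimes>\<^bsub>H\<^esub> h))"
          using st_commute [OF pinch(2)] pinch(2) base_word ws(1)
          by (simp add: G.m_assoc [symmetric] del: \<iota>.hom_mult) (simp add: G.m_assoc del: \<iota>.hom_mult)
        then have "evl vs \<otimes>\<^bsub>G\<^esub> st (\<not> fst p) = st (\<not> fst p) \<otimes>\<^bsub>G\<^esub> g'"
          using base_word us ws(1) by (simp add: vs_def g'_def q evl_append G.m_assoc)
        then have conj: "g \<otimes>\<^bsub>G\<^esub> (\<iota> h \<otimes>\<^bsub>G\<^esub> st (\<not> fst p)) = (\<iota> h \<otimes>\<^bsub>G\<^esub> st (\<not> fst p)) \<otimes>\<^bsub>G\<^esub> g'"
          using conj0 less.prems ws(1) vs g' by (intro conj_trans) auto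
        have "len g' \<le> len (\<iota> (snd q)) + (len (evl us') + len (\<iota> (\<theta> (fst p) (snd p \<otimes>\<^bsub>H\<^esub> h))))"
          unfolding g'_def using base_word us pinch
          by (intro order_trans [OF len_mult_le] add_left_mono len_mult_le) auto
        also have "\<dots> \<le> length us'"
          using base_word us pinch len_evl_le by simp
        also have "\<dots> < len g" by (simp add: ws(5) snoc us)
        finally have "?P g'" using less.hyps g' by blast
        then show ?thesis
        proof (elim disjE exE conjE)
          fix c h' assume *: "c \<in> carrier G" "h' \<in> carrier H" "g' \<otimes>\<^bsub>G\<^esub> c = c \<otimes>\<^bsub>G\<^esub> \<iota> h'"
          have "g \<otimes>\<^bsub>G\<^esub> ((\<iota> h \<otimes>\<^bsub>G\<^esub> st (\<not> fst p)) \<otimes>\<^bsub>G\<^esub> c)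
              = ((\<iota> h \<otimes>\<^bsub>G\<^esub> st (\<not> fst p)) \<otimes>\<^bsub>G\<^esub> c) \<otimes>\<^bsub>G\<^esub> \<iota> h'"
            by (rule conj_trans [OF _ _ g' _ _ conj]) (use * less.prems ws(1) in auto)
          then show ?thesis using * ws(1) by (intro disjI1 exI [of _ "(\<iota> h \<otimes>\<^bsub>G\<^esub> st (\<not> fst p)) \<otimes>\<^bsub>G\<^esub> c"] exI [of _ h']) simp
        next
          fix c us assume *: "c \<in> carrier G" "us \<noteq> []" "base_word us" "successively red us"
            "red (last us) (hd us)" "g' \<otimes>\<^bsub>G\<^esub> c = c \<otimes>\<^bsub>G\<^esub> evl us"
          have "g \<otimes>\<^bsub>G\<^esub> ((\<iota> h \<otimes>\<^bsub>G\<^esub> st (\<not> fst p)) \<otimes>\<^bsub>G\<^esub> c)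
              = ((\<iota> h \<otimes>\<^bsub>G\<^esub> st (\<not> fst p)) \<otimes>\<^bsub>G\<^esub> c) \<otimes>\<^bsub>G\<^esub> evl us"
            by (rule conj_trans [OF _ _ g' _ _ conj]) (use * less.prems ws(1) in auto)
          then show ?thesis using * ws(1) by (intro disjI2 exI [of _ "(\<iota> h \<otimes>\<^bsub>G\<^esub> st (\<not> fst p)) \<otimes>\<^bsub>G\<^esub> c"] exI [of _ us]) simp
        qed
      qed
    qed
  qed
  then show ?thesis using that by blast
qed

text \<open>Powers of a cyclically reduced word are reduced as written, since no pinch arises where
  two copies meet.\<close>

lemma len_cyclic_pow:
  fixes N :: nat
  assumes "ws \<noteq> []" "base_word ws" "successively red ws" "red (last ws) (hd ws)"
  shows "len (evl ws [^]\<^bsub>G\<^esub> N) = N * length ws"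
proof -
  define us where "us N = concat (replicate N ws)" for N
  have us: "us 0 = []" "us (Suc N) = ws @ us N" for N by (simp_all add: us_def)
  have "base_word (us N)" for N
    using assms(2) by (induction N) (simp_all add: us)
  moreover have "successively red (us N)" for N
  proof (induction N)
    case (Suc N)
    have "us N \<noteq> [] \<Longrightarrow> hd (us N) = hd ws" using assms(1) by (cases N) (auto simp: us)
    then show ?case
      using Suc assms by (cases "us N = []") (simp_all add: us successively_append_iff)
  qed (simp add: us)
  moreover have "length (us N) = N * length ws" for N
    by (induction N) (simp_all add: us)
  moreover have "evl (us N) = evl ws [^]\<^bsub>G\<^esub> N" for N
  proof (induction N)
    case (Suc N)
    then show ?case
      using assms(2) \<open>\<And>N. base_word (us N)\<close> by (simp only: us evl_append G.nat_pow_Suc2 evl_closed)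
  qed (simp add: us)
  ultimately show ?thesis
    using len_reduced [of "\<one>\<^bsub>H\<^esub>" "us N"] by (metis H.one_closed G.l_one \<iota>.hom_one evl_closed)
qed

text \<open>The number \<open>n\<close> is the translation length. Passing to the conjugate
  \<open>y\<close> makes the length of powers exactly linear, not only asymptotically.\<close>

lemma elliptic_or_hyperbolic:
  assumes "g \<in> carrier G"
  obtains (elliptic) c h where "c \<in> carrier G" "h \<in> carrier H" "g \<otimes>\<^bsub>G\<^esub> c = c \<otimes>\<^bsub>G\<^esub> \<iota> h"
  | (hyperbolic) c y n where "c \<in> carrier G" "y \<in> carrier G" "g \<otimes>\<^bsub>G\<^esub> c = c \<otimes>\<^bsub>G\<^esub> y" "n > 0"
      "\<And>i::int. len (y [^]\<^bsub>G\<^esub> i) = nat \<bar>i\<bar> * n"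
  using assms
proof (cases rule: cyclic_reduction)
  case (2 c ws)
  have "len (evl ws [^]\<^bsub>G\<^esub> i) = nat \<bar>i\<bar> * length ws" for i :: int
    using 2 len_cyclic_pow [of ws]
    by (cases i rule: int_cases2) (simp_all add: int_pow_int G.int_pow_neg len_inv)
  then show ?thesis using 2 hyperbolic [of c "evl ws" "length ws"] by auto
qed (use elliptic in blast)

text \<open>A hyperbolic element \<open>g\<close> has positive translation length, which is multiplied by \<open>\<bar>i\<bar>\<close> for
  \<open>g [^] i\<close> and is invariant under conjugation.\<close>

lemma elliptic_if_pow_conj_pow:
  fixes l m :: int
  assumes "g \<in> carrier G" "\<gamma> \<in> carrier G" "g [^]\<^bsub>G\<^esub> l \<otimes>\<^bsub>G\<^esub> \<gamma> = \<gamma> \<otimes>\<^bsub>G\<^esub> g [^]\<^bsub>G\<^esub> m" "\<bar>l\<bar> > \<bar>m\<bar>"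
  obtains c h where "c \<in> carrier G" "h \<in> carrier H" "g \<otimes>\<^bsub>G\<^esub> c = c \<otimes>\<^bsub>G\<^esub> \<iota> h"
  using assms(1)
proof (cases rule: elliptic_or_hyperbolic)
  case (hyperbolic c y n)
  define \<delta> where "\<delta> = inv\<^bsub>G\<^esub> c \<otimes>\<^bsub>G\<^esub> (\<gamma> \<otimes>\<^bsub>G\<^esub> c)"
  have \<delta>: "\<delta> \<in> carrier G" using hyperbolic assms by (simp add: \<delta>_def)
  have y: "y = inv\<^bsub>G\<^esub> c \<otimes>\<^bsub>G\<^esub> g \<otimes>\<^bsub>G\<^esub> c"
    using G.conj_eq_iff hyperbolic assms by metis
  have y_pow: "y [^]\<^bsub>G\<^esub> i = inv\<^bsub>G\<^esub> c \<otimes>\<^bsub>G\<^esub> (g [^]\<^bsub>G\<^esub> i \<otimes>\<^bsub>G\<^esub> c)" for i :: int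
    using hyperbolic(1) assms(1) by (simp only: y G.conj_int_pow') (simp add: G.m_assoc)
  have "y [^]\<^bsub>G\<^esub> l \<otimes>\<^bsub>G\<^esub> \<delta> = inv\<^bsub>G\<^esub> c \<otimes>\<^bsub>G\<^esub> ((g [^]\<^bsub>G\<^esub> l \<otimes>\<^bsub>G\<^esub> \<gamma>) \<otimes>\<^bsub>G\<^esub> c)"
    using hyperbolic(1) assms(1,2) by (simp add: y_pow \<delta>_def G.m_assoc)
  also have "\<dots> = \<delta> \<otimes>\<^bsub>G\<^esub> y [^]\<^bsub>G\<^esub> m"
    using hyperbolic(1) assms(1,2) unfolding assms(3)
    by (simp add: y_pow \<delta>_def G.m_assoc)
  finally have conj: "y [^]\<^bsub>G\<^esub> l \<otimes>\<^bsub>G\<^esub> \<delta> = \<delta> \<otimes>\<^bsub>G\<^esub> y [^]\<^bsub>G\<^esub> m" .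
  \<comment> \<open>Conjugation by \<open>\<delta>\<close> changes lengths by at most
    \<open>2 * len \<delta>\<close>, while the lengths of the two powers differ by at least
    \<open>N * n\<close>; this \<open>N\<close> makes the gap too large.\<close>
  define N :: nat where "N = Suc (2 * len \<delta>)"
  have "y [^]\<^bsub>G\<^esub> (l * int N) \<otimes>\<^bsub>G\<^esub> \<delta> = \<delta> \<otimes>\<^bsub>G\<^esub> y [^]\<^bsub>G\<^esub> (m * int N)"
    using G.conj_int_pow [OF _ _ _ conj, of "int N"] hyperbolic \<delta> by (simp add: G.int_pow_pow)
  then have "y [^]\<^bsub>G\<^esub> (l * int N) = \<delta> \<otimes>\<^bsub>G\<^esub> (y [^]\<^bsub>G\<^esub> (m * int N) \<otimes>\<^bsub>G\<^esub> inv\<^bsub>G\<^esub> \<delta>)"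
    using hyperbolic(2) \<delta> by (metis G.inv_solve_right G.int_pow_closed G.inv_closed G.m_assoc G.m_closed)
  then have "len (y [^]\<^bsub>G\<^esub> (l * int N)) \<le> len \<delta> + (len (y [^]\<^bsub>G\<^esub> (m * int N)) + len (inv\<^bsub>G\<^esub> \<delta>))"
    using hyperbolic \<delta> by (auto intro!: order_trans [OF len_mult_le] add_left_mono len_mult_le)
  then have "nat \<bar>l\<bar> * N * n \<le> nat \<bar>m\<bar> * N * n + 2 * len \<delta>"
    using hyperbolic \<delta> by (simp add: len_inv abs_mult nat_mult_distrib)
  moreover have "N * n + nat \<bar>m\<bar> * N * n \<le> nat \<bar>l\<bar> * N * n"
  proof -
    have "Suc (nat \<bar>m\<bar>) \<le> nat \<bar>l\<bar>" using assms(4) by linarith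
    from mult_le_mono1 [OF this, of "N * n"] show ?thesis by (simp add: mult.assoc)
  qed
  moreover have "N \<le> N * n" using hyperbolic by simp
  moreover have "2 * len \<delta> < N" by (simp add: N_def)
  ultimately show ?thesis by linarith
qed (use that in blast)

lemma elliptic_if_pow_elliptic:
  fixes l :: int
  assumes "g \<in> carrier G" "\<gamma> \<in> carrier G" "h \<in> carrier H" "g [^]\<^bsub>G\<^esub> l \<otimes>\<^bsub>G\<^esub> \<gamma> = \<gamma> \<otimes>\<^bsub>G\<^esub> \<iota> h" "l \<noteq> 0"
  obtains c h where "c \<in> carrier G" "h \<in> carrier H" "g \<otimes>\<^bsub>G\<^esub> c = c \<otimes>\<^bsub>G\<^esub> \<iota> h"
  using assms(1)
proof (cases rule: elliptic_or_hyperbolic)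
  case (hyperbolic c y n)
  define \<delta> where "\<delta> = inv\<^bsub>G\<^esub> c \<otimes>\<^bsub>G\<^esub> \<gamma>"
  have \<delta>: "\<delta> \<in> carrier G" using hyperbolic assms by (simp add: \<delta>_def)
  have y: "y = inv\<^bsub>G\<^esub> c \<otimes>\<^bsub>G\<^esub> g \<otimes>\<^bsub>G\<^esub> c"
    using G.conj_eq_iff hyperbolic assms by metis
  have y_pow: "y [^]\<^bsub>G\<^esub> i = inv\<^bsub>G\<^esub> c \<otimes>\<^bsub>G\<^esub> (g [^]\<^bsub>G\<^esub> i \<otimes>\<^bsub>G\<^esub> c)" for i :: int
    using hyperbolic(1) assms(1) by (simp only: y G.conj_int_pow') (simp add: G.m_assoc)
  have "y [^]\<^bsub>G\<^esub> l \<otimes>\<^bsub>G\<^esub> \<delta> = inv\<^bsub>G\<^esub> c \<otimes>\<^bsub>G\<^esub> (g [^]\<^bsub>G\<^esub> l \<otimes>\<^bsub>G\<^esub> \<gamma>)"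
    using hyperbolic(1) assms(1,2) by (simp add: y_pow \<delta>_def G.m_assoc)
  also have "\<dots> = \<delta> \<otimes>\<^bsub>G\<^esub> \<iota> h"
    using hyperbolic(1) assms(2,3) by (simp add: assms(4) \<delta>_def G.m_assoc)
  finally have conj: "y [^]\<^bsub>G\<^esub> l \<otimes>\<^bsub>G\<^esub> \<delta> = \<delta> \<otimes>\<^bsub>G\<^esub> \<iota> h" .
  define N :: nat where "N = Suc (2 * len \<delta>)"
  have "y [^]\<^bsub>G\<^esub> (l * int N) \<otimes>\<^bsub>G\<^esub> \<delta> = \<delta> \<otimes>\<^bsub>G\<^esub> \<iota> (h [^]\<^bsub>H\<^esub> int N)"
    using G.conj_int_pow [OF _ _ _ conj, of "int N"] hyperbolic \<delta> assms(3)
    by (simp add: G.int_pow_pow \<iota>.hom_int_pow)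
  then have "y [^]\<^bsub>G\<^esub> (l * int N) = \<delta> \<otimes>\<^bsub>G\<^esub> (\<iota> (h [^]\<^bsub>H\<^esub> int N) \<otimes>\<^bsub>G\<^esub> inv\<^bsub>G\<^esub> \<delta>)"
    using hyperbolic(2) \<delta> assms(3)
    by (metis G.inv_solve_right G.int_pow_closed H.int_pow_closed \<iota>.hom_closed G.inv_closed G.m_assoc G.m_closed)
  \<comment> \<open>The middle term is 0, so the powers of \<open>y\<close> would have bounded
    length.\<close>
  then have "len (y [^]\<^bsub>G\<^esub> (l * int N)) \<le> len \<delta> + (len (\<iota> (h [^]\<^bsub>H\<^esub> int N)) + len (inv\<^bsub>G\<^esub> \<delta>))"
    using hyperbolic \<delta> assms(3) by (auto intro!: order_trans [OF len_mult_le] add_left_mono len_mult_le)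
  then have "nat \<bar>l\<bar> * N * n \<le> 2 * len \<delta>"
    using hyperbolic \<delta> assms(3) by (simp add: len_inv abs_mult nat_mult_distrib)
  moreover have "1 * N * 1 \<le> nat \<bar>l\<bar> * N * n"
    using assms(5) hyperbolic by (intro mult_le_mono) auto
  ultimately show ?thesis by (simp add: N_def)
qed (use that in blast)

text \<open>This and \<open>len_pinch_right\<close> turn minimality of length into the absence of
  pinches when an element is multiplied by a stable letter.\<close>

lemma len_pinch_left:
  assumes "d \<in> D e" "base_word ws" "ws \<noteq> []" "fst (hd ws) \<noteq> e"
  shows "len (st e \<otimes>\<^bsub>G\<^esub> (\<iota> d \<otimes>\<^bsub>G\<^esub> evl ws)) < length ws"
proof -
  obtain c w where ws: "ws = (\<not> e, c) # w" using assms(3,4) by (cases ws) auto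
  have w: "base_word w" "c \<in> carrier H" using assms(2) by (auto simp: ws)
  have "st e \<otimes>\<^bsub>G\<^esub> (\<iota> d \<otimes>\<^bsub>G\<^esub> evl ws) = (st e \<otimes>\<^bsub>G\<^esub> \<iota> d) \<otimes>\<^bsub>G\<^esub> (st (\<not> e) \<otimes>\<^bsub>G\<^esub> (\<iota> c \<otimes>\<^bsub>G\<^esub> evl w))"
    using assms(1) w by (simp add: ws G.m_assoc)
  also have "\<dots> = \<iota> (\<theta> e d) \<otimes>\<^bsub>G\<^esub> (\<iota> c \<otimes>\<^bsub>G\<^esub> evl w)"
    using assms(1) w by (simp add: st_commute G.m_assoc)
  also have "len \<dots> \<le> len (\<iota> (\<theta> e d)) + (len (\<iota> c) + len (evl w))"
    using assms(1) w by (intro order_trans [OF len_mult_le] add_left_mono len_mult_le) auto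
  also have "\<dots> \<le> length w" using assms(1) w len_evl_le by simp
  finally show ?thesis by (simp add: ws)
qed

lemma len_pinch_right:
  assumes "d \<in> D (\<not> e)" "base_word ws" "h \<in> carrier H"
  shows "len (\<iota> h \<otimes>\<^bsub>G\<^esub> evl (ws @ [(\<not> e, d)]) \<otimes>\<^bsub>G\<^esub> st e) \<le> length ws"
proof -
  have "st (\<not> e) \<otimes>\<^bsub>G\<^esub> (\<iota> d \<otimes>\<^bsub>G\<^esub> st e) = (st (\<not> e) \<otimes>\<^bsub>G\<^esub> \<iota> d) \<otimes>\<^bsub>G\<^esub> st e"
    using assms(1) by (simp add: G.m_assoc)
  also have "\<dots> = \<iota> (\<theta> (\<not> e) d)"
    using assms(1) by (simp add: st_commute G.m_assoc)
  finally have "\<iota> h \<otimes>\<^bsub>G\<^esub> evl (ws @ [(\<not> e, d)]) \<otimes>\<^bsub>G\<^esub> st e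
      = \<iota> h \<otimes>\<^bsub>G\<^esub> (evl ws \<otimes>\<^bsub>G\<^esub> \<iota> (\<theta> (\<not> e) d))"
    using assms by (simp add: evl_append G.m_assoc)
  also have "len \<dots> \<le> len (\<iota> h) + (len (evl ws) + len (\<iota> (\<theta> (\<not> e) d)))"
    using assms by (intro order_trans [OF len_mult_le] add_left_mono len_mult_le) auto
  also have "\<dots> \<le> length ws" using assms len_evl_le by simp
  finally show ?thesis .
qed

end

section \<open>Baumslag-Solitar groups\<close>

text \<open>Here \<open>GT\<close> plays the role of \<open>b\<close>, not of the stable letter of
  \<open>G(l,m;k)\<close>.\<close>

definition bs_relators :: "int \<Rightarrow> int \<Rightarrow> word set" where
  "bs_relators l m = {gpow GT (-1) @ gpow GA l @ gpow GT 1 @ gpow GA (-m)}"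

lemma (in group) eval_bs_relator_iff:
  assumes f: "\<And>x. f x \<in> carrier G" and r: "r \<in> bs_relators l m"
  shows "eval_word G f r = \<one> \<longleftrightarrow> f GA [^] l \<otimes> f GT = f GT \<otimes> f GA [^] m"
proof -
  have "eval_word G f r = (inv f GT \<otimes> f GA [^] l \<otimes> f GT) \<otimes> inv (f GA [^] m)"
    using f r by (simp add: bs_relators_def eval_append eval_gpow int_pow_neg m_assoc)
  also have "\<dots> = \<one> \<longleftrightarrow> inv f GT \<otimes> f GA [^] l \<otimes> f GT = f GA [^] m"
    using f by (metis inv_solve_right' l_one one_closed int_pow_closed m_closed inv_closed)
  finally show ?thesis using f conj_eq_iff by simp
qed

locale bs =
  fixes l m :: int
  assumes lm: "\<bar>l\<bar> > m" and m_pos: "m > 0"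
begin

abbreviation B :: "word set monoid" where "B \<equiv> pres_group (bs_relators l m)"

definition a :: "word set" where "a = gen_cls (bs_relators l m) GA"
definition b :: "word set" where "b = gen_cls (bs_relators l m) GT"

text \<open>Exponents of \<open>a\<close> in the associated subgroups. The relation
  \<open>a^l b = b a^m\<close> gives \<open>b a^(m q) = a^(l q) b\<close>, so multiples of
  \<open>m\<close> pass \<open>b\<close> and multiples of \<open>l\<close> pass
  \<open>b^-1\<close>.\<close>

definition DZ :: "bool \<Rightarrow> int set" where
  "DZ e = range ((*) (if e then m else l))"

definition \<theta>Z :: "bool \<Rightarrow> int \<Rightarrow> int" where
  "\<theta>Z e x = (if e then l * (x div m) else m * (x div l))"

lemma l_nonzero [simp]: "l \<noteq> 0" using lm m_pos by auto

lemma m_nonzero [simp]: "m \<noteq> 0" using m_pos by auto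

end

sublocale bs \<subseteq> B: group "pres_group (bs_relators l m)"
  by (rule group_pres)

sublocale bs \<subseteq> bz: hnn_data integer_group DZ \<theta>Z
proof (intro hnn_data.intro hnn_data_axioms.intro)
  show "subgroup (DZ e) integer_group" for e
  proof (rule subgroup.intro)
    show "x \<otimes>\<^bsub>integer_group\<^esub> y \<in> DZ e" if "x \<in> DZ e" "y \<in> DZ e" for x y
      using that by (auto simp: DZ_def simp flip: distrib_left)
    show "inv\<^bsub>integer_group\<^esub> x \<in> DZ e" if "x \<in> DZ e" for x
    proof -
      obtain q where "x = (if e then m else l) * q" using \<open>x \<in> DZ e\<close> by (auto simp: DZ_def)
      then have "- x = (if e then m else l) * (- q)" by simp
      then show ?thesis unfolding DZ_def inv_integer_group by (rule range_eqI)
    qed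
  qed (auto simp: DZ_def image_iff intro: exI [of _ 0])
qed (auto simp: DZ_def \<theta>Z_def algebra_simps simp flip: distrib_left split: if_splits)

context bs
begin

lemma a_closed [simp]: "a \<in> carrier B" and b_closed [simp]: "b \<in> carrier B"
  by (simp_all add: a_def b_def)

lemma bs_relation: "a [^]\<^bsub>B\<^esub> l \<otimes>\<^bsub>B\<^esub> b = b \<otimes>\<^bsub>B\<^esub> a [^]\<^bsub>B\<^esub> m"
proof -
  obtain r where r: "r \<in> bs_relators l m" by (simp add: bs_relators_def)
  then show ?thesis
    using B.eval_bs_relator_iff [OF _ r, of "gen_cls (bs_relators l m)"] eval_relator [OF r]
    by (simp add: a_def b_def)
qed

lemma bs_lift:
  assumes "group K" "x \<in> carrier K" "y \<in> carrier K" "x [^]\<^bsub>K\<^esub> l \<otimes>\<^bsub>K\<^esub> y = y \<otimes>\<^bsub>K\<^esub> x [^]\<^bsub>K\<^esub> m"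
  obtains h where "h \<in> hom B K" "h a = x" "h b = y"
proof -
  interpret K: group K by fact
  define f where "f s = (case s of GA \<Rightarrow> x | GT \<Rightarrow> y)" for s
  have f: "f s \<in> carrier K" for s using assms by (cases s) (auto simp: f_def)
  obtain h where "h \<in> hom B K" "\<And>s. h (gen_cls (bs_relators l m) s) = f s"
    by (rule K.pres_lift [of f "bs_relators l m"])
      (use f assms(4) K.eval_bs_relator_iff [of f] in \<open>auto simp: f_def\<close>)
  then show ?thesis using that by (simp add: a_def b_def f_def)
qed

lemma bs_hom_unique:
  assumes "group K" "h \<in> hom B K" "h' \<in> hom B K" "h a = h' a" "h b = h' b" "x \<in> carrier B"
  shows "h x = h' x"
proof (rule pres_hom_unique [OF assms(1-3) _ assms(6)])
  show "h (gen_cls (bs_relators l m) s) = h' (gen_cls (bs_relators l m) s)" for s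
    using assms(4,5) by (cases s) (auto simp: a_def b_def)
qed

lemma left_perm_pow: "bz.left_perm 1 [^]\<^bsub>BijGroup bz.NF\<^esub> i = bz.left_perm i" for i :: int
  using hom_int_pow [OF bz.left_perm_hom, of 1 i] by (simp add: group_BijGroup)

lemma ex_\<rho>Z:
  "\<exists>\<rho>. \<rho> \<in> hom B (BijGroup bz.NF) \<and> \<rho> a = bz.left_perm 1 \<and> \<rho> b = bz.letter_perm True"
proof -
  have "m \<in> DZ True" by (auto simp: DZ_def intro: range_eqI [of _ _ 1])
  moreover have "\<theta>Z True m = l" by (simp add: \<theta>Z_def)
  ultimately have "bz.left_perm 1 [^]\<^bsub>BijGroup bz.NF\<^esub> l \<otimes>\<^bsub>BijGroup bz.NF\<^esub> bz.letter_perm True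
    = bz.letter_perm True \<otimes>\<^bsub>BijGroup bz.NF\<^esub> bz.left_perm 1 [^]\<^bsub>BijGroup bz.NF\<^esub> m"
    using bz.letter_perm_left_perm [of m True] by (simp add: left_perm_pow)
  then show ?thesis
    using bs_lift [OF group_BijGroup bz.left_perm_closed bz.letter_perm_closed, of 1 True]
    by (metis UNIV_I carrier_integer_group)
qed

text \<open>The action is a parameter of \<open>hnn\<close>, so one homomorphism is fixed
  here.\<close>

definition \<rho>Z :: "word set \<Rightarrow> int \<times> (bool \<times> int) list \<Rightarrow> int \<times> (bool \<times> int) list" where
  "\<rho>Z = (SOME \<rho>. \<rho> \<in> hom B (BijGroup bz.NF) \<and> \<rho> a = bz.left_perm 1 \<and> \<rho> b = bz.letter_perm True)"

lemma \<rho>Z: "\<rho>Z \<in> hom B (BijGroup bz.NF)" "\<rho>Z a = bz.left_perm 1" "\<rho>Z b = bz.letter_perm True"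
  using someI_ex [OF ex_\<rho>Z] by (simp_all add: \<rho>Z_def)

end

text \<open>The lower layer: the Baumslag-Solitar group as an HNN extension of the integers, with
  stable letter \<open>b\<close>. In particular \<open>a\<close> has infinite order.\<close>

sublocale bs \<subseteq> bz: hnn integer_group DZ \<theta>Z "pres_group (bs_relators l m)" "\<lambda>i. a [^]\<^bsub>B\<^esub> i" b \<rho>Z
proof
  show "(\<lambda>i. a [^]\<^bsub>B\<^esub> i) \<in> hom integer_group B"
    by (auto simp: hom_def B.int_pow_mult)
  show "b \<otimes>\<^bsub>B\<^esub> a [^]\<^bsub>B\<^esub> d = a [^]\<^bsub>B\<^esub> \<theta>Z True d \<otimes>\<^bsub>B\<^esub> b" if d: "d \<in> DZ True" for d
  proof -
    obtain q where q: "d = m * q" using d by (auto simp: DZ_def)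
    show ?thesis
      using B.conj_int_pow [OF _ _ _ bs_relation, of q] by (simp add: q \<theta>Z_def B.int_pow_pow)
  qed
  show "\<rho>Z (a [^]\<^bsub>B\<^esub> h) = bz.left_perm h" for h
    using hom_int_pow [OF \<rho>Z(1) a_closed _ group_BijGroup, of h]
    by (simp add: \<rho>Z(2) left_perm_pow)
  show "g \<in> generate B (insert b ((\<lambda>i::int. a [^]\<^bsub>B\<^esub> i) ` carrier integer_group))"
    if "g \<in> carrier B" for g
  proof -
    have *: "gen_cls (bs_relators l m) s \<in> insert b (range (\<lambda>i::int. a [^]\<^bsub>B\<^esub> i))" for s
      using B.int_pow_1 [OF a_closed] by (cases s) (auto simp: a_def b_def intro: range_eqI [of _ _ 1])
    have "range (gen_cls (bs_relators l m)) \<subseteq> insert b ((\<lambda>i::int. a [^]\<^bsub>B\<^esub> i) ` carrier integer_group)"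
      unfolding carrier_integer_group by (rule image_subsetI) (rule *)
    then show ?thesis using B.mono_generate pres_generate [OF that] by blast
  qed
qed (simp_all add: \<rho>Z)

context bs
begin

section \<open>The exponent sum of \<open>b\<close> and conjugacy of powers of
  \<open>a\<close>\<close>

lemma ex_exponent: "\<exists>\<sigma>. \<sigma> \<in> hom B integer_group \<and> \<sigma> a = 0 \<and> \<sigma> b = 1"
proof -
  have "0 [^]\<^bsub>integer_group\<^esub> l \<otimes>\<^bsub>integer_group\<^esub> 1 = 1 \<otimes>\<^bsub>integer_group\<^esub> 0 [^]\<^bsub>integer_group\<^esub> m"
    by simp
  then show ?thesis
    using bs_lift [OF group_integer_group, of 0 1] by (metis UNIV_I carrier_integer_group)
qed

text \<open>A conjugacy invariant that separates powers of \<open>b\<close> from powers of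
  \<open>a\<close>; by \<open>a_pow_conj\<close> it is also the power of \<open>l/m\<close> by which
  an element scales exponents of \<open>a\<close>.\<close>

definition \<sigma> :: "word set \<Rightarrow> int" where
  "\<sigma> = (SOME \<sigma>. \<sigma> \<in> hom B integer_group \<and> \<sigma> a = 0 \<and> \<sigma> b = 1)"

lemma \<sigma>_hom: "\<sigma> \<in> hom B integer_group" and \<sigma>_a [simp]: "\<sigma> a = 0" and \<sigma>_b [simp]: "\<sigma> b = 1"
  using someI_ex [OF ex_exponent] by (simp_all add: \<sigma>_def)

lemma \<sigma>_mult [simp]: "x \<in> carrier B \<Longrightarrow> y \<in> carrier B \<Longrightarrow> \<sigma> (x \<otimes>\<^bsub>B\<^esub> y) = \<sigma> x + \<sigma> y"
  using \<sigma>_hom by (simp add: hom_def)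

lemma \<sigma>_pow [simp]: "x \<in> carrier B \<Longrightarrow> \<sigma> (x [^]\<^bsub>B\<^esub> i) = i * \<sigma> x" for i :: int
  using hom_int_pow [OF \<sigma>_hom _ _ group_integer_group, of x i] by simp

lemma \<sigma>_one [simp]: "\<sigma> \<one>\<^bsub>B\<^esub> = 0"
  using \<sigma>_pow [of a 0] by simp

lemma \<sigma>_conj:
  assumes "x \<in> carrier B" "g \<in> carrier B" "y \<in> carrier B" "x \<otimes>\<^bsub>B\<^esub> g = g \<otimes>\<^bsub>B\<^esub> y"
  shows "\<sigma> x = \<sigma> y"
  using arg_cong [OF assms(4), of \<sigma>] assms(1-3) by simp

lemma \<sigma>_st: "\<sigma> (bz.st e) = (if e then 1 else -1)"
proof -
  have "\<sigma> (inv\<^bsub>B\<^esub> b) = - 1"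
    using \<sigma>_mult [of "inv\<^bsub>B\<^esub> b" b] by simp
  then show ?thesis by (simp add: bz.st_def)
qed

lemma a_pow_eq_iff [simp]: "a [^]\<^bsub>B\<^esub> i = a [^]\<^bsub>B\<^esub> j \<longleftrightarrow> i = j" for i j :: int
  using bz.\<iota>_eq_iff [of i j] by simp

text \<open>Each letter \<open>b^e\<close> of the conjugator forces the current exponent into
  \<open>DZ (\<not> e)\<close> and replaces it by its image under \<open>\<theta>Z\<close>. One such
  step contributes a factor \<open>l/m\<close> or its inverse, and both the exponents before and
  after it are divisible by \<open>l\<close> or \<open>m\<close>.\<close>

lemma a_pow_conj_word:
  assumes "bz.base_word ws" "successively bz.red ws"
    "a [^]\<^bsub>B\<^esub> i \<otimes>\<^bsub>B\<^esub> (a [^]\<^bsub>B\<^esub> (h::int) \<otimes>\<^bsub>B\<^esub> bz.evl ws) = (a [^]\<^bsub>B\<^esub> h \<otimes>\<^bsub>B\<^esub> bz.evl ws) \<otimes>\<^bsub>B\<^esub> a [^]\<^bsub>B\<^esub> (j::int)"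
  shows "(ws = [] \<longrightarrow> i = j) \<and> (ws \<noteq> [] \<longrightarrow> (l dvd i \<or> m dvd i) \<and> (l dvd j \<or> m dvd j))
    \<and> (of_int i :: rat) = of_int j * (of_int l / of_int m) powi \<sigma> (bz.evl ws)"
  using assms
proof (induction ws arbitrary: i h)
  case Nil
  then have "a [^]\<^bsub>B\<^esub> (i + h) = a [^]\<^bsub>B\<^esub> (h + j)" by (simp add: B.int_pow_mult)
  then show ?case by simp
next
  case (Cons p ws)
  let ?e = "fst p" and ?i = "\<theta>Z (\<not> fst p) i"
  have wf: "bz.base_word ws" "successively bz.red ws"
    using Cons.prems by (auto simp: successively_Cons)
  have i: "i \<in> DZ (\<not> ?e)"
    using bz.conj_base [OF _ _ _ Cons.prems(1,2), of i j h] Cons.prems(3)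
    by (simp del: bz.evl.simps)
  have "a [^]\<^bsub>B\<^esub> ?i \<otimes>\<^bsub>B\<^esub> (a [^]\<^bsub>B\<^esub> snd p \<otimes>\<^bsub>B\<^esub> bz.evl ws)
      = (a [^]\<^bsub>B\<^esub> snd p \<otimes>\<^bsub>B\<^esub> bz.evl ws) \<otimes>\<^bsub>B\<^esub> a [^]\<^bsub>B\<^esub> j"
    using bz.conj_step [OF _ _ _ Cons.prems(1), of i j h i] Cons.prems(3) i
    by (simp del: bz.evl.simps)
  from Cons.IH [OF wf this]
  have IH: "ws = [] \<longrightarrow> ?i = j" "ws \<noteq> [] \<longrightarrow> l dvd j \<or> m dvd j"
    "(of_int ?i :: rat) = of_int j * (of_int l / of_int m) powi \<sigma> (bz.evl ws)"
    by auto
  have "bz.evl ws \<in> carrier B" using wf by simp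
  then have \<sigma>: "\<sigma> (bz.evl (p # ws)) = (if ?e then 1 else -1) + \<sigma> (bz.evl ws)"
    by (simp add: \<sigma>_st)
  have "l dvd i \<or> m dvd i" using i by (auto simp: DZ_def split: if_splits)
  moreover have "l dvd j \<or> m dvd j" using IH(1,2) by (cases "ws = []") (auto simp: \<theta>Z_def)
  moreover have "(of_int i :: rat) = of_int ?i * (of_int l / of_int m) powi (if ?e then 1 else -1)"
    using i by (auto simp: DZ_def \<theta>Z_def power_int_minus split: if_splits)
  ultimately show ?case
    unfolding \<sigma> by (simp add: IH(3) power_int_add del: bz.evl.simps)
qed

lemma a_pow_conj:
  assumes "g \<in> carrier B" "a [^]\<^bsub>B\<^esub> i \<otimes>\<^bsub>B\<^esub> g = g \<otimes>\<^bsub>B\<^esub> a [^]\<^bsub>B\<^esub> (j::int)"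
  shows "i = j \<or> (l dvd i \<or> m dvd i) \<and> (l dvd j \<or> m dvd j)"
    "(of_int i :: rat) = of_int j * (of_int l / of_int m) powi \<sigma> g"
proof -
  obtain h ws where *: "bz.base_word ws" "successively bz.red ws" "g = a [^]\<^bsub>B\<^esub> (h::int) \<otimes>\<^bsub>B\<^esub> bz.evl ws"
    using bz.obtain_reduced [OF assms(1)] by metis
  then have "\<sigma> g = \<sigma> (bz.evl ws)" by simp
  then show "i = j \<or> (l dvd i \<or> m dvd i) \<and> (l dvd j \<or> m dvd j)"
    "(of_int i :: rat) = of_int j * (of_int l / of_int m) powi \<sigma> g"
    using a_pow_conj_word [OF *(1,2), of i h j] assms(2) *(3) by auto
qed

text \<open>True because \<open>l/m\<close> has absolute value above 1; it turns equal scaling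
  factors into equal exponent sums.\<close>

lemma ratio_powi_eq_iff:
  "((of_int l / of_int m) powi i :: rat) = (of_int l / of_int m) powi j \<longleftrightarrow> i = j"
proof
  let ?x = "of_int l / of_int m :: rat"
  assume "?x powi i = ?x powi j"
  then have "\<bar>?x\<bar> powi i = \<bar>?x\<bar> powi j" by (metis power_int_abs)
  moreover have "\<bar>?x\<bar> > 1"
    using lm m_pos by (simp add: abs_divide flip: of_int_abs)
  ultimately show "i = j"
    using power_int_strict_increasing [of i j "\<bar>?x\<bar>"] power_int_strict_increasing [of j i "\<bar>?x\<bar>"]
    by (cases i j rule: linorder_cases) auto
qed simp

section \<open>The centralizer of a nontrivial power of \<open>b\<close>\<close>

lemma b_pow_evl: "b [^]\<^bsub>B\<^esub> n = bz.evl (replicate n (True, 0))" for n :: nat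
proof (induction n)
  case (Suc n)
  have "b [^]\<^bsub>B\<^esub> Suc n = b \<otimes>\<^bsub>B\<^esub> b [^]\<^bsub>B\<^esub> n" by (rule B.nat_pow_Suc2) simp
  then show ?case using Suc by (simp add: bz.st_def bz.base_word_def)
qed simp

text \<open>If \<open>g\<close> has minimal length in its double coset of \<open>\<langle>b\<rangle>\<close> and is not in \<open>\<langle>a\<rangle>\<close>, then
  \<open>b\<^sup>n g\<close> and \<open>g b\<^sup>n\<close> are both reduced as written, and their normal forms are different.\<close>
lemma minimal_commuting:
  assumes "g \<in> carrier B" "b [^]\<^bsub>B\<^esub> Suc n \<otimes>\<^bsub>B\<^esub> g = g \<otimes>\<^bsub>B\<^esub> b [^]\<^bsub>B\<^esub> Suc n"
    and min: "\<And>x. x \<in> {b \<otimes>\<^bsub>B\<^esub> g, inv\<^bsub>B\<^esub> b \<otimes>\<^bsub>B\<^esub> g, g \<otimes>\<^bsub>B\<^esub> b} \<Longrightarrow> bz.len g \<le> bz.len x"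
  shows "g = \<one>\<^bsub>B\<^esub>"
proof -
  obtain r ws where ws: "bz.base_word ws" "successively bz.red ws"
    "g = a [^]\<^bsub>B\<^esub> (r::int) \<otimes>\<^bsub>B\<^esub> bz.evl ws" "bz.len g = length ws"
    using bz.obtain_reduced [OF assms(1)] by metis
  have "ws = []"
  proof (rule ccontr)
    assume ne: "ws \<noteq> []"
    \<comment> \<open>Otherwise multiplying \<open>g\<close> on the left by \<open>b\<close> or its
      inverse would shorten it.\<close>
    have left: "r \<notin> DZ e" if "fst (hd ws) \<noteq> e" for e
    proof
      assume "r \<in> DZ e"
      from bz.len_pinch_left [OF this ws(1) ne that] show False
        using min [of "bz.st e \<otimes>\<^bsub>B\<^esub> g"] ws(3,4) by (cases e) (auto simp: bz.st_def)
    qed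
    have right: "bz.red (last ws) (True, 0)"
    proof -
      have False if "\<not> fst (last ws)" "snd (last ws) \<in> DZ False"
      proof -
        have split: "ws = butlast ws @ [(\<not> True, snd (last ws))]"
          using that(1) append_butlast_last_id [OF ne] by (metis (full_types) prod.collapse)
        have "bz.base_word (butlast ws)"
          using ws(1) by (metis append_butlast_last_id bz.base_word_simps(3) ne)
        then have "bz.len (a [^]\<^bsub>B\<^esub> r \<otimes>\<^bsub>B\<^esub> bz.evl ws \<otimes>\<^bsub>B\<^esub> bz.st True) \<le> length (butlast ws)"
          using bz.len_pinch_right [of "snd (last ws)" True "butlast ws" r] that(2) split by simp
        then have "bz.len (g \<otimes>\<^bsub>B\<^esub> b) \<le> length (butlast ws)"
          by (simp add: ws(3) bz.st_def)
        moreover have "length (butlast ws) < length ws" using ne by simp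
        ultimately show False
          using min [of "g \<otimes>\<^bsub>B\<^esub> b"] ws(4) by simp
      qed
      then show ?thesis by (auto simp: bz.red_def)
    qed
    \<comment> \<open>Reduced words: \<open>us\<close> for \<open>b^(n+1) g\<close>, where the last
      \<open>b\<close> absorbs the head \<open>a^r\<close> of \<open>g\<close>, and
      \<open>vs\<close> for \<open>g b^(n+1)\<close> without that head.\<close>
    define us where "us = replicate n (True, 0::int) @ (True, r) # ws"
    define vs where "vs = ws @ replicate (Suc n) (True, 0::int)"
    have rep: "successively bz.red (replicate k (True, 0))" for k
      by (induction k) (auto simp: successively_Cons bz.red_def split: nat.splits)
    have us: "bz.base_word us" "us \<noteq> []" "fst (hd us)"
      using ws(1) by (auto simp: us_def bz.base_word_def hd_append)
    have "bz.red (True, r) (hd ws)" using left by (auto simp: bz.red_def)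
    then have us_red: "successively bz.red us"
      using rep ws(2) by (auto simp: us_def successively_append_iff successively_Cons bz.red_def)
    have vs: "bz.base_word vs" "vs \<noteq> []" "hd vs = hd ws"
      using ws(1) ne by (auto simp: vs_def bz.base_word_def)
    have vs_red: "successively bz.red vs"
      using rep [of "Suc n"] ws(2) right by (auto simp: vs_def successively_append_iff)
    have evl_us: "bz.evl us = b [^]\<^bsub>B\<^esub> Suc n \<otimes>\<^bsub>B\<^esub> g"
    proof -
      have "bz.evl us = bz.evl (replicate n (True, 0)) \<otimes>\<^bsub>B\<^esub> bz.evl ((True, r) # ws)"
        unfolding us_def using ws(1) by (intro bz.evl_append) (auto simp: bz.base_word_def)
      also have "\<dots> = b [^]\<^bsub>B\<^esub> n \<otimes>\<^bsub>B\<^esub> (b \<otimes>\<^bsub>B\<^esub> g)"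
        by (simp add: ws(3) bz.st_def flip: b_pow_evl)
      finally show ?thesis using assms(1) by (simp add: B.m_assoc)
    qed
    have evl_vs: "a [^]\<^bsub>B\<^esub> r \<otimes>\<^bsub>B\<^esub> bz.evl vs = g \<otimes>\<^bsub>B\<^esub> b [^]\<^bsub>B\<^esub> Suc n"
    proof -
      have "bz.evl vs = bz.evl ws \<otimes>\<^bsub>B\<^esub> bz.evl (replicate (Suc n) (True, 0))"
        unfolding vs_def using ws(1) by (intro bz.evl_append) (auto simp: bz.base_word_def)
      then show ?thesis
        using ws(1) by (simp only: ws(3) B.m_assoc bz.evl_closed B.int_pow_closed B.nat_pow_closed
            a_closed b_closed flip: b_pow_evl)
    qed
    obtain z c w where z: "\<rho>Z (bz.evl us) (0, []) = (z, (fst (hd us), c) # w)" "z \<in> DZ (\<not> fst (hd us))"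
      by (rule bz.britton [OF us(1) us_red us(2), of 0]) auto
    obtain z' c' w' where z': "\<rho>Z (bz.evl vs) (0, []) = (z', (fst (hd vs), c') # w')"
      "z' \<in> DZ (\<not> fst (hd vs))"
      by (rule bz.britton [OF vs(1) vs_red vs(2), of 0]) auto
    have NF: "(z', (fst (hd vs), c') # w') \<in> bz.NF"
      using bz.\<rho>_closed [of "bz.evl vs" "(0, [])"] vs(1) by (simp add: z')
    have "\<rho>Z (a [^]\<^bsub>B\<^esub> r \<otimes>\<^bsub>B\<^esub> bz.evl vs) (0, []) = (r + z', (fst (hd vs), c') # w')"
      using vs(1) z' NF by (simp add: bz.\<rho>_mult)
    \<comment> \<open>As the first signs agree, \<open>ws\<close> begins with \<open>b\<close>. So
      \<open>z\<close> and \<open>z'\<close> both lie in \<open>DZ False\<close>, hence so does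
      \<open>r\<close>, against \<open>left\<close>.\<close>
    then have "z = r + z'" "fst (hd us) = fst (hd vs)"
      using z(1) evl_us evl_vs assms(2) by auto
    then have "r \<in> DZ False" "fst (hd ws)"
      using z(2) z'(2) us(3) vs(3) bz.D_mult_right_iff [of z' False r] by auto
    then show False using left by blast
  qed
  then have g: "g = a [^]\<^bsub>B\<^esub> r" by (simp add: ws(3))
  have "b [^]\<^bsub>B\<^esub> Suc n = b [^]\<^bsub>B\<^esub> int (Suc n)" by (simp only: int_pow_int)
  with assms(2) g have "a [^]\<^bsub>B\<^esub> r \<otimes>\<^bsub>B\<^esub> b [^]\<^bsub>B\<^esub> int (Suc n) = b [^]\<^bsub>B\<^esub> int (Suc n) \<otimes>\<^bsub>B\<^esub> a [^]\<^bsub>B\<^esub> r"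
    by metis
  \<comment> \<open>The power of \<open>b\<close> fixes the exponent \<open>r\<close> but scales it
    by a ratio different from 1, so \<open>r = 0\<close>.\<close>
  then have "(of_int r :: rat) = of_int r * (of_int l / of_int m) powi \<sigma> (b [^]\<^bsub>B\<^esub> int (Suc n))"
    by (intro a_pow_conj(2)) auto
  moreover have "\<sigma> (b [^]\<^bsub>B\<^esub> int (Suc n)) = int (Suc n)" by (simp only: \<sigma>_pow b_closed \<sigma>_b mult_1_right)
  ultimately have "r = 0 \<or> (of_int l / of_int m :: rat) powi int (Suc n) = (of_int l / of_int m) powi 0"
    by (metis mult_cancel_left1 of_int_0_eq_iff power_int_0_right)
  then show ?thesis unfolding ratio_powi_eq_iff by (simp add: g)
qed

text \<open>Among all \<open>b^p g b^q\<close>, which commute with \<open>b^j\<close> as well, one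
  of minimal length is trivial by \<open>minimal_commuting\<close>; so \<open>g\<close> is a power
  of \<open>b\<close>.\<close>

lemma centralizer_b_pow:
  fixes j :: int
  assumes "g \<in> carrier B" "b [^]\<^bsub>B\<^esub> j \<otimes>\<^bsub>B\<^esub> g = g \<otimes>\<^bsub>B\<^esub> b [^]\<^bsub>B\<^esub> j" "j \<noteq> 0"
  obtains p :: int where "g = b [^]\<^bsub>B\<^esub> p"
proof -
  define f where "f pq = b [^]\<^bsub>B\<^esub> fst pq \<otimes>\<^bsub>B\<^esub> g \<otimes>\<^bsub>B\<^esub> b [^]\<^bsub>B\<^esub> snd pq" for pq :: "int \<times> int"
  obtain pq where min: "\<And>pq'. bz.len (f pq) \<le> bz.len (f pq')"
    using ex_has_least_nat [of "\<lambda>_. True" _ "\<lambda>pq. bz.len (f pq)"] by blast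
  obtain p q where pq: "pq = (p, q)" by force
  define g' where "g' = f pq"
  have g': "g' \<in> carrier B" using assms(1) by (simp add: g'_def f_def)
  have comm: "b [^]\<^bsub>B\<^esub> i \<otimes>\<^bsub>B\<^esub> (b [^]\<^bsub>B\<^esub> j \<otimes>\<^bsub>B\<^esub> y) = b [^]\<^bsub>B\<^esub> j \<otimes>\<^bsub>B\<^esub> (b [^]\<^bsub>B\<^esub> i \<otimes>\<^bsub>B\<^esub> y)"
    if "y \<in> carrier B" for i j :: int and y
    using that by (simp add: B.m_assoc [symmetric] B.int_pow_mult [symmetric] add.commute)
  have "b [^]\<^bsub>B\<^esub> j \<otimes>\<^bsub>B\<^esub> g' = b [^]\<^bsub>B\<^esub> p \<otimes>\<^bsub>B\<^esub> ((b [^]\<^bsub>B\<^esub> j \<otimes>\<^bsub>B\<^esub> g) \<otimes>\<^bsub>B\<^esub> b [^]\<^bsub>B\<^esub> q)"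
    using assms(1) comm [of "g \<otimes>\<^bsub>B\<^esub> b [^]\<^bsub>B\<^esub> q" p j] by (simp add: g'_def f_def pq B.m_assoc)
  also have "\<dots> = b [^]\<^bsub>B\<^esub> p \<otimes>\<^bsub>B\<^esub> (g \<otimes>\<^bsub>B\<^esub> (b [^]\<^bsub>B\<^esub> j \<otimes>\<^bsub>B\<^esub> b [^]\<^bsub>B\<^esub> q))"
    unfolding assms(2) using assms(1) by (simp add: B.m_assoc)
  also have "b [^]\<^bsub>B\<^esub> j \<otimes>\<^bsub>B\<^esub> b [^]\<^bsub>B\<^esub> q = b [^]\<^bsub>B\<^esub> q \<otimes>\<^bsub>B\<^esub> b [^]\<^bsub>B\<^esub> j"
    by (simp add: B.int_pow_mult [symmetric] add.commute)
  finally have g'_comm: "b [^]\<^bsub>B\<^esub> j \<otimes>\<^bsub>B\<^esub> g' = g' \<otimes>\<^bsub>B\<^esub> b [^]\<^bsub>B\<^esub> j"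
    using assms(1) by (simp add: g'_def f_def pq B.m_assoc)
  obtain n where n: "\<bar>j\<bar> = int (Suc n)" using assms(3)
    by (metis abs_ge_zero abs_eq_0 nonneg_int_cases of_nat_0 old.nat.exhaust)
  have "b [^]\<^bsub>B\<^esub> (j * sgn j) \<otimes>\<^bsub>B\<^esub> g' = g' \<otimes>\<^bsub>B\<^esub> b [^]\<^bsub>B\<^esub> (j * sgn j)"
    using B.conj_int_pow [OF _ _ _ g'_comm, of "sgn j"] g' by (simp add: B.int_pow_pow)
  then have "b [^]\<^bsub>B\<^esub> Suc n \<otimes>\<^bsub>B\<^esub> g' = g' \<otimes>\<^bsub>B\<^esub> b [^]\<^bsub>B\<^esub> Suc n"
    using n by (simp only: abs_sgn [symmetric] int_pow_int)
  then have "g' = \<one>\<^bsub>B\<^esub>"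
  proof (rule minimal_commuting [OF g'])
    fix x assume "x \<in> {b \<otimes>\<^bsub>B\<^esub> g', inv\<^bsub>B\<^esub> b \<otimes>\<^bsub>B\<^esub> g', g' \<otimes>\<^bsub>B\<^esub> b}"
    moreover have "b \<otimes>\<^bsub>B\<^esub> g' = f (1 + p, q)" "g' \<otimes>\<^bsub>B\<^esub> b = f (p, q + 1)"
      using assms(1) by (simp_all add: g'_def f_def pq B.int_pow_mult B.m_assoc)
    moreover have "inv\<^bsub>B\<^esub> b \<otimes>\<^bsub>B\<^esub> g' = f (-1 + p, q)"
      using assms(1) B.int_pow_mult [of b "-1" p]
      by (simp add: g'_def f_def pq B.int_pow_neg B.m_assoc)
    ultimately have "\<exists>pq'. x = f pq'" by blast
    then show "bz.len g' \<le> bz.len x" using min by (auto simp: g'_def)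
  qed
  then have "b [^]\<^bsub>B\<^esub> (-p) \<otimes>\<^bsub>B\<^esub> (b [^]\<^bsub>B\<^esub> p \<otimes>\<^bsub>B\<^esub> g \<otimes>\<^bsub>B\<^esub> b [^]\<^bsub>B\<^esub> q) \<otimes>\<^bsub>B\<^esub> b [^]\<^bsub>B\<^esub> (-q)
      = b [^]\<^bsub>B\<^esub> (-p) \<otimes>\<^bsub>B\<^esub> b [^]\<^bsub>B\<^esub> (-q)"
    by (simp add: g'_def f_def pq)
  then have "g = b [^]\<^bsub>B\<^esub> (-p + -q)"
    using assms(1) B.int_pow_mult [of b "-p" "-q"] by (simp add: B.int_pow_neg B.m_assoc)
  then show ?thesis by (rule that)
qed

end

section \<open>The groups \<open>G(l,m;k)\<close>\<close>

definition g_relators :: "int \<Rightarrow> int \<Rightarrow> int \<Rightarrow> word set" where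
  "g_relators l m k = {gpow GT (-1) @ gpow GA (- k) @ gpow GT 1 @ gpow GA l @ gpow GT (-1)
    @ gpow GA k @ gpow GT 1 @ gpow GA (- m)}"

lemma G_eq: "G l m k = pres_group (g_relators l m k)"
  by (simp add: G_def g_relators_def)

definition gA :: "int \<Rightarrow> int \<Rightarrow> int \<Rightarrow> word set" where
  "gA l m k = gen_cls (g_relators l m k) GA"

definition gT :: "int \<Rightarrow> int \<Rightarrow> int \<Rightarrow> word set" where
  "gT l m k = gen_cls (g_relators l m k) GT"

lemma group_G: "group (G l m k)"
  by (simp add: G_eq group_pres)

lemma gA_closed [simp]: "gA l m k \<in> carrier (G l m k)"
  and gT_closed [simp]: "gT l m k \<in> carrier (G l m k)"
  by (simp_all add: gA_def gT_def G_eq)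

context group
begin

text \<open>The Baumslag-Solitar relation between \<open>x\<close> and
  \<open>b = y^-1 x^k y\<close>, written without an inverse of \<open>b\<close>.\<close>

definition g_relation :: "int \<Rightarrow> int \<Rightarrow> int \<Rightarrow> 'a \<Rightarrow> 'a \<Rightarrow> bool" where
  "g_relation l m k x y \<longleftrightarrow> x [^] l \<otimes> (inv y \<otimes> x [^] k \<otimes> y) = (inv y \<otimes> x [^] k \<otimes> y) \<otimes> x [^] m"

lemma eval_g_relator_iff:
  assumes f: "\<And>x. f x \<in> carrier G" and r: "r \<in> g_relators l m k"
  shows "eval_word G f r = \<one> \<longleftrightarrow> g_relation l m k (f GA) (f GT)"
proof -
  let ?b = "inv f GT \<otimes> f GA [^] k \<otimes> f GT"
  have b: "?b \<in> carrier G" using f by simp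
  have "eval_word G f r = (inv ?b \<otimes> f GA [^] l \<otimes> ?b) \<otimes> inv (f GA [^] m)"
    using f r by (simp add: g_relators_def eval_append eval_gpow int_pow_neg m_assoc inv_mult_group)
  then have "eval_word G f r = \<one> \<longleftrightarrow> inv ?b \<otimes> f GA [^] l \<otimes> ?b = f GA [^] m"
    using f b by (metis inv_solve_right' l_one one_closed int_pow_closed m_closed inv_closed)
  then show ?thesis
    unfolding g_relation_def using conj_eq_iff [OF _ b] f by blast
qed

end

lemma g_relation_G: "group.g_relation (G l m k) l m k (gA l m k) (gT l m k)"
proof -
  obtain r where r: "r \<in> g_relators l m k" by (simp add: g_relators_def)
  then show ?thesis
    using group.eval_g_relator_iff [OF group_pres _ r, of "gen_cls (g_relators l m k)" "g_relators l m k"]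
      eval_relator [OF r]
    by (simp add: gA_def gT_def G_eq)
qed

lemma g_lift:
  assumes "group K" "x \<in> carrier K" "y \<in> carrier K" "group.g_relation K l m k x y"
  obtains h where "h \<in> hom (G l m k) K" "h (gA l m k) = x" "h (gT l m k) = y"
proof -
  interpret K: group K by fact
  define f where "f s = (case s of GA \<Rightarrow> x | GT \<Rightarrow> y)" for s
  have f: "f s \<in> carrier K" for s using assms by (cases s) (auto simp: f_def)
  obtain h where "h \<in> hom (G l m k) K" "\<And>s. h (gen_cls (g_relators l m k) s) = f s"
    unfolding G_eq by (rule K.pres_lift [of f "g_relators l m k"])
      (use f assms(4) K.eval_g_relator_iff [of f] in \<open>auto simp: f_def\<close>)
  then show ?thesis using that by (simp add: gA_def gT_def f_def)
qed

locale gk = bs +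
  fixes k :: int
  assumes k_nonzero [simp]: "k \<noteq> 0"
begin

definition DB :: "bool \<Rightarrow> word set set" where
  "DB e = range (\<lambda>i::int. if e then b [^]\<^bsub>B\<^esub> i else a [^]\<^bsub>B\<^esub> (k * i))"

text \<open>The isomorphism between the subgroups generated by \<open>b\<close> and by
  \<open>a^k\<close>. Exponents are read off by \<open>\<sigma>\<close> for powers of
  \<open>b\<close> and by the head of the normal form for powers of \<open>a\<close>.\<close>

definition \<theta>B :: "bool \<Rightarrow> word set \<Rightarrow> word set" where
  "\<theta>B e x = (if e then a [^]\<^bsub>B\<^esub> (k * \<sigma> x) else b [^]\<^bsub>B\<^esub> (fst (bz.nf x) div k))"

lemma nf_a_pow: "bz.nf (a [^]\<^bsub>B\<^esub> i) = (i, [])" for i :: int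
  using bz.nf_\<iota> [of i] by simp

lemma \<theta>B_b [simp]: "\<theta>B True (b [^]\<^bsub>B\<^esub> i) = a [^]\<^bsub>B\<^esub> (k * i)"
  and \<theta>B_a [simp]: "\<theta>B False (a [^]\<^bsub>B\<^esub> (k * i)) = b [^]\<^bsub>B\<^esub> i" for i :: int
  by (simp_all add: \<theta>B_def nf_a_pow)

lemma DB_iff:
  "x \<in> DB e \<longleftrightarrow> (\<exists>i::int. x = (if e then b [^]\<^bsub>B\<^esub> i else a [^]\<^bsub>B\<^esub> (k * i)))"
  by (auto simp: DB_def)

end

sublocale gk \<subseteq> bh: hnn_data "pres_group (bs_relators l m)" DB \<theta>B
proof (intro hnn_data.intro hnn_data_axioms.intro)
  show "subgroup (DB e) B" for e
  proof (rule subgroup.intro)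
    show "x \<otimes>\<^bsub>B\<^esub> y \<in> DB e" if "x \<in> DB e" "y \<in> DB e" for x y
      using that by (auto simp: DB_iff distrib_left simp flip: B.int_pow_mult)
    show "\<one>\<^bsub>B\<^esub> \<in> DB e" by (auto simp: DB_iff intro: exI [of _ 0])
    show "inv\<^bsub>B\<^esub> x \<in> DB e" if "x \<in> DB e" for x
      using that by (auto simp: DB_iff simp flip: B.int_pow_neg mult_minus_right)
  qed (auto simp: DB_iff)
  show "\<theta>B e (x \<otimes>\<^bsub>B\<^esub> y) = \<theta>B e x \<otimes>\<^bsub>B\<^esub> \<theta>B e y" if "x \<in> DB e" "y \<in> DB e" for x y e
    using that
    by (cases e) (auto simp: DB_iff B.int_pow_mult [symmetric] simp flip: distrib_left)
  show "\<theta>B e x \<in> DB (\<not> e)" "\<theta>B (\<not> e) (\<theta>B e x) = x" if x: "x \<in> DB e" for x e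
  proof -
    obtain i :: int where "x = (if e then b [^]\<^bsub>B\<^esub> i else a [^]\<^bsub>B\<^esub> (k * i))"
      using x by (auto simp: DB_iff)
    then show "\<theta>B e x \<in> DB (\<not> e)" "\<theta>B (\<not> e) (\<theta>B e x) = x"
      by (cases e; simp add: DB_def)+
  qed
qed (rule group_pres)

context gk
begin

abbreviation Gk :: "word set monoid" where "Gk \<equiv> pres_group (g_relators l m k)"

abbreviation A where "A \<equiv> gA l m k"
abbreviation t where "t \<equiv> gT l m k"

lemma A_closed [simp]: "A \<in> carrier Gk" and t_closed [simp]: "t \<in> carrier Gk"
  using gA_closed gT_closed by (simp_all flip: G_eq)

lemma ex_\<iota>:
  "\<exists>\<iota>. \<iota> \<in> hom B Gk \<and> \<iota> a = A \<and> \<iota> b = inv\<^bsub>Gk\<^esub> t \<otimes>\<^bsub>Gk\<^esub> A [^]\<^bsub>Gk\<^esub> k \<otimes>\<^bsub>Gk\<^esub> t"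
proof -
  interpret Gk: group Gk by (rule group_pres)
  show ?thesis
    using bs_lift [OF group_pres, of A "g_relators l m k"
        "inv\<^bsub>Gk\<^esub> t \<otimes>\<^bsub>Gk\<^esub> A [^]\<^bsub>Gk\<^esub> k \<otimes>\<^bsub>Gk\<^esub> t"]
      g_relation_G [of l m k]
    unfolding G_eq Gk.g_relation_def by (metis A_closed t_closed Gk.int_pow_closed Gk.inv_closed Gk.m_closed)
qed

definition \<iota> :: "word set \<Rightarrow> word set" where
  "\<iota> = (SOME \<iota>. \<iota> \<in> hom B Gk \<and> \<iota> a = A
    \<and> \<iota> b = inv\<^bsub>Gk\<^esub> t \<otimes>\<^bsub>Gk\<^esub> A [^]\<^bsub>Gk\<^esub> k \<otimes>\<^bsub>Gk\<^esub> t)"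

lemma \<iota>_hom: "\<iota> \<in> hom B Gk" and \<iota>_a: "\<iota> a = A"
  and \<iota>_b: "\<iota> b = inv\<^bsub>Gk\<^esub> t \<otimes>\<^bsub>Gk\<^esub> A [^]\<^bsub>Gk\<^esub> k \<otimes>\<^bsub>Gk\<^esub> t"
  using someI_ex [OF ex_\<iota>] by (simp_all add: \<iota>_def)

text \<open>In the permutation group, too, the stable letter conjugates \<open>a^k\<close> to
  \<open>b\<close>; so the relator of \<open>G(l,m;k)\<close> reduces to the Baumslag-Solitar
  relation, which \<open>left_perm\<close> preserves.\<close>

lemma left_perm_conj:
  "inv\<^bsub>BijGroup bh.NF\<^esub> bh.letter_perm True \<otimes>\<^bsub>BijGroup bh.NF\<^esub> bh.left_perm a [^]\<^bsub>BijGroup bh.NF\<^esub> k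
    \<otimes>\<^bsub>BijGroup bh.NF\<^esub> bh.letter_perm True = bh.left_perm b"
proof -
  have "b \<in> DB True" by (auto simp: DB_iff intro: exI [of _ 1])
  moreover have "\<theta>B True b = a [^]\<^bsub>B\<^esub> k" using \<theta>B_b [of 1] by simp
  ultimately have "bh.left_perm (a [^]\<^bsub>B\<^esub> k) \<otimes>\<^bsub>BijGroup bh.NF\<^esub> bh.letter_perm True
      = bh.letter_perm True \<otimes>\<^bsub>BijGroup bh.NF\<^esub> bh.left_perm b"
    using bh.letter_perm_left_perm [of b True] by simp
  then have "inv\<^bsub>BijGroup bh.NF\<^esub> bh.letter_perm True \<otimes>\<^bsub>BijGroup bh.NF\<^esub> bh.left_perm (a [^]\<^bsub>B\<^esub> k)
    \<otimes>\<^bsub>BijGroup bh.NF\<^esub> bh.letter_perm True = bh.left_perm b"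
    by (simp add: group.conj_eq_iff [OF group_BijGroup])
  then show ?thesis
    by (simp only: hom_int_pow [OF bh.left_perm_hom a_closed group_pres group_BijGroup])
qed

lemma ex_\<rho>B:
  "\<exists>\<rho>. \<rho> \<in> hom Gk (BijGroup bh.NF) \<and> \<rho> A = bh.left_perm a \<and> \<rho> t = bh.letter_perm True"
proof -
  have "group.g_relation (BijGroup bh.NF) l m k (bh.left_perm a) (bh.letter_perm True)"
    using arg_cong [OF bs_relation, of bh.left_perm]
      hom_int_pow [OF bh.left_perm_hom a_closed group_pres group_BijGroup]
    by (simp add: group.g_relation_def [OF group_BijGroup] left_perm_conj
        hom_mult [OF bh.left_perm_hom])
  from g_lift [OF group_BijGroup _ _ this] show ?thesis
    unfolding G_eq by (metis bh.left_perm_closed bh.letter_perm_closed a_closed)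
qed

definition \<rho>B :: "word set \<Rightarrow> word set \<times> (bool \<times> word set) list \<Rightarrow> word set \<times> (bool \<times> word set) list" where
  "\<rho>B = (SOME \<rho>. \<rho> \<in> hom Gk (BijGroup bh.NF) \<and> \<rho> A = bh.left_perm a \<and> \<rho> t = bh.letter_perm True)"

lemma \<rho>B: "\<rho>B \<in> hom Gk (BijGroup bh.NF)" "\<rho>B A = bh.left_perm a" "\<rho>B t = bh.letter_perm True"
  using someI_ex [OF ex_\<rho>B] by (simp_all add: \<rho>B_def)

end

sublocale gk \<subseteq> Gk: group "pres_group (g_relators l m k)"
  by (rule group_pres)

context gk
begin

lemma t_commute: "t \<otimes>\<^bsub>Gk\<^esub> \<iota> (b [^]\<^bsub>B\<^esub> i) = A [^]\<^bsub>Gk\<^esub> (k * i) \<otimes>\<^bsub>Gk\<^esub> t" for i :: int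
proof -
  have "A [^]\<^bsub>Gk\<^esub> k \<otimes>\<^bsub>Gk\<^esub> t = t \<otimes>\<^bsub>Gk\<^esub> \<iota> b"
    by (simp add: \<iota>_b Gk.m_assoc)
  from Gk.conj_int_pow [OF _ _ _ this, of i] show ?thesis
    using \<iota>_hom by (simp add: hom_int_pow [OF \<iota>_hom b_closed group_pres group_pres] Gk.int_pow_pow
        hom_in_carrier)
qed

lemma \<iota>_a_pow: "\<iota> (a [^]\<^bsub>B\<^esub> i) = A [^]\<^bsub>Gk\<^esub> i" for i :: int
  by (simp add: hom_int_pow [OF \<iota>_hom a_closed group_pres group_pres] \<iota>_a)

text \<open>Both sides are homomorphisms on the Baumslag-Solitar group that agree on
  \<open>a\<close> and \<open>b\<close>.\<close>

lemma \<rho>B_\<iota>: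
  assumes "h \<in> carrier B"
  shows "\<rho>B (\<iota> h) = bh.left_perm h"
proof -
  interpret \<rho>: group_hom Gk "BijGroup bh.NF" \<rho>B
    using group_BijGroup \<rho>B(1) by (auto simp: group_hom_def group_hom_axioms_def)
  have "(\<rho>B \<circ> \<iota>) h = bh.left_perm h"
  proof (rule bs_hom_unique [OF group_BijGroup _ bh.left_perm_hom _ _ assms])
    show "\<rho>B \<circ> \<iota> \<in> hom B (BijGroup bh.NF)"
      by (rule hom_compose [OF \<iota>_hom \<rho>B(1)])
    show "(\<rho>B \<circ> \<iota>) a = bh.left_perm a"
      by (simp add: \<iota>_a \<rho>B(2))
    show "(\<rho>B \<circ> \<iota>) b = bh.left_perm b"
      using left_perm_conj by (simp add: \<iota>_b \<rho>B(2,3) \<rho>.hom_int_pow)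
  qed
  then show ?thesis by simp
qed

end

text \<open>The upper layer: \<open>G(l,m;k)\<close> as an HNN extension of the Baumslag-Solitar
  group, which therefore embeds in it by \<open>\<iota>\<close>.\<close>

sublocale gk \<subseteq> bh: hnn "pres_group (bs_relators l m)" DB \<theta>B "pres_group (g_relators l m k)" \<iota> t \<rho>B
proof
  show "t \<otimes>\<^bsub>Gk\<^esub> \<iota> d = \<iota> (\<theta>B True d) \<otimes>\<^bsub>Gk\<^esub> t" if d: "d \<in> DB True" for d
  proof -
    obtain i :: int where "d = b [^]\<^bsub>B\<^esub> i" using d by (auto simp: DB_iff)
    then show ?thesis using t_commute \<iota>_a_pow by simp
  qed
  show "g \<in> generate Gk (insert t (\<iota> ` carrier B))" if "g \<in> carrier Gk" for g
  proof -
    have "gen_cls (g_relators l m k) s \<in> insert t (\<iota> ` carrier B)" for s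
      using a_closed \<iota>_a by (cases s) (auto simp: gA_def gT_def intro: rev_image_eqI [of a])
    then have "range (gen_cls (g_relators l m k)) \<subseteq> insert t (\<iota> ` carrier B)"
      by (metis image_subsetI)
    then show ?thesis using Gk.mono_generate pres_generate [OF that] by blast
  qed
qed (simp_all add: \<iota>_hom \<rho>B \<rho>B_\<iota>)

context gk
begin

section \<open>Conjugates of powers of \<open>a\<close> in \<open>G(l,m;k)\<close>\<close>

lemma A_pow_eq_iff [simp]: "A [^]\<^bsub>Gk\<^esub> i = A [^]\<^bsub>Gk\<^esub> j \<longleftrightarrow> i = j" for i j :: int
  using bh.\<iota>_eq_iff [of "a [^]\<^bsub>B\<^esub> i" "a [^]\<^bsub>B\<^esub> j"] by (simp add: \<iota>_a_pow)

lemma not_b_pow_conj_a_pow: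
  fixes i j :: int
  assumes "h \<in> carrier B" "a [^]\<^bsub>B\<^esub> i \<otimes>\<^bsub>B\<^esub> h = h \<otimes>\<^bsub>B\<^esub> b [^]\<^bsub>B\<^esub> j" "i \<noteq> 0"
  shows False
proof -
  have "j = 0" using \<sigma>_conj [OF _ assms(1) _ assms(2)] by simp
  then have "a [^]\<^bsub>B\<^esub> i \<otimes>\<^bsub>B\<^esub> h = h \<otimes>\<^bsub>B\<^esub> a [^]\<^bsub>B\<^esub> (0::int)" using assms(2) by simp
  from a_pow_conj(2) [OF assms(1) this] assms(3) show False by simp
qed

text \<open>In the Bass-Serre tree, a nontrivial power of \<open>a\<close> fixes no vertex other than the base vertex
  and some of its neighbours.\<close>
lemma A_pow_conj_base:
  assumes g: "g \<in> carrier Gk" and y: "y \<in> carrier B" and i: "i \<noteq> 0"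
    and eq: "A [^]\<^bsub>Gk\<^esub> (i::int) \<otimes>\<^bsub>Gk\<^esub> g = g \<otimes>\<^bsub>Gk\<^esub> \<iota> y"
  obtains (base) h where "h \<in> carrier B" "g = \<iota> h"
  | (edge) h h' j where "h \<in> carrier B" "h' \<in> carrier B" "j \<noteq> 0"
      "a [^]\<^bsub>B\<^esub> i \<otimes>\<^bsub>B\<^esub> h = h \<otimes>\<^bsub>B\<^esub> a [^]\<^bsub>B\<^esub> (k * j)" "b [^]\<^bsub>B\<^esub> j \<otimes>\<^bsub>B\<^esub> h' = h' \<otimes>\<^bsub>B\<^esub> y"
proof -
  obtain h ws where ws: "h \<in> carrier B" "bh.base_word ws" "successively bh.red ws"
    "g = \<iota> h \<otimes>\<^bsub>Gk\<^esub> bh.evl ws"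
    using bh.obtain_reduced [OF g] by metis
  show ?thesis
  proof (cases ws)
    case Nil
    then show ?thesis using base ws by simp
  next
    case (Cons p us)
    define z where "z = inv\<^bsub>B\<^esub> h \<otimes>\<^bsub>B\<^esub> a [^]\<^bsub>B\<^esub> i \<otimes>\<^bsub>B\<^esub> h"
    have hz: "a [^]\<^bsub>B\<^esub> i \<otimes>\<^bsub>B\<^esub> h = h \<otimes>\<^bsub>B\<^esub> z" using ws(1) by (simp add: z_def B.m_assoc)
    have eq': "\<iota> (a [^]\<^bsub>B\<^esub> i) \<otimes>\<^bsub>Gk\<^esub> (\<iota> h \<otimes>\<^bsub>Gk\<^esub> bh.evl (p # us)) = (\<iota> h \<otimes>\<^bsub>Gk\<^esub> bh.evl (p # us)) \<otimes>\<^bsub>Gk\<^esub> \<iota> y"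
      using eq by (simp only: ws(4) Cons \<iota>_a_pow)
    have p: "bh.base_word (p # us)" "successively bh.red (p # us)" using ws Cons by auto
    have zD: "z \<in> DB (\<not> fst p)"
      unfolding z_def by (rule bh.conj_base [OF _ y ws(1) p eq']) simp
    \<comment> \<open>The first letter must be \<open>t\<close>, because a conjugate of a nontrivial
      power of \<open>a\<close> cannot enter the subgroup generated by \<open>b\<close>.\<close>
    have "fst p"
    proof (rule ccontr)
      assume "\<not> fst p"
      then obtain j :: int where "z = b [^]\<^bsub>B\<^esub> j" using zD by (auto simp: DB_iff)
      from not_b_pow_conj_a_pow [OF ws(1) hz [unfolded this] i] show False .
    qed
    then obtain j where j: "z = a [^]\<^bsub>B\<^esub> (k * j)" using zD by (auto simp: DB_iff)
    have "j \<noteq> 0" using a_pow_conj(2) [OF ws(1), of i "k * j"] hz i by (auto simp: j)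
    have eq2: "\<iota> (b [^]\<^bsub>B\<^esub> j) \<otimes>\<^bsub>Gk\<^esub> (\<iota> (snd p) \<otimes>\<^bsub>Gk\<^esub> bh.evl us) = (\<iota> (snd p) \<otimes>\<^bsub>Gk\<^esub> bh.evl us) \<otimes>\<^bsub>Gk\<^esub> \<iota> y"
      using bh.conj_step [OF _ y ws(1) p(1) eq' z_def zD] \<open>fst p\<close> by (simp add: j)
    have c: "snd p \<in> carrier B" using p by simp
    show ?thesis
    proof (cases us)
      case Nil
      then have "\<iota> (b [^]\<^bsub>B\<^esub> j \<otimes>\<^bsub>B\<^esub> snd p) = \<iota> (snd p \<otimes>\<^bsub>B\<^esub> y)" using eq2 c y by simp
      then have "b [^]\<^bsub>B\<^esub> j \<otimes>\<^bsub>B\<^esub> snd p = snd p \<otimes>\<^bsub>B\<^esub> y"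
        using c y by (subst (asm) bh.\<iota>_eq_iff) auto
      then show ?thesis using edge [OF ws(1) c \<open>j \<noteq> 0\<close>] hz j by simp
    next
      case (Cons q vs)
      have q: "bh.base_word (q # vs)" "successively bh.red (q # vs)" "bh.red p q"
        using p Cons by (auto simp: successively_Cons)
      \<comment> \<open>A second letter is impossible. If it is \<open>t\<close>, then
        \<open>x\<close> is a power of \<open>a\<close>, although its exponent sum is
        \<open>j \<noteq> 0\<close>. If it is \<open>t^-1\<close>, then \<open>x = b^j\<close>, so
        \<open>snd p\<close> centralizes \<open>b^j\<close> and is a power of \<open>b\<close>: a
        pinch.\<close>
      define x where "x = inv\<^bsub>B\<^esub> snd p \<otimes>\<^bsub>B\<^esub> b [^]\<^bsub>B\<^esub> j \<otimes>\<^bsub>B\<^esub> snd p"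
      have hx: "b [^]\<^bsub>B\<^esub> j \<otimes>\<^bsub>B\<^esub> snd p = snd p \<otimes>\<^bsub>B\<^esub> x" and xc: "x \<in> carrier B"
        using c by (simp_all add: x_def B.m_assoc)
      have \<sigma>x: "\<sigma> x = j" using \<sigma>_conj [OF _ c xc hx] by simp
      have xD: "x \<in> DB (\<not> fst q)"
        unfolding x_def by (rule bh.conj_base [OF _ y c q(1,2) eq2 [unfolded Cons]]) simp
      show ?thesis
      proof (cases "fst q")
        case True
        then show ?thesis using xD \<sigma>x \<open>j \<noteq> 0\<close> by (auto simp: DB_iff)
      next
        case False
        then have "x = b [^]\<^bsub>B\<^esub> j" using xD \<sigma>x by (auto simp: DB_iff)
        then obtain i' :: int where "snd p = b [^]\<^bsub>B\<^esub> i'"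
          using centralizer_b_pow [OF c _ \<open>j \<noteq> 0\<close>] hx by auto
        then have "snd p \<in> DB (fst p)" using \<open>fst p\<close> by (auto simp: DB_iff)
        then show ?thesis using q(3) False \<open>fst p\<close> by (simp add: bh.red_def)
      qed
    qed
  qed
qed

text \<open>The \<open>edge\<close> case of \<open>A_pow_conj_base\<close> would conjugate a
  nontrivial power of \<open>b\<close> to a power of \<open>a\<close>, which the exponent sum
  forbids.\<close>

lemma A_pow_conj_A_pow_base:
  assumes g: "g \<in> carrier Gk" and i: "i \<noteq> 0"
    and eq: "A [^]\<^bsub>Gk\<^esub> (i::int) \<otimes>\<^bsub>Gk\<^esub> g = g \<otimes>\<^bsub>Gk\<^esub> A [^]\<^bsub>Gk\<^esub> (j::int)"
  obtains h where "h \<in> carrier B" "g = \<iota> h" "a [^]\<^bsub>B\<^esub> i \<otimes>\<^bsub>B\<^esub> h = h \<otimes>\<^bsub>B\<^esub> a [^]\<^bsub>B\<^esub> j"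
proof -
  have y: "a [^]\<^bsub>B\<^esub> j \<in> carrier B" by simp
  have eq': "A [^]\<^bsub>Gk\<^esub> i \<otimes>\<^bsub>Gk\<^esub> g = g \<otimes>\<^bsub>Gk\<^esub> \<iota> (a [^]\<^bsub>B\<^esub> j)" using eq by (simp add: \<iota>_a_pow)
  from g y i eq' show ?thesis
  proof (cases rule: A_pow_conj_base)
    case (base h)
    then have "\<iota> (a [^]\<^bsub>B\<^esub> i \<otimes>\<^bsub>B\<^esub> h) = \<iota> (h \<otimes>\<^bsub>B\<^esub> a [^]\<^bsub>B\<^esub> j)" using eq by (simp add: \<iota>_a_pow)
    then show ?thesis using base that by (subst (asm) bh.\<iota>_eq_iff) auto
  next
    case (edge h h' j')
    then show ?thesis using \<sigma>_conj [OF _ edge(2) _ edge(5)] by simp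
  qed
qed

lemma A_pow_conj:
  assumes "g \<in> carrier Gk" "i \<noteq> 0" "A [^]\<^bsub>Gk\<^esub> (i::int) \<otimes>\<^bsub>Gk\<^esub> g = g \<otimes>\<^bsub>Gk\<^esub> A [^]\<^bsub>Gk\<^esub> (j::int)"
  shows "i = j \<or> (l dvd i \<or> m dvd i) \<and> (l dvd j \<or> m dvd j)"
    "\<exists>p. (of_int i :: rat) = of_int j * (of_int l / of_int m) powi p"
  using A_pow_conj_A_pow_base [OF assms] a_pow_conj by metis+

text \<open>Applied to the image \<open>\<beta>\<close> of \<open>b\<close> under an isomorphism,
  after a conjugation taking the image of \<open>a\<close> to \<open>A^r\<close>.\<close>

lemma A_pow_conj_A_pow_k:
  assumes "g \<in> carrier Gk" "\<beta> \<in> carrier Gk" "s \<noteq> 0" "r \<noteq> 0"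
    "A [^]\<^bsub>Gk\<^esub> (s::int) \<otimes>\<^bsub>Gk\<^esub> g = g \<otimes>\<^bsub>Gk\<^esub> \<beta>"
    "A [^]\<^bsub>Gk\<^esub> (r * l) \<otimes>\<^bsub>Gk\<^esub> \<beta> = \<beta> \<otimes>\<^bsub>Gk\<^esub> A [^]\<^bsub>Gk\<^esub> (r * m)"
  obtains h where "h \<in> carrier Gk" "A [^]\<^bsub>Gk\<^esub> s \<otimes>\<^bsub>Gk\<^esub> h = h \<otimes>\<^bsub>Gk\<^esub> A [^]\<^bsub>Gk\<^esub> k"
proof -
  obtain h where h: "h \<in> carrier B" "\<beta> = \<iota> h" "a [^]\<^bsub>B\<^esub> (r * l) \<otimes>\<^bsub>B\<^esub> h = h \<otimes>\<^bsub>B\<^esub> a [^]\<^bsub>B\<^esub> (r * m)"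
    using A_pow_conj_A_pow_base [OF assms(2) _ assms(6)] assms(4) by auto
  \<comment> \<open>Since \<open>h\<close> carries the exponent \<open>r l\<close> to
    \<open>r m\<close>, its exponent sum is 1. This excludes the \<open>base\<close> case and forces
    \<open>j = 1\<close> in the \<open>edge\<close> case.\<close>
  have "(of_int l / of_int m :: rat) powi \<sigma> h = (of_int l / of_int m) powi 1"
    using a_pow_conj(2) [OF h(1,3)] assms(4) by (simp add: field_simps)
  then have \<sigma>h: "\<sigma> h = 1" by (simp only: ratio_powi_eq_iff)
  from assms(1) h(1) assms(3) assms(5) [unfolded h(2)] show ?thesis
  proof (cases rule: A_pow_conj_base)
    case (base h')
    have "\<iota> (a [^]\<^bsub>B\<^esub> s \<otimes>\<^bsub>B\<^esub> h') = \<iota> (h' \<otimes>\<^bsub>B\<^esub> h)"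
      using assms(5) base h(1) by (simp add: \<iota>_a_pow h(2))
    then have "a [^]\<^bsub>B\<^esub> s \<otimes>\<^bsub>B\<^esub> h' = h' \<otimes>\<^bsub>B\<^esub> h"
      using base h(1) by (subst (asm) bh.\<iota>_eq_iff) auto
    from \<sigma>_conj [OF _ base(1) h(1) this] \<sigma>h show ?thesis by simp
  next
    case (edge h0 h1 j)
    have "j = 1" using \<sigma>_conj [OF _ edge(2) h(1) edge(5)] \<sigma>h by simp
    then have "\<iota> (a [^]\<^bsub>B\<^esub> s \<otimes>\<^bsub>B\<^esub> h0) = \<iota> (h0 \<otimes>\<^bsub>B\<^esub> a [^]\<^bsub>B\<^esub> k)" using edge(4) by simp
    then show ?thesis using edge(1) that [of "\<iota> h0"] by (simp add: \<iota>_a_pow)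
  qed
qed

text \<open>Ellipticity is used in both layers: first \<open>\<alpha>\<close> is conjugate to some
  \<open>x\<close> in the Baumslag-Solitar group. If the conjugator of \<open>x^l\<close> to
  \<open>x^m\<close> lies there too, \<open>x\<close> is elliptic in the lower layer; otherwise
  \<open>x^l\<close> is conjugate into an edge group, generated by \<open>a^k\<close> or by
  \<open>b\<close>.\<close>

lemma conj_A_pow:
  assumes "\<alpha> \<in> carrier Gk" "\<gamma> \<in> carrier Gk" "\<alpha> [^]\<^bsub>Gk\<^esub> l \<otimes>\<^bsub>Gk\<^esub> \<gamma> = \<gamma> \<otimes>\<^bsub>Gk\<^esub> \<alpha> [^]\<^bsub>Gk\<^esub> m"
  obtains c and r :: int where "c \<in> carrier Gk" "\<alpha> \<otimes>\<^bsub>Gk\<^esub> c = c \<otimes>\<^bsub>Gk\<^esub> A [^]\<^bsub>Gk\<^esub> r"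
proof -
  note result = that
  have lm': "\<bar>l\<bar> > \<bar>m\<bar>" using lm m_pos by simp
  obtain c x where c: "c \<in> carrier Gk" "x \<in> carrier B" "\<alpha> \<otimes>\<^bsub>Gk\<^esub> c = c \<otimes>\<^bsub>Gk\<^esub> \<iota> x"
    using bh.elliptic_if_pow_conj_pow [OF assms lm'] by metis
  have base: thesis if "h \<in> carrier B" "x \<otimes>\<^bsub>B\<^esub> h = h \<otimes>\<^bsub>B\<^esub> a [^]\<^bsub>B\<^esub> r" for h and r :: int
  proof (rule result)
    have "\<iota> x \<otimes>\<^bsub>Gk\<^esub> \<iota> h = \<iota> h \<otimes>\<^bsub>Gk\<^esub> A [^]\<^bsub>Gk\<^esub> r"
      using arg_cong [OF that(2), of \<iota>] that(1) c(2) by (simp add: \<iota>_a_pow)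
    then show "\<alpha> \<otimes>\<^bsub>Gk\<^esub> (c \<otimes>\<^bsub>Gk\<^esub> \<iota> h) = (c \<otimes>\<^bsub>Gk\<^esub> \<iota> h) \<otimes>\<^bsub>Gk\<^esub> A [^]\<^bsub>Gk\<^esub> r"
      using assms(1) c that(1) by (intro bh.conj_trans [OF _ _ _ _ _ c(3)]) auto
  qed (use c that in auto)
  define \<delta> where "\<delta> = inv\<^bsub>Gk\<^esub> c \<otimes>\<^bsub>Gk\<^esub> (\<gamma> \<otimes>\<^bsub>Gk\<^esub> c)"
  have \<delta>: "\<delta> \<in> carrier Gk" using c assms by (simp add: \<delta>_def)
  have "inv\<^bsub>Gk\<^esub> c \<otimes>\<^bsub>Gk\<^esub> \<alpha> \<otimes>\<^bsub>Gk\<^esub> c = \<iota> x" using c assms(1) by (simp add: Gk.conj_eq_iff)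
  then have pow: "\<iota> (x [^]\<^bsub>B\<^esub> i) = inv\<^bsub>Gk\<^esub> c \<otimes>\<^bsub>Gk\<^esub> (\<alpha> [^]\<^bsub>Gk\<^esub> i \<otimes>\<^bsub>Gk\<^esub> c)" for i :: int
    using Gk.conj_int_pow' [OF assms(1) c(1), of i] c assms(1)
    by (simp add: bh.\<iota>.hom_int_pow Gk.m_assoc)
  have "\<iota> (x [^]\<^bsub>B\<^esub> l) \<otimes>\<^bsub>Gk\<^esub> \<delta> = inv\<^bsub>Gk\<^esub> c \<otimes>\<^bsub>Gk\<^esub> ((\<alpha> [^]\<^bsub>Gk\<^esub> l \<otimes>\<^bsub>Gk\<^esub> \<gamma>) \<otimes>\<^bsub>Gk\<^esub> c)"
    unfolding pow using c assms(1,2) by (simp add: \<delta>_def Gk.m_assoc)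
  also have "\<dots> = \<delta> \<otimes>\<^bsub>Gk\<^esub> \<iota> (x [^]\<^bsub>B\<^esub> m)"
    unfolding pow assms(3) using c assms(1,2) by (simp add: \<delta>_def Gk.m_assoc)
  finally have conj: "\<iota> (x [^]\<^bsub>B\<^esub> l) \<otimes>\<^bsub>Gk\<^esub> \<delta> = \<delta> \<otimes>\<^bsub>Gk\<^esub> \<iota> (x [^]\<^bsub>B\<^esub> m)" .
  obtain h ws where ws: "h \<in> carrier B" "bh.base_word ws" "successively bh.red ws"
    "\<delta> = \<iota> h \<otimes>\<^bsub>Gk\<^esub> bh.evl ws"
    using bh.obtain_reduced [OF \<delta>] by metis
  show thesis
  proof (cases ws)
    case Nil
    then have "\<iota> (x [^]\<^bsub>B\<^esub> l \<otimes>\<^bsub>B\<^esub> h) = \<iota> (h \<otimes>\<^bsub>B\<^esub> x [^]\<^bsub>B\<^esub> m)"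
      using conj ws c by simp
    then have "x [^]\<^bsub>B\<^esub> l \<otimes>\<^bsub>B\<^esub> h = h \<otimes>\<^bsub>B\<^esub> x [^]\<^bsub>B\<^esub> m"
      using ws(1) c(2) by (subst (asm) bh.\<iota>_eq_iff) auto
    from bz.elliptic_if_pow_conj_pow [OF c(2) ws(1) this lm'] base show thesis by metis
  next
    case (Cons p us)
    define z where "z = inv\<^bsub>B\<^esub> h \<otimes>\<^bsub>B\<^esub> x [^]\<^bsub>B\<^esub> l \<otimes>\<^bsub>B\<^esub> h"
    have hz: "x [^]\<^bsub>B\<^esub> l \<otimes>\<^bsub>B\<^esub> h = h \<otimes>\<^bsub>B\<^esub> z" using ws(1) c(2) by (simp add: z_def B.m_assoc)
    have "z \<in> DB (\<not> fst p)"
      unfolding z_def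
      by (rule bh.conj_base [OF _ _ ws(1) ws(2,3) [unfolded Cons] conj [unfolded ws(4) Cons]])
        (use c(2) in auto)
    \<comment> \<open>The trivial power of \<open>b\<close> is counted as a power of
      \<open>a\<close>, as \<open>centralizer_b_pow\<close> needs
      \<open>j \<noteq> 0\<close>.\<close>
    then consider i :: int where "z = a [^]\<^bsub>B\<^esub> i" | j :: int where "z = b [^]\<^bsub>B\<^esub> j" "j \<noteq> 0"
      by (auto simp: DB_iff split: if_splits) (metis int_pow_0)
    then show thesis
    proof cases
      case 1
      have "x [^]\<^bsub>B\<^esub> l \<otimes>\<^bsub>B\<^esub> h = h \<otimes>\<^bsub>B\<^esub> a [^]\<^bsub>B\<^esub> i" using hz 1 by simp
      from bz.elliptic_if_pow_elliptic [OF c(2) ws(1) _ this l_nonzero] base show thesis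
        by (metis UNIV_I carrier_integer_group)
    next
      case 2
      \<comment> \<open>A root of \<open>b^j\<close> commutes with \<open>b^j\<close>, hence is
        itself a power of \<open>b\<close>; the stable letter then conjugates it to a power of
        \<open>A\<close>.\<close>
      define x' where "x' = inv\<^bsub>B\<^esub> h \<otimes>\<^bsub>B\<^esub> x \<otimes>\<^bsub>B\<^esub> h"
      have x': "x' \<in> carrier B" using ws(1) c(2) by (simp add: x'_def)
      have "x' [^]\<^bsub>B\<^esub> l = z" unfolding x'_def z_def by (rule B.conj_int_pow' [OF c(2) ws(1)])
      then have "b [^]\<^bsub>B\<^esub> j = x' [^]\<^bsub>B\<^esub> l" using 2 by simp
      moreover have "x' [^]\<^bsub>B\<^esub> l \<otimes>\<^bsub>B\<^esub> x' [^]\<^bsub>B\<^esub> (1::int) = x' [^]\<^bsub>B\<^esub> (1::int) \<otimes>\<^bsub>B\<^esub> x' [^]\<^bsub>B\<^esub> l"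
        by (simp only: B.int_pow_mult [OF x', symmetric] add.commute)
      ultimately have "b [^]\<^bsub>B\<^esub> j \<otimes>\<^bsub>B\<^esub> x' = x' \<otimes>\<^bsub>B\<^esub> b [^]\<^bsub>B\<^esub> j" using x' by simp
      then obtain i :: int where i: "x' = b [^]\<^bsub>B\<^esub> i"
        using centralizer_b_pow [OF x' _ 2(2)] by metis
      have "x \<otimes>\<^bsub>B\<^esub> h = h \<otimes>\<^bsub>B\<^esub> b [^]\<^bsub>B\<^esub> i"
        using ws(1) c(2) by (simp add: i [symmetric] x'_def B.m_assoc)
      then have "\<iota> x \<otimes>\<^bsub>Gk\<^esub> \<iota> h = \<iota> h \<otimes>\<^bsub>Gk\<^esub> \<iota> (b [^]\<^bsub>B\<^esub> i)"
        using ws(1) c(2) by (metis bh.\<iota>.hom_mult B.int_pow_closed b_closed)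
      then have 1: "\<alpha> \<otimes>\<^bsub>Gk\<^esub> (c \<otimes>\<^bsub>Gk\<^esub> \<iota> h) = (c \<otimes>\<^bsub>Gk\<^esub> \<iota> h) \<otimes>\<^bsub>Gk\<^esub> \<iota> (b [^]\<^bsub>B\<^esub> i)"
        using assms(1) c ws(1) by (intro bh.conj_trans [OF _ _ _ _ _ c(3)]) auto
      have "\<iota> (b [^]\<^bsub>B\<^esub> i) \<otimes>\<^bsub>Gk\<^esub> inv\<^bsub>Gk\<^esub> t
          = inv\<^bsub>Gk\<^esub> t \<otimes>\<^bsub>Gk\<^esub> (t \<otimes>\<^bsub>Gk\<^esub> \<iota> (b [^]\<^bsub>B\<^esub> i)) \<otimes>\<^bsub>Gk\<^esub> inv\<^bsub>Gk\<^esub> t"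
        by (simp add: Gk.m_assoc)
      also have "\<dots> = inv\<^bsub>Gk\<^esub> t \<otimes>\<^bsub>Gk\<^esub> A [^]\<^bsub>Gk\<^esub> (k * i)"
        unfolding t_commute by (simp add: Gk.m_assoc)
      finally have "\<alpha> \<otimes>\<^bsub>Gk\<^esub> (c \<otimes>\<^bsub>Gk\<^esub> \<iota> h \<otimes>\<^bsub>Gk\<^esub> inv\<^bsub>Gk\<^esub> t)
          = (c \<otimes>\<^bsub>Gk\<^esub> \<iota> h \<otimes>\<^bsub>Gk\<^esub> inv\<^bsub>Gk\<^esub> t) \<otimes>\<^bsub>Gk\<^esub> A [^]\<^bsub>Gk\<^esub> (k * i)"
        using assms(1) c ws(1) by (intro bh.conj_trans [OF _ _ _ _ _ 1]) auto
      then show thesis using c ws(1) by (intro that) auto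
    qed
  qed
qed

end

section \<open>Isomorphisms between the groups \<open>G(l,m;k)\<close>\<close>

context group
begin

text \<open>Inverting both \<open>x\<close> and the sign of \<open>k\<close> leaves
  \<open>y^-1 x^k y\<close> unchanged, and the relation is then raised to the power -1.\<close>

lemma g_relation_neg:
  assumes "x \<in> carrier G" "y \<in> carrier G" "g_relation l m k x y"
  shows "g_relation l m (- k) (inv x) y"
proof -
  have inv_pow: "(inv x) [^] i = x [^] (- i)" for i :: int
    using assms(1) by (simp add: int_pow_inv int_pow_neg)
  show ?thesis
    using conj_int_pow [OF _ _ _ assms(3) [unfolded g_relation_def], of "-1"] assms(1,2)
    by (simp add: g_relation_def inv_pow int_pow_pow)
qed

text \<open>From \<open>x^(l s) b = b x^(m s)\<close>, conjugating \<open>x^(m s)\<close> by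
  \<open>b^-1 y\<close> gives the same \<open>b\<close> as conjugating \<open>x^(l s)\<close> by
  \<open>y\<close>. The lemma \<open>g_relation_unshift\<close> undoes this change of stable
  letter.\<close>

lemma g_relation_shift:
  assumes "x \<in> carrier G" "y \<in> carrier G" "g_relation l m (l * s) x y"
    and b: "b = inv y \<otimes> x [^] (l * s) \<otimes> y"
  shows "inv (inv b \<otimes> y) \<otimes> x [^] (m * s) \<otimes> (inv b \<otimes> y) = b" "g_relation l m (m * s) x (inv b \<otimes> y)"
proof -
  have bc: "b \<in> carrier G" using assms by simp
  have rel: "x [^] l \<otimes> b = b \<otimes> x [^] m" using assms(3) by (simp add: g_relation_def b)
  have "x [^] (l * s) \<otimes> b = b \<otimes> x [^] (m * s)"
    using conj_int_pow [OF _ bc _ rel, of s] assms(1) by (simp add: int_pow_pow)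
  then have "b \<otimes> x [^] (m * s) \<otimes> inv b = x [^] (l * s)"
    using bc assms(1) by (simp add: inv_solve_right')
  moreover have "inv (inv b \<otimes> y) \<otimes> x [^] (m * s) \<otimes> (inv b \<otimes> y)
      = inv y \<otimes> (b \<otimes> x [^] (m * s) \<otimes> inv b) \<otimes> y"
    using bc assms(1,2) by (simp add: inv_mult_group m_assoc)
  ultimately show eq: "inv (inv b \<otimes> y) \<otimes> x [^] (m * s) \<otimes> (inv b \<otimes> y) = b"
    by (simp add: b)
  show "g_relation l m (m * s) x (inv b \<otimes> y)"
    unfolding g_relation_def eq by (rule rel)
qed

lemma g_relation_unshift:
  assumes "x \<in> carrier G" "y \<in> carrier G" "g_relation l m (m * s) x y"
    and b: "b = inv y \<otimes> x [^] (m * s) \<otimes> y"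
  shows "inv (b \<otimes> y) \<otimes> x [^] (l * s) \<otimes> (b \<otimes> y) = b" "g_relation l m (l * s) x (b \<otimes> y)"
proof -
  have bc: "b \<in> carrier G" using assms by simp
  have rel: "x [^] l \<otimes> b = b \<otimes> x [^] m" using assms(3) by (simp add: g_relation_def b)
  have "x [^] (l * s) \<otimes> b = b \<otimes> x [^] (m * s)"
    using conj_int_pow [OF _ bc _ rel, of s] assms(1) by (simp add: int_pow_pow)
  then have "inv b \<otimes> x [^] (l * s) \<otimes> b = x [^] (m * s)"
    using bc assms(1) by (simp add: conj_eq_iff)
  moreover have "inv (b \<otimes> y) \<otimes> x [^] (l * s) \<otimes> (b \<otimes> y)
      = inv y \<otimes> (inv b \<otimes> x [^] (l * s) \<otimes> b) \<otimes> y"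
    using bc assms(1,2) by (simp add: inv_mult_group m_assoc)
  ultimately show eq: "inv (b \<otimes> y) \<otimes> x [^] (l * s) \<otimes> (b \<otimes> y) = b"
    by (simp add: b)
  show "g_relation l m (l * s) x (b \<otimes> y)"
    unfolding g_relation_def eq by (rule rel)
qed

lemma g_relation_pow:
  assumes "x \<in> carrier G" "y \<in> carrier G" "g_relation l 1 (p * k) x y"
  shows "g_relation l 1 k (x [^] p) y"
  using conj_int_pow [OF _ _ _ assms(3) [unfolded g_relation_def], of p] assms(1,2)
  by (simp add: g_relation_def int_pow_pow mult.commute)

text \<open>With \<open>m = 1\<close> and \<open>l = p q\<close>, the relation reads
  \<open>x = b^-1 x^(p q) b\<close>, so \<open>z\<close> is a \<open>p\<close>-th root of
  \<open>x\<close>. Moreover \<open>z^(p q) = x^q\<close>, so the definition of \<open>z\<close> is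
  itself the new relation.\<close>

lemma g_relation_root:
  assumes "x \<in> carrier G" "y \<in> carrier G" "g_relation (p * q) 1 k x y"
    and b: "b = inv y \<otimes> x [^] k \<otimes> y" and z: "z = inv b \<otimes> x [^] q \<otimes> b"
  shows "z [^] p = x" "g_relation (p * q) 1 (p * k) z y"
proof -
  have bc: "b \<in> carrier G" using assms by simp
  have zc: "z \<in> carrier G" using assms(1) bc by (simp add: z)
  have rel: "x [^] (p * q) \<otimes> b = b \<otimes> x" using assms(1,3) by (simp add: g_relation_def b)
  have "z [^] p = inv b \<otimes> x [^] (p * q) \<otimes> b"
    using assms(1) bc by (simp add: z conj_int_pow' int_pow_pow mult.commute)
  also have "\<dots> = x" using rel assms(1) bc by (simp add: conj_eq_iff)
  finally show zp: "z [^] p = x" .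
  have pow: "z [^] (p * i) = x [^] i" for i :: int
    using zc by (simp add: int_pow_pow [symmetric] zp)
  have "x [^] q \<otimes> b = b \<otimes> z" using assms(1) bc by (simp add: z m_assoc)
  then show "g_relation (p * q) 1 (p * k) z y"
    using zc by (simp add: g_relation_def pow b)
qed

end

lemma G_iso:
  assumes "f \<in> hom (G l m k) (G l' m' k')" "g \<in> hom (G l' m' k') (G l m k)"
    and "g (f (gA l m k)) = gA l m k" "g (f (gT l m k)) = gT l m k"
    and "f (g (gA l' m' k')) = gA l' m' k'" "f (g (gT l' m' k')) = gT l' m' k'"
  shows "G l m k \<cong> G l' m' k'"
  unfolding G_eq
proof (rule pres_iso [OF assms(1,2) [unfolded G_eq]])
  show "g (f (gen_cls (g_relators l m k) s)) = gen_cls (g_relators l m k) s" for s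
    using assms(3,4) by (cases s) (auto simp: gA_def gT_def)
  show "f (g (gen_cls (g_relators l' m' k') s)) = gen_cls (g_relators l' m' k') s" for s
    using assms(5,6) by (cases s) (auto simp: gA_def gT_def)
qed

lemma G_iso_sym: "G l m k \<cong> G l m k' \<Longrightarrow> G l m k' \<cong> G l m k"
  by (rule group.iso_sym [OF group_G])

lemma G_iso_neg: "G l m k \<cong> G l m (- k)"
proof -
  interpret K: group "G l m k" by (rule group_G)
  interpret L: group "G l m (- k)" by (rule group_G)
  obtain f where f: "f \<in> hom (G l m k) (G l m (- k))"
    "f (gA l m k) = inv\<^bsub>G l m (- k)\<^esub> gA l m (- k)" "f (gT l m k) = gT l m (- k)"
    using g_lift [OF group_G _ _ L.g_relation_neg [OF _ _ g_relation_G]] by auto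
  obtain g where g: "g \<in> hom (G l m (- k)) (G l m k)"
    "g (gA l m (- k)) = inv\<^bsub>G l m k\<^esub> gA l m k" "g (gT l m (- k)) = gT l m k"
    using g_lift [OF group_G _ _ K.g_relation_neg [OF _ _ g_relation_G]] by auto
  interpret f: group_hom "G l m k" "G l m (- k)" f by unfold_locales (rule f)
  interpret g: group_hom "G l m (- k)" "G l m k" g by unfold_locales (rule g)
  show ?thesis
    by (rule G_iso [OF f(1) g(1)]) (simp_all add: f(2,3) g(2,3))
qed

lemma G_iso_shift: "G l m (l * s) \<cong> G l m (m * s)"
proof -
  let ?G1 = "G l m (l * s)" and ?G2 = "G l m (m * s)"
  let ?a1 = "gA l m (l * s)" and ?a2 = "gA l m (m * s)"
  let ?t1 = "gT l m (l * s)" and ?t2 = "gT l m (m * s)"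
  interpret G1: group ?G1 by (rule group_G)
  interpret G2: group ?G2 by (rule group_G)
  define b1 where "b1 = inv\<^bsub>?G1\<^esub> ?t1 \<otimes>\<^bsub>?G1\<^esub> ?a1 [^]\<^bsub>?G1\<^esub> (l * s) \<otimes>\<^bsub>?G1\<^esub> ?t1"
  define b2 where "b2 = inv\<^bsub>?G2\<^esub> ?t2 \<otimes>\<^bsub>?G2\<^esub> ?a2 [^]\<^bsub>?G2\<^esub> (m * s) \<otimes>\<^bsub>?G2\<^esub> ?t2"
  have b: "b1 \<in> carrier ?G1" "b2 \<in> carrier ?G2" by (simp_all add: b1_def b2_def)
  note rel1 = G1.g_relation_shift [OF gA_closed gT_closed g_relation_G b1_def]
  note rel2 = G2.g_relation_unshift [OF gA_closed gT_closed g_relation_G b2_def]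
  obtain f where f: "f \<in> hom ?G1 ?G2" "f ?a1 = ?a2" "f ?t1 = b2 \<otimes>\<^bsub>?G2\<^esub> ?t2"
    using g_lift [OF group_G _ _ rel2(2)] b by auto
  obtain g where g: "g \<in> hom ?G2 ?G1" "g ?a2 = ?a1" "g ?t2 = inv\<^bsub>?G1\<^esub> b1 \<otimes>\<^bsub>?G1\<^esub> ?t1"
    using g_lift [OF group_G _ _ rel1(2)] b by auto
  interpret f: group_hom ?G1 ?G2 f by unfold_locales (rule f)
  interpret g: group_hom ?G2 ?G1 g by unfold_locales (rule g)
  \<comment> \<open>The substitutions for the stable letters involve \<open>b1\<close> and
    \<open>b2\<close>; they are mutually inverse because these two elements correspond to each
    other.\<close>
  have fb: "f b1 = b2"
    using rel2(1) f.hom_int_pow [of ?a1 "l * s"] by (simp add: b1_def f(2,3))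
  have gb: "g b2 = b1"
    using rel1(1) g.hom_int_pow [of ?a2 "m * s"] by (simp add: b2_def g(2,3))
  show ?thesis
    by (rule G_iso [OF f(1) g(1)]) (use b in \<open>simp_all add: f(2,3) g(2,3) fb gb\<close>)
qed

lemma G_iso_divisor:
  assumes "p dvd l"
  shows "G l 1 (p * k) \<cong> G l 1 k"
proof -
  obtain q where l: "l = p * q" using assms by blast
  let ?G1 = "G l 1 (p * k)" and ?G2 = "G l 1 k"
  let ?a1 = "gA l 1 (p * k)" and ?a2 = "gA l 1 k"
  let ?t1 = "gT l 1 (p * k)" and ?t2 = "gT l 1 k"
  interpret G1: group ?G1 by (rule group_G)
  interpret G2: group ?G2 by (rule group_G)
  define b1 where "b1 = inv\<^bsub>?G1\<^esub> ?t1 \<otimes>\<^bsub>?G1\<^esub> ?a1 [^]\<^bsub>?G1\<^esub> (p * k) \<otimes>\<^bsub>?G1\<^esub> ?t1"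
  define b2 where "b2 = inv\<^bsub>?G2\<^esub> ?t2 \<otimes>\<^bsub>?G2\<^esub> ?a2 [^]\<^bsub>?G2\<^esub> k \<otimes>\<^bsub>?G2\<^esub> ?t2"
  define z where "z = inv\<^bsub>?G2\<^esub> b2 \<otimes>\<^bsub>?G2\<^esub> ?a2 [^]\<^bsub>?G2\<^esub> q \<otimes>\<^bsub>?G2\<^esub> b2"
  have b: "b1 \<in> carrier ?G1" "b2 \<in> carrier ?G2" by (simp_all add: b1_def b2_def)
  have z: "z \<in> carrier ?G2" using b by (simp add: z_def)
  note rel1 = G1.g_relation_pow [OF gA_closed gT_closed g_relation_G]
  have rel2: "z [^]\<^bsub>?G2\<^esub> p = ?a2" "G2.g_relation l 1 (p * k) z ?t2"
    using G2.g_relation_root [OF gA_closed gT_closed _ b2_def z_def, of p] g_relation_G [of l 1 k]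
    by (simp_all add: l)
  obtain f where f: "f \<in> hom ?G1 ?G2" "f ?a1 = z" "f ?t1 = ?t2"
    using g_lift [OF group_G _ _ rel2(2)] z by auto
  obtain g where g: "g \<in> hom ?G2 ?G1" "g ?a2 = ?a1 [^]\<^bsub>?G1\<^esub> p" "g ?t2 = ?t1"
    using g_lift [OF group_G _ _ rel1] by auto
  interpret f: group_hom ?G1 ?G2 f by unfold_locales (rule f)
  interpret g: group_hom ?G2 ?G1 g by unfold_locales (rule g)
  have gb: "g b2 = b1"
    using g.hom_int_pow [of ?a2 k] by (simp add: b1_def b2_def g(2,3) G1.int_pow_pow)
  have "g (?a2 [^]\<^bsub>?G2\<^esub> q) = ?a1 [^]\<^bsub>?G1\<^esub> l"
    using g.hom_int_pow [of ?a2 q] G1.int_pow_pow [of ?a1 p q] by (simp add: g(2) flip: l)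
  then have "g z = inv\<^bsub>?G1\<^esub> b1 \<otimes>\<^bsub>?G1\<^esub> ?a1 [^]\<^bsub>?G1\<^esub> l \<otimes>\<^bsub>?G1\<^esub> b1"
    using b by (simp add: z_def gb)
  also have "\<dots> = ?a1"
    using g_relation_G [of l 1 "p * k"] b G1.conj_eq_iff
    by (simp add: G1.g_relation_def flip: b1_def)
  finally have gz: "g z = ?a1" .
  have fp: "f (?a1 [^]\<^bsub>?G1\<^esub> p) = ?a2"
    using f.hom_int_pow [of ?a1 p] rel2(1) by (simp add: f(2))
  show ?thesis
    by (rule G_iso [OF f(1) g(1)]) (simp_all add: f(2,3) g(2,3) gz fp)
qed

lemma G_iso_n_number:
  fixes u :: int
  assumes "u > 0" "\<And>p. prime p \<Longrightarrow> p dvd u \<Longrightarrow> p dvd l"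
  shows "G l 1 (u * k) \<cong> G l 1 k"
  using assms
proof (induction "nat u" arbitrary: u rule: less_induct)
  case less
  show ?case
  proof (cases "u = 1")
    case True
    then show ?thesis using is_isoI [OF iso_set_refl] by simp
  next
    case False
    then obtain p where p: "prime p" "p dvd u" using prime_factor_int [of u] less.prems by auto
    then obtain v where u: "u = p * v" by blast
    have "p > 1" using p(1) prime_gt_1_int by blast
    have v: "v > 0" using u less.prems(1) \<open>p > 1\<close> by (simp add: zero_less_mult_iff)
    have "v < u" using u v \<open>p > 1\<close> by simp
    have "G l 1 (p * (v * k)) \<cong> G l 1 (v * k)"
      using less.prems(2) p by (intro G_iso_divisor) auto
    moreover have "G l 1 (v * k) \<cong> G l 1 k"
      using less.hyps [of v] v \<open>v < u\<close> less.prems(2) u by auto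
    ultimately show ?thesis using iso_trans by (auto simp: u mult.assoc)
  qed
qed

text \<open>Each use of \<open>G_iso_shift\<close> exchanges one factor \<open>l'\<close> for a
  factor \<open>m'\<close>; the factor \<open>d\<close> kept in the parameter makes it divisible by
  \<open>d * l'\<close> every time.\<close>

lemma G_iso_power:
  fixes l' m' d s :: int
  shows "G (d * l') (d * m') (l' ^ i * m' ^ j * (d * s)) \<cong> G (d * l') (d * m') (m' ^ (i + j) * (d * s))"
proof (induction i arbitrary: j)
  case 0
  then show ?case using is_isoI [OF iso_set_refl] by simp
next
  case (Suc i)
  have "G (d * l') (d * m') (d * l' * (l' ^ i * m' ^ j * s)) \<cong> G (d * l') (d * m') (d * m' * (l' ^ i * m' ^ j * s))"
    by (rule G_iso_shift)
  then have "G (d * l') (d * m') (l' ^ Suc i * m' ^ j * (d * s)) \<cong> G (d * l') (d * m') (l' ^ i * m' ^ Suc j * (d * s))"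
    by (simp add: mult_ac)
  from iso_trans [OF this Suc [of "Suc j"]] show ?case by simp
qed

lemma G_iso_ratio:
  fixes l m k1 k2 :: int
  assumes "m \<noteq> 0" "l \<noteq> 0" "gcd l m dvd k1" "gcd l m dvd k2"
    and "k1 * m ^ n = k2 * l ^ n \<or> k1 * m ^ n = - (k2 * l ^ n)"
  shows "G l m k1 \<cong> G l m k2"
proof -
  define d where "d = gcd l m"
  define l' where "l' = l div d"
  define m' where "m' = m div d"
  have l: "l = d * l'" and m: "m = d * m'" by (simp_all add: d_def l'_def m'_def)
  have cop: "coprime l' m'"
    unfolding d_def l'_def m'_def by (rule div_gcd_coprime) (use assms(1) in simp)
  have d: "d \<noteq> 0" using assms(1) by (simp add: d_def)
  have cop_n: "coprime (l' ^ n) (m' ^ n)" using cop by simp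
  have nz: "l' ^ n \<noteq> 0" "m' ^ n \<noteq> 0" using assms(1,2) l m by auto
  obtain k2' where k2': "k2' = k2 \<or> k2' = - k2" "k1 * m ^ n = k2' * l ^ n"
    using assms(5) by (metis minus_mult_left)
  have eq: "k1 * m' ^ n = k2' * l' ^ n"
    using k2'(2) d by (simp add: l m power_mult_distrib mult.left_commute)
  then have "l' ^ n dvd k1 * m' ^ n" by simp
  then obtain u where u: "k1 = l' ^ n * u"
    using cop_n coprime_dvd_mult_left_iff by blast
  have "l' ^ n * k2' = l' ^ n * (m' ^ n * u)" using eq by (auto simp: u mult_ac)
  then have v: "k2' = m' ^ n * u" using nz(1) by (metis mult_cancel_left)
  \<comment> \<open>The two powers are coprime, so this gcd is \<open>u\<close> up to sign. Here the
    hypothesis that \<open>gcd l m\<close> divides both parameters enters.\<close>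
  have "d dvd gcd (l' ^ n * u) (m' ^ n * u)"
    using assms(3,4) k2'(1) u v by (auto simp: d_def)
  then have "d dvd u" using cop by (simp add: gcd_mult_right gcd.commute [of m' l'])
  then obtain s where s: "u = d * s" by blast
  have "G l m k1 \<cong> G l m k2'"
    using G_iso_power [of d l' m' n 0 s] by (simp add: u v s l m)
  moreover have "G l m k2' \<cong> G l m k2"
    using k2'(1)
  proof
    assume "k2' = k2"
    then show ?thesis using is_isoI [OF iso_set_refl] by simp
  next
    assume "k2' = - k2"
    then show ?thesis using G_iso_neg [of l m k2'] by simp
  qed
  ultimately show ?thesis by (rule iso_trans)
qed

section \<open>Isomorphic groups have related parameters\<close>

lemma G_iso_A_image:
  assumes "bs l m" "k \<noteq> 0" "k' \<noteq> 0" "\<phi> \<in> iso (G l m k) (G l m k')"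
  obtains c and r :: int where "c \<in> carrier (G l m k')" "r \<noteq> 0"
    "\<phi> (gA l m k) \<otimes>\<^bsub>G l m k'\<^esub> c = c \<otimes>\<^bsub>G l m k'\<^esub> gA l m k' [^]\<^bsub>G l m k'\<^esub> r"
    "\<exists>h\<in>carrier (G l m k'). gA l m k' [^]\<^bsub>G l m k'\<^esub> (r * k) \<otimes>\<^bsub>G l m k'\<^esub> h
      = h \<otimes>\<^bsub>G l m k'\<^esub> gA l m k' [^]\<^bsub>G l m k'\<^esub> k'"
proof -
  interpret bs l m by fact
  interpret g: gk l m k by unfold_locales (rule assms)
  interpret g': gk l m k' by unfold_locales (rule assms)
  have hom: "\<phi> \<in> hom g.Gk g'.Gk" and inj: "inj_on \<phi> (carrier g.Gk)"
    using assms(4) by (auto simp: iso_def bij_betw_def G_eq)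
  interpret \<phi>: group_hom g.Gk g'.Gk \<phi> by unfold_locales (rule hom)
  define \<alpha> where "\<alpha> = \<phi> g.A"
  define \<tau> where "\<tau> = \<phi> g.t"
  define \<beta> where "\<beta> = inv\<^bsub>g'.Gk\<^esub> \<tau> \<otimes>\<^bsub>g'.Gk\<^esub> \<alpha> [^]\<^bsub>g'.Gk\<^esub> k \<otimes>\<^bsub>g'.Gk\<^esub> \<tau>"
  have closed: "\<alpha> \<in> carrier g'.Gk" "\<tau> \<in> carrier g'.Gk" by (simp_all add: \<alpha>_def \<tau>_def)
  then have \<beta>c: "\<beta> \<in> carrier g'.Gk" by (simp add: \<beta>_def)
  have "g.A [^]\<^bsub>g.Gk\<^esub> l \<otimes>\<^bsub>g.Gk\<^esub> (inv\<^bsub>g.Gk\<^esub> g.t \<otimes>\<^bsub>g.Gk\<^esub> g.A [^]\<^bsub>g.Gk\<^esub> k \<otimes>\<^bsub>g.Gk\<^esub> g.t)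
      = (inv\<^bsub>g.Gk\<^esub> g.t \<otimes>\<^bsub>g.Gk\<^esub> g.A [^]\<^bsub>g.Gk\<^esub> k \<otimes>\<^bsub>g.Gk\<^esub> g.t) \<otimes>\<^bsub>g.Gk\<^esub> g.A [^]\<^bsub>g.Gk\<^esub> m"
    using g_relation_G [of l m k] by (simp add: G_eq g.Gk.g_relation_def)
  from arg_cong [OF this, of \<phi>]
  have rel: "\<alpha> [^]\<^bsub>g'.Gk\<^esub> l \<otimes>\<^bsub>g'.Gk\<^esub> \<beta> = \<beta> \<otimes>\<^bsub>g'.Gk\<^esub> \<alpha> [^]\<^bsub>g'.Gk\<^esub> m"
    by (simp add: \<alpha>_def \<tau>_def \<beta>_def \<phi>.hom_int_pow)
  obtain c r where c: "c \<in> carrier g'.Gk" "\<alpha> \<otimes>\<^bsub>g'.Gk\<^esub> c = c \<otimes>\<^bsub>g'.Gk\<^esub> g'.A [^]\<^bsub>g'.Gk\<^esub> (r::int)"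
    using g'.conj_A_pow [OF closed(1) \<beta>c rel] by metis
  have "r \<noteq> 0"
  proof
    assume "r = 0"
    then have "\<phi> g.A = \<phi> \<one>\<^bsub>g.Gk\<^esub>" using c closed by (simp add: \<alpha>_def)
    then have "g.A = \<one>\<^bsub>g.Gk\<^esub>" using inj by (simp add: inj_on_eq_iff del: \<phi>.hom_one)
    then show False using g.A_pow_eq_iff [of 1 0] by simp
  qed
  \<comment> \<open>Composing with this inner automorphism reduces to the case where the image of
    \<open>a\<close> is \<open>A^r\<close> itself.\<close>
  let ?\<kappa> = "\<lambda>x. inv\<^bsub>g'.Gk\<^esub> c \<otimes>\<^bsub>g'.Gk\<^esub> x \<otimes>\<^bsub>g'.Gk\<^esub> c"
  have \<kappa>\<alpha>: "?\<kappa> (\<alpha> [^]\<^bsub>g'.Gk\<^esub> i) = g'.A [^]\<^bsub>g'.Gk\<^esub> (r * i)" for i :: int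
  proof -
    have "?\<kappa> \<alpha> = g'.A [^]\<^bsub>g'.Gk\<^esub> r" using c closed by (simp add: g'.Gk.conj_eq_iff)
    then show ?thesis
      using g'.Gk.conj_int_pow' [OF closed(1) c(1), of i] by (simp add: g'.Gk.int_pow_pow)
  qed
  have \<kappa>: "?\<kappa> (x \<otimes>\<^bsub>g'.Gk\<^esub> y) = ?\<kappa> x \<otimes>\<^bsub>g'.Gk\<^esub> ?\<kappa> y"
    if "x \<in> carrier g'.Gk" "y \<in> carrier g'.Gk" for x y
    using that c(1) by (simp add: g'.Gk.m_assoc)
  have 1: "g'.A [^]\<^bsub>g'.Gk\<^esub> (r * l) \<otimes>\<^bsub>g'.Gk\<^esub> ?\<kappa> \<beta> = ?\<kappa> \<beta> \<otimes>\<^bsub>g'.Gk\<^esub> g'.A [^]\<^bsub>g'.Gk\<^esub> (r * m)"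
    using arg_cong [OF rel, of ?\<kappa>] closed \<beta>c by (simp only: \<kappa> \<kappa>\<alpha> g'.Gk.int_pow_closed)
  have "\<alpha> [^]\<^bsub>g'.Gk\<^esub> k \<otimes>\<^bsub>g'.Gk\<^esub> \<tau> = \<tau> \<otimes>\<^bsub>g'.Gk\<^esub> \<beta>"
    using closed by (simp add: \<beta>_def g'.Gk.m_assoc)
  then have 2: "g'.A [^]\<^bsub>g'.Gk\<^esub> (r * k) \<otimes>\<^bsub>g'.Gk\<^esub> ?\<kappa> \<tau> = ?\<kappa> \<tau> \<otimes>\<^bsub>g'.Gk\<^esub> ?\<kappa> \<beta>"
    using closed \<beta>c by (metis \<kappa> \<kappa>\<alpha> g'.Gk.int_pow_closed)
  have "?\<kappa> \<tau> \<in> carrier g'.Gk" "?\<kappa> \<beta> \<in> carrier g'.Gk" using c closed \<beta>c by simp_all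
  then obtain h where "h \<in> carrier g'.Gk"
    "g'.A [^]\<^bsub>g'.Gk\<^esub> (r * k) \<otimes>\<^bsub>g'.Gk\<^esub> h = h \<otimes>\<^bsub>g'.Gk\<^esub> g'.A [^]\<^bsub>g'.Gk\<^esub> k'"
    using g'.A_pow_conj_A_pow_k [OF _ _ _ \<open>r \<noteq> 0\<close> 2 1] \<open>r \<noteq> 0\<close> assms(2) by auto
  then show ?thesis
    using that [of c r] c \<open>r \<noteq> 0\<close> by (auto simp: G_eq \<alpha>_def)
qed

text \<open>The exponents \<open>r\<close> and \<open>s\<close> belong to an isomorphism and its
  inverse. Composing the two conjugations shows that \<open>a\<close> is conjugate to
  \<open>a^(r s)\<close>, which gives the first two constraints; the last two come from
  \<open>a^(r k)\<close> and \<open>a^k'\<close>.\<close>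

lemma G_iso_parameters:
  assumes "bs l m" "k \<noteq> 0" "k' \<noteq> 0" "G l m k \<cong> G l m k'"
  obtains r s :: int where
    "r * s = 1 \<or> l dvd 1 \<or> m dvd 1" "\<exists>q. (1 :: rat) = of_int (r * s) * (of_int l / of_int m) powi q"
    "r * k = k' \<or> (l dvd r * k \<or> m dvd r * k) \<and> (l dvd k' \<or> m dvd k')"
    "\<exists>p. (of_int (r * k) :: rat) = of_int k' * (of_int l / of_int m) powi p"
proof -
  interpret bs l m by fact
  interpret g: gk l m k by unfold_locales (rule assms)
  interpret g': gk l m k' by unfold_locales (rule assms)
  obtain \<phi> where \<phi>: "\<phi> \<in> iso (G l m k) (G l m k')" using assms(4) by (auto simp: is_iso_def)
  then have hom: "\<phi> \<in> hom g.Gk g'.Gk" and inj: "inj_on \<phi> (carrier g.Gk)"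
    by (auto simp: iso_def bij_betw_def G_eq)
  interpret \<phi>: group_hom g.Gk g'.Gk \<phi> by unfold_locales (rule hom)
  define \<psi> where "\<psi> = inv_into (carrier (G l m k)) \<phi>"
  have \<psi>: "\<psi> \<in> iso (G l m k') (G l m k)"
    unfolding \<psi>_def by (rule group.iso_set_sym [OF group_G \<phi>])
  have \<phi>\<psi>: "\<phi> (\<psi> g'.A) = g'.A"
    using \<phi> unfolding \<psi>_def by (intro f_inv_into_f) (auto simp: iso_def bij_betw_def)
  obtain c r where c: "c \<in> carrier g'.Gk" "r \<noteq> 0"
    "\<phi> g.A \<otimes>\<^bsub>g'.Gk\<^esub> c = c \<otimes>\<^bsub>g'.Gk\<^esub> g'.A [^]\<^bsub>g'.Gk\<^esub> (r::int)"
    "\<exists>h\<in>carrier g'.Gk. g'.A [^]\<^bsub>g'.Gk\<^esub> (r * k) \<otimes>\<^bsub>g'.Gk\<^esub> h = h \<otimes>\<^bsub>g'.Gk\<^esub> g'.A [^]\<^bsub>g'.Gk\<^esub> k'"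
    using G_iso_A_image [OF assms(1-3) \<phi>] unfolding G_eq by metis
  obtain d s where d: "d \<in> carrier g.Gk" "s \<noteq> 0"
    "\<psi> g'.A \<otimes>\<^bsub>g.Gk\<^esub> d = d \<otimes>\<^bsub>g.Gk\<^esub> g.A [^]\<^bsub>g.Gk\<^esub> (s::int)"
    using G_iso_A_image [OF assms(1,3,2) \<psi>] unfolding G_eq by metis
  have "\<psi> g'.A \<in> carrier g.Gk" using \<psi> hom_in_carrier [of \<psi> "G l m k'" "G l m k" "gA l m k'"] by (simp add: iso_def G_eq)
  then have 1: "g'.A \<otimes>\<^bsub>g'.Gk\<^esub> \<phi> d = \<phi> d \<otimes>\<^bsub>g'.Gk\<^esub> (\<phi> g.A) [^]\<^bsub>g'.Gk\<^esub> s"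
    using arg_cong [OF d(3), of \<phi>] d(1) by (simp add: \<phi>\<psi> \<phi>.hom_int_pow)
  have 2: "(\<phi> g.A) [^]\<^bsub>g'.Gk\<^esub> s \<otimes>\<^bsub>g'.Gk\<^esub> c = c \<otimes>\<^bsub>g'.Gk\<^esub> g'.A [^]\<^bsub>g'.Gk\<^esub> (r * s)"
    using g'.Gk.conj_int_pow [OF _ c(1) _ c(3), of s] by (simp add: g'.Gk.int_pow_pow)
  have "g'.A [^]\<^bsub>g'.Gk\<^esub> (1::int) \<otimes>\<^bsub>g'.Gk\<^esub> (\<phi> d \<otimes>\<^bsub>g'.Gk\<^esub> c)
      = (\<phi> d \<otimes>\<^bsub>g'.Gk\<^esub> c) \<otimes>\<^bsub>g'.Gk\<^esub> g'.A [^]\<^bsub>g'.Gk\<^esub> (r * s)"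
    using g'.bh.conj_trans [OF _ _ _ _ _ 1 2] c(1) d(1) by simp
  then have "1 = r * s \<or> (l dvd 1 \<or> m dvd 1) \<and> (l dvd r * s \<or> m dvd r * s)"
    "\<exists>q. (of_int 1 :: rat) = of_int (r * s) * (of_int l / of_int m) powi q"
    using g'.A_pow_conj [of "\<phi> d \<otimes>\<^bsub>g'.Gk\<^esub> c" 1 "r * s"] c(1) d(1) by auto
  moreover have "r * k = k' \<or> (l dvd r * k \<or> m dvd r * k) \<and> (l dvd k' \<or> m dvd k')"
    "\<exists>p. (of_int (r * k) :: rat) = of_int k' * (of_int l / of_int m) powi p"
    using g'.A_pow_conj [of _ "r * k" k'] c(2,4) assms(2) by (metis mult_eq_0_iff)+
  ultimately show ?thesis by (intro that [of r s]) auto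
qed

lemma n_number_ratI:
  assumes "n_number_int n x" "n_number_int n y" "q = of_int x / of_int y"
  shows "n_number_rat n q"
proof -
  obtain a b where ab: "quotient_of q = (a, b)" by force
  have b: "b > 0" and cop: "coprime a b" and q: "q = of_int a / of_int b"
    using quotient_of_denom_pos [OF ab] quotient_of_coprime [OF ab] quotient_of_div [OF ab] by auto
  have nz: "x \<noteq> 0" "y \<noteq> 0" using assms(1,2) by (auto simp: n_number_int_def)
  have "(of_int (x * b) :: rat) = of_int (a * y)"
    using q assms(3) nz b by (simp add: field_simps)
  then have eq: "x * b = a * y" by (simp only: of_int_eq_iff)
  have "a dvd x * b" "b dvd a * y" using eq by (metis dvd_triv_left, metis dvd_triv_right)
  then have "a dvd x" "b dvd y"
    using cop by (metis coprime_dvd_mult_left_iff, metis coprime_commute coprime_dvd_mult_right_iff)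
  moreover have "a \<noteq> 0" using eq nz b by auto
  moreover from this have "q \<noteq> 0" using q b by simp
  ultimately show ?thesis
    using assms(1,2) b by (auto simp: n_number_rat_def ab n_number_int_def intro: dvd_trans)
qed

lemma n_number_int_mult: "n_number_int n x \<Longrightarrow> n_number_int n y \<Longrightarrow> n_number_int n (x * y)"
  by (auto simp: n_number_int_def prime_dvd_mult_iff)

lemma n_number_int_power: "n \<noteq> 0 \<Longrightarrow> n_number_int n (n ^ i)"
  by (auto simp: n_number_int_def dest: prime_dvd_power)

lemma n_number_int_dvd: "n_number_int n x \<Longrightarrow> y dvd x \<Longrightarrow> n_number_int n y"
  by (auto simp: n_number_int_def intro: dvd_trans)

text \<open>One of \<open>nat p\<close> and \<open>nat (- p)\<close> is 0, so a single integer
  equation covers both signs of \<open>p\<close>.\<close>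

lemma powi_ratio_eq_iff:
  fixes x y l m :: int
  assumes "l \<noteq> 0" "m \<noteq> 0"
  shows "(of_int x :: rat) = of_int y * (of_int l / of_int m) powi p \<longleftrightarrow>
    x * m ^ nat p * l ^ nat (- p) = y * l ^ nat p * m ^ nat (- p)"
proof -
  have "(of_int x :: rat) = of_int y * (of_int l / of_int m) powi p \<longleftrightarrow>
    (of_int (x * m ^ nat p * l ^ nat (- p)) :: rat) = of_int (y * l ^ nat p * m ^ nat (- p))"
    using assms by (cases p rule: int_cases2) (auto simp: power_int_minus field_simps)
  then show ?thesis by (simp only: of_int_eq_iff)
qed

lemma parameters_if_G_iso:
  assumes "\<bar>l\<bar> > m" "m > 0" "k1 > 0" "k2 > 0" "G l m k1 \<cong> G l m k2"
  shows "k1 = k2 \<or>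
    (m > 1 \<and> gcd l m dvd k1 \<and> gcd l m dvd k2 \<and>
      (\<exists>p::int. p \<noteq> 0 \<and>
        (of_int k1 / of_int k2 = (of_int l / of_int m :: rat) powi p \<or>
         of_int k1 / of_int k2 = - ((of_int l / of_int m :: rat) powi p)))) \<or>
    (m = 1 \<and> n_number_rat l (of_int k1 / of_int k2))"
proof -
  have bs: "bs l m" using assms(1,2) by unfold_locales
  have nz: "l \<noteq> 0" "m \<noteq> 0" using assms(1,2) by auto
  obtain r s :: int and q p where
    rs: "r * s = 1 \<or> l dvd 1 \<or> m dvd 1" "(1 :: rat) = of_int (r * s) * (of_int l / of_int m) powi q"
    and rk: "r * k1 = k2 \<or> (l dvd r * k1 \<or> m dvd r * k1) \<and> (l dvd k2 \<or> m dvd k2)"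
    "(of_int (r * k1) :: rat) = of_int k2 * (of_int l / of_int m) powi p"
    using G_iso_parameters [OF bs _ _ assms(5)] assms(3,4) by (metis less_irrefl)
  show ?thesis
  proof (cases "m = 1")
    case True
    have l: "n_number_int l (l ^ i)" for i using nz(1) by (rule n_number_int_power)
    have "1 * l ^ nat (- q) = r * s * l ^ nat q"
      using rs(2) powi_ratio_eq_iff [of l 1 1 "r * s" q] nz True by simp
    \<comment> \<open>So \<open>r\<close> may differ from a unit, but only by primes of
      \<open>l\<close>, and is absorbed into the \<open>l\<close>-number.\<close>
    then have "r dvd l ^ nat (- q)" by (simp add: mult.assoc)
    then have r: "n_number_int l r" using n_number_int_dvd [OF l] by blast
    have "r * k1 * l ^ nat (- p) = k2 * l ^ nat p"
      using rk(2) powi_ratio_eq_iff [of l 1 "r * k1" k2 p] nz True by simp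
    then have "(of_int (r * k1 * l ^ nat (- p)) :: rat) = of_int (k2 * l ^ nat p)" by (simp only:)
    then have "(of_int k1 / of_int k2 :: rat) = of_int (l ^ nat p) / of_int (r * l ^ nat (- p))"
      using assms(4) r nz by (simp add: n_number_int_def field_simps)
    then show ?thesis
      using n_number_ratI [OF l n_number_int_mult [OF r l]] True by blast
  next
    case False
    then have "m > 1" using assms(2) by simp
    \<comment> \<open>Neither \<open>l\<close> nor \<open>m\<close> is a unit here, so
      \<open>a\<close> is conjugate to no other power of itself.\<close>
    then have "r * s = 1" using rs(1) assms(1) by auto
    then have r: "r = 1 \<or> r = -1" using zmult_eq_1_iff by blast
    show ?thesis
    proof (cases "r * k1 = k2 \<or> p = 0")
      case True
      then have "(of_int (r * k1) :: rat) = of_int k2" using rk(2) by auto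
      then have "r * k1 = k2" by (simp only: of_int_eq_iff)
      then show ?thesis using r assms(3,4) by auto
    next
      case False
      then have "gcd l m dvd r * k1" "gcd l m dvd k2"
        using rk(1) by (meson dvd_trans gcd_dvd1 gcd_dvd2)+
      moreover have "of_int k1 / of_int k2 = (of_int l / of_int m :: rat) powi p \<or>
          of_int k1 / of_int k2 = - ((of_int l / of_int m :: rat) powi p)"
        using r
      proof
        assume "r = 1"
        then show ?thesis using rk(2) assms(4) by (simp add: divide_simps)
      next
        assume "r = -1"
        then have "(of_int k1 :: rat) = - (of_int k2 * (of_int l / of_int m) powi p)"
          using rk(2) by (simp add: minus_equation_iff)
        then show ?thesis using assms(4) by (simp add: divide_simps)
      qed
      ultimately show ?thesis using r False \<open>m > 1\<close> by auto
    qed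
  qed
qed

lemma G_iso_if_power_ratio:
  assumes "m > 0" "l \<noteq> 0" "k2 > 0" "gcd l m dvd k1" "gcd l m dvd k2"
    "of_int k1 / of_int k2 = (of_int l / of_int m :: rat) powi p \<or>
     of_int k1 / of_int k2 = - ((of_int l / of_int m :: rat) powi p)"
  shows "G l m k1 \<cong> G l m k2"
proof -
  obtain k2' where k2': "k2' = k2 \<or> k2' = - k2"
    "(of_int k1 :: rat) = of_int k2' * (of_int l / of_int m) powi p"
  proof (cases "of_int k1 / of_int k2 = (of_int l / of_int m :: rat) powi p")
    case True
    then show ?thesis using assms(3) by (intro that [of k2]) (auto simp: field_simps)
  next
    case False
    then show ?thesis using assms(3,6) by (intro that [of "- k2"]) (auto simp: field_simps)
  qed
  have eq: "k1 * m ^ nat p * l ^ nat (- p) = k2' * l ^ nat p * m ^ nat (- p)"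
    using powi_ratio_eq_iff [of l m k1 k2' p] assms(1,2) k2'(2) by simp
  show ?thesis
  proof (cases "p \<ge> 0")
    case True
    then have "k1 * m ^ nat p = k2 * l ^ nat p \<or> k1 * m ^ nat p = - (k2 * l ^ nat p)"
      using eq k2'(1) by auto
    then show ?thesis using assms by (intro G_iso_ratio) auto
  next
    \<comment> \<open>For negative \<open>p\<close> the roles of \<open>k1\<close> and
      \<open>k2\<close> are exchanged.\<close>
    case False
    then have "k2 * m ^ nat (- p) = k1 * l ^ nat (- p) \<or> k2 * m ^ nat (- p) = - (k1 * l ^ nat (- p))"
      using eq k2'(1) by auto
    then have "G l m k2 \<cong> G l m k1" using assms by (intro G_iso_ratio) auto
    then show ?thesis by (rule G_iso_sym)
  qed
qed

lemma G_iso_if_n_number_ratio: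
  assumes "k1 > 0" "k2 > 0" "n_number_rat l (of_int k1 / of_int k2)"
  shows "G l 1 k1 \<cong> G l 1 k2"
proof -
  obtain x y where xy: "quotient_of (of_int k1 / of_int k2) = (x, y)" by force
  have y: "y > 0" and cop: "coprime x y" and q: "(of_int k1 / of_int k2 :: rat) = of_int x / of_int y"
    using quotient_of_denom_pos [OF xy] quotient_of_coprime [OF xy] quotient_of_div [OF xy] by auto
  have "(of_int (k1 * y) :: rat) = of_int (k2 * x)"
    using q assms y by (simp add: field_simps)
  then have eq: "k1 * y = k2 * x" by (simp only: of_int_eq_iff)
  have x: "x > 0" using eq assms(1,2) y by (metis mult_pos_pos zero_less_mult_pos)
  have "x dvd k1 * y" using eq by simp
  \<comment> \<open>Both groups are isomorphic to \<open>G l 1 g\<close>, as \<open>k1 = x g\<close>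
    and \<open>k2 = y g\<close> with \<open>x\<close> and \<open>y\<close> composed of primes of
    \<open>l\<close>.\<close>
  then obtain g where g: "k1 = x * g" using cop coprime_dvd_mult_left_iff by blast
  have "k2 = y * g" using eq x by (simp add: g mult_ac)
  moreover have "\<And>p. prime p \<Longrightarrow> p dvd x \<Longrightarrow> p dvd l" "\<And>p. prime p \<Longrightarrow> p dvd y \<Longrightarrow> p dvd l"
    using assms(3) xy by (auto simp: n_number_rat_def n_number_int_def)
  ultimately show ?thesis
    using iso_trans [OF G_iso_n_number [OF x] G_iso_sym [OF G_iso_n_number [OF y]]] g by metis
qed

theorem mainTheorem3:
  fixes l m k1 k2 :: int
  assumes "\<bar>l\<bar> > m" and "m > 0" and "k1 > 0" and "k2 > 0"
  shows "G l m k1 \<cong> G l m k2 \<longleftrightarrow>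
           (k1 = k2
            \<or> (m > 1 \<and> gcd l m dvd k1 \<and> gcd l m dvd k2 \<and>
                (\<exists>p::int. p \<noteq> 0 \<and>
                   (of_int k1 / of_int k2 = (of_int l / of_int m :: rat) powi p \<or>
                    of_int k1 / of_int k2 = - ((of_int l / of_int m :: rat) powi p))))
            \<or> (m = 1 \<and> n_number_rat l (of_int k1 / of_int k2)))"
  (is "?iso \<longleftrightarrow> ?same \<or> ?power \<or> ?n_number")
proof
  assume ?iso
  then show "?same \<or> ?power \<or> ?n_number" by (rule parameters_if_G_iso [OF assms])
next
  assume "?same \<or> ?power \<or> ?n_number"
  then show ?iso
  proof (elim disjE)
    assume ?same
    then show ?iso using is_isoI [OF iso_set_refl] by simp
  next
    assume ?power
    moreover have "l \<noteq> 0" using assms by auto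
    ultimately show ?iso using assms G_iso_if_power_ratio by blast
  next
    assume ?n_number
    then show ?iso using assms G_iso_if_n_number_ratio by auto
  qed
qed

end
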